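(* Let $\mathbb{K}$ be an algebraically closed field, let $G$ be a forest on the vertex set $[n]$, and let $d\geq 1$. Let $R=\mathbb{K}[x_{i,j}: i\in[n], j\in[d]]$. Then $$\mathrm{v}(L_G^{\mathbb{K}}(d))\leq \operatorname{reg}(R/L_G^{\mathbb{K}}(d)).$$
   Context: $[n]=\{1,\dots,n\}$ and $R$ has the standard grading. The Lovász–Saks–Schrijver ideal of $G$ in dimension $d$ is $$L_G^{\mathbb{K}}(d)=\Big(\sum_{k=1}^d x_{i,k}x_{j,k} : \{i,j\}\in E(G)\Big)\subset R .$$ For a graded ideal $I\subset R$, the $\mathrm{v}$-number is $\mathrm{v}(I)=\min\{e\ge 0:\exists f\in R_e \text{ and } \mathfrak p\in\mathrm{Ass}(I) \text{ with } I:f=\mathfrak p\}$. $\operatorname{reg}$ denotes Castelnuovo–Mumford regularity: $\operatorname{reg}(R/I)=\max\{j-i:\beta_{i,j}(R/I)\neq 0\}$, with $\beta_{i,j}$ the graded Betti numbers over $R$. *)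

theory Defs
  imports
    "HOL-Library.Poly_Mapping"
    "HOL-Library.Extended_Real"
    "HOL-Algebra.Ideal"
    "Jordan_Normal_Form.Matrix_Kernel"
begin

section \<open>Forests\<close>

text \<open>
  A simple graph with vertex set \<^term>\<open>UNIV :: 'n set\<close> is given by its set of edges.
\<close>

definition simple_graph :: "'n::finite set set \<Rightarrow> bool" where
  "simple_graph E \<longleftrightarrow> (\<forall>e\<in>E. card e = 2)"

text \<open>\<open>vs\<close> lists the vertices of a cycle once each, in cyclic order.\<close>

definition graph_cycle :: "'n::finite set set \<Rightarrow> 'n list \<Rightarrow> bool" where
  "graph_cycle E vs \<longleftrightarrow>
     3 \<le> length vs \<and> distinct vs \<and>
     (\<forall>i<length vs. {vs ! i, vs ! (Suc i mod length vs)} \<in> E)"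

definition forest :: "'n::finite set set \<Rightarrow> bool" where
  "forest E \<longleftrightarrow> simple_graph E \<and> (\<nexists>vs. graph_cycle E vs)"

section \<open>The standard graded polynomial ring\<close>

text \<open>
  The polynomial ring over \<open>'k\<close> in the variables \<open>'v\<close>: a polynomial maps exponent vectors to
  coefficients. The whole type is the ring; as a record for \<^theory>\<open>HOL-Algebra.Ideal\<close> it
  is \<open>class_ring\<close>.
\<close>

type_synonym ('v, 'k) mpoly = "('v \<Rightarrow>\<^sub>0 nat) \<Rightarrow>\<^sub>0 'k"

definition Var :: "'v \<Rightarrow> ('v, 'k::comm_ring_1) mpoly" where
  "Var v = Poly_Mapping.single (Poly_Mapping.single v 1) 1"

definition monom_degree :: "('v \<Rightarrow>\<^sub>0 nat) \<Rightarrow> nat" where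
  "monom_degree m = (\<Sum>v\<in>Poly_Mapping.keys m. Poly_Mapping.lookup m v)"

text \<open>
  The graded component of degree \<open>e - a\<close>, which is \<open>0\<close> when \<open>e < a\<close>. The offset \<open>a\<close> is used
  for maps between the shifted free modules \<open>R(-a)\<close>; with \<open>a = 0\<close> this is \<open>R\<^sub>e\<close>.
\<close>

definition homogeneous_diff :: "nat \<Rightarrow> nat \<Rightarrow> ('v, 'k::comm_ring_1) mpoly set" where
  "homogeneous_diff e a = {f. \<forall>m\<in>Poly_Mapping.keys f. monom_degree m + a = e}"

abbreviation homogeneous :: "nat \<Rightarrow> ('v, 'k::comm_ring_1) mpoly set" where
  "homogeneous e \<equiv> homogeneous_diff e 0"

definition irrelevant_ideal :: "('v, 'k::comm_ring_1) mpoly set" where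
  "irrelevant_ideal = genideal class_ring (range Var)"

section \<open>The v-number\<close>

definition colon :: "('v, 'k::comm_ring_1) mpoly set \<Rightarrow> ('v, 'k) mpoly \<Rightarrow> ('v, 'k) mpoly set"
  where "colon I f = {g. g * f \<in> I}"

text \<open>\<open>colon I h\<close> is the annihilator of the class of \<open>h\<close> in \<open>R/I\<close>, so these are the associated
  primes of \<open>R/I\<close>.\<close>

definition Ass :: "('v, 'k::comm_ring_1) mpoly set \<Rightarrow> ('v, 'k) mpoly set set" where
  "Ass I = {P. primeideal P class_ring \<and> (\<exists>h. P = colon I h)}"

definition v_number :: "('v, 'k::comm_ring_1) mpoly set \<Rightarrow> nat" where
  "v_number I = (LEAST e. \<exists>f\<in>homogeneous e. \<exists>P\<in>Ass I. colon I f = P)"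

section \<open>Graded Betti numbers and regularity\<close>

definition mat_image :: "'a::comm_ring_1 mat \<Rightarrow> 'a vec set" where
  "mat_image A = (\<lambda>v. A *\<^sub>v v) ` carrier_vec (dim_col A)"

text \<open>
  A graded free resolution \<open>\<dots> \<rightarrow> F\<^sub>2 \<rightarrow> F\<^sub>1 \<rightarrow> F\<^sub>0 \<rightarrow> R/I \<rightarrow> 0\<close> by modules of finite rank.
  The list \<open>s i\<close> contains the degrees of the basis of \<open>F\<^sub>i\<close>, that is, \<open>F\<^sub>i\<close> is the direct sum of
  the modules \<open>R(- (s i ! k))\<close>. The map from \<open>F\<^sub>i\<^sub>+\<^sub>1\<close> to \<open>F\<^sub>i\<close> is the matrix \<open>\<phi> i\<close>, and the
  augmentation sends the \<open>k\<close>-th basis element of \<open>F\<^sub>0\<close> to the class of \<open>\<epsilon> $ k\<close>.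
  Both are homogeneous of degree \<open>0\<close>.
\<close>

definition graded_free_resolution ::
  "('v, 'k::comm_ring_1) mpoly set \<Rightarrow> (nat \<Rightarrow> nat list) \<Rightarrow> (nat \<Rightarrow> ('v, 'k) mpoly mat) \<Rightarrow>
   ('v, 'k) mpoly vec \<Rightarrow> bool" where
  "graded_free_resolution I s \<phi> \<epsilon> \<longleftrightarrow>
     \<epsilon> \<in> carrier_vec (length (s 0)) \<and>
     (\<forall>k<length (s 0). \<epsilon> $ k \<in> homogeneous (s 0 ! k)) \<and>
     (\<forall>i. \<phi> i \<in> carrier_mat (length (s i)) (length (s (Suc i)))) \<and>
     (\<forall>i. \<forall>r<length (s i). \<forall>c<length (s (Suc i)).
        \<phi> i $$ (r, c) \<in> homogeneous_diff (s (Suc i) ! c) (s i ! r)) \<and>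
     (\<forall>f. \<exists>v\<in>carrier_vec (length (s 0)). f - \<epsilon> \<bullet> v \<in> I) \<and>
     {v \<in> carrier_vec (length (s 0)). \<epsilon> \<bullet> v \<in> I} = mat_image (\<phi> 0) \<and>
     (\<forall>i. mat_kernel (\<phi> i) = mat_image (\<phi> (Suc i)))"

text \<open>Minimality: the image of \<open>F\<^sub>i\<^sub>+\<^sub>1\<close> lies in \<open>\<mm> F\<^sub>i\<close>, with \<open>\<mm>\<close> the ideal of the variables.\<close>

definition minimal_graded_free_resolution ::
  "('v, 'k::comm_ring_1) mpoly set \<Rightarrow> (nat \<Rightarrow> nat list) \<Rightarrow> (nat \<Rightarrow> ('v, 'k) mpoly mat) \<Rightarrow>
   ('v, 'k) mpoly vec \<Rightarrow> bool" where
  "minimal_graded_free_resolution I s \<phi> \<epsilon> \<longleftrightarrow>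
     graded_free_resolution I s \<phi> \<epsilon> \<and>
     (\<forall>i. \<forall>r<length (s i). \<forall>c<length (s (Suc i)). \<phi> i $$ (r, c) \<in> irrelevant_ideal)"

text \<open>
  \<open>\<beta>\<^sub>i\<^sub>,\<^sub>j(R/I)\<close>: the number of basis elements of degree \<open>j\<close> in \<open>F\<^sub>i\<close>. For a homogeneous ideal of a
  polynomial ring in finitely many variables over a field, a minimal graded free resolution
  exists and its degrees do not depend on the choice.
\<close>

definition graded_betti :: "('v, 'k::comm_ring_1) mpoly set \<Rightarrow> nat \<Rightarrow> nat \<Rightarrow> nat" where
  "graded_betti I i j =
     count_list ((SOME s. \<exists>\<phi> \<epsilon>. minimal_graded_free_resolution I s \<phi> \<epsilon>) i) j"

text \<open>
  \<open>reg(R/I)\<close>. Only finitely many Betti numbers are nonzero (in the situation above), so the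
  supremum is the maximum; it is \<open>-\<infinity>\<close> for \<open>R/I = 0\<close>.
\<close>

definition reg_quotient :: "('v, 'k::comm_ring_1) mpoly set \<Rightarrow> ereal" where
  "reg_quotient I = Sup {ereal (real j - real i) | i j. graded_betti I i j \<noteq> 0}"

section \<open>Lov\'asz--Saks--Schrijver ideals\<close>

definition lss_ideal :: "'n::finite set set \<Rightarrow> ('n \<times> 'd::finite, 'k::field) mpoly set" where
  "lss_ideal E =
     genideal class_ring {\<Sum>k\<in>UNIV. Var (i, k) * Var (j, k) | i j. {i, j} \<in> E}"

end

theory Submission
  imports Defs "HOL-Library.Function_Algebras"
begin

text \<open>
  Let \<open>d\<close> be the number of coordinates, \<open>L\<close> the ideal, and \<open>B\<close> the set of vertices of degree at least \<open>d\<close>.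
  For \<open>d \<ge> 2\<close> both sides are compared with \<open>|B|\<close>.

  Upper bound: the key point is that a variable \<open>x\<^sub>v\<^sub>k\<close> is a nonzerodivisor modulo \<open>L\<close> if \<open>v \<notin> B\<close>, and that
  \<open>x\<^sub>v\<^sub>k\<^sup>2 h \<in> L\<close> implies \<open>x\<^sub>v\<^sub>k h \<in> L\<close> for every \<open>v\<close>. Hence the product \<open>f\<close> of the \<open>x\<^sub>v\<^sub>k\<close> with \<open>v \<in> B\<close>, for one
  fixed \<open>k\<close>, satisfies \<open>L : f = L : f\<^sup>\<infinity>\<close>. This is the ideal of the closure of the orthogonal representations
  with all \<open>x\<^sub>v\<^sub>k \<noteq> 0\<close>, which is prime because such representations are parametrized vertex by vertex.

  Lower bound: Koszul homology survives the addition of a leaf, and if the neighbour \<open>u\<close> of the leaf had degree less than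
  \<open>d\<close> before, then the new quadric is regular modulo the old ones and raises the regularity by one. Since \<open>B\<close> only
  grows in the second case, leaf induction gives a class in \<open>Tor\<^sub>N(R/L, K)\<^sub>2\<^sub>N\<close> for some \<open>N \<ge> |B|\<close>.

  For \<open>d = 1\<close> the product of an independent set \<open>A\<close> whose neighbours form a vertex cover takes the role of
  \<open>f\<close>, and \<open>A\<close> is built along an induced matching.
\<close>

section \<open>Ideals of a commutative ring\<close>

text \<open>The threshold d in the definition of \<open>B\<close> is a dimension count: setting the
  vector at v to zero costs d conditions and makes the deg v quadrics at v vanish, so it can create
  further components of the zero set as soon as deg v \<ge> d. The monomial \<open>f\<close> removes
  exactly these components. The case d = 1 needs another \<open>f\<close>: every nonisolated vertex
  then lies in \<open>B\<close>, so if there is an edge, the product over \<open>B\<close> is a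
  multiple of a generator and its colon ideal is the whole ring. For the regularity a single nonzero
  Betti number in position (N, 2N) suffices. The Betti numbers are read off a minimal resolution
  picked by \<open>SOME\<close>, which shapes two parts of the proof: a minimal graded free
  resolution has to be constructed, so that the pick is a resolution, and the Koszul argument has to
  apply to whatever resolution is picked. Quotient rings are avoided throughout: statements about
  R/L are membership statements in L.\<close>

interpretation idl: Modules.module "(*) :: 'a::comm_ring_1 \<Rightarrow> 'a \<Rightarrow> 'a"
  by unfold_locales (simp_all add: algebra_simps)

declare idl.scale_scale [simp del] \<comment> \<open>reversed associativity, which loops with \<open>mult_ac\<close>\<close>

lemma ideal_class_ring_iff:
  "ideal I (class_ring :: 'a::comm_ring_1 ring) \<longleftrightarrow> idl.subspace I"
proof
  assume "ideal I (class_ring :: 'a ring)"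
  then interpret ideal I "class_ring :: 'a ring" .
  show "idl.subspace I"
    using zero_closed a_closed I_l_closed
    by (auto simp: idl.subspace_def)
next
  assume *: "idl.subspace I"
  interpret R: ring "class_ring :: 'a ring" by (rule class_ring.ring_axioms)
  show "ideal I (class_ring :: 'a ring)"
  proof (rule idealI)
    show "ring (class_ring :: 'a ring)" by (rule class_ring.ring_axioms)
    have "inv\<^bsub>add_monoid class_ring\<^esub> a = - a" for a :: 'a
      using class_ring_simps(8) unfolding a_inv_def by metis
    then show "subgroup I (add_monoid (class_ring :: 'a ring))"
      using * idl.subspace_neg[OF *]
      by (intro group.subgroupI[OF abelian_group.a_group[OF class_ring.is_abelian_group]])
         (auto simp: idl.subspace_def)
  next
    fix a x :: 'a
    assume "a \<in> I"
    then show "x \<otimes>\<^bsub>class_ring\<^esub> a \<in> I" "a \<otimes>\<^bsub>class_ring\<^esub> x \<in> I"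
      using idl.subspace_scale[OF *, of a x] by (simp_all add: mult.commute)
  qed
qed

lemma genideal_class_ring: "genideal (class_ring :: 'a::comm_ring_1 ring) S = idl.span S"
  unfolding genideal_def ideal_class_ring_iff idl.span_def hull_def by simp

lemma primeideal_class_ringI:
  fixes P :: "'a::comm_ring_1 set"
  assumes "idl.subspace P" "1 \<notin> P" "\<And>a b. a * b \<in> P \<Longrightarrow> a \<in> P \<or> b \<in> P"
  shows "primeideal P class_ring"
  using assms by (intro primeidealI) (auto simp: ideal_class_ring_iff class_cring.is_cring)

section \<open>Polynomials\<close>

abbreviation coef :: "('v, 'k::zero) mpoly \<Rightarrow> ('v \<Rightarrow>\<^sub>0 nat) \<Rightarrow> 'k" where
  "coef \<equiv> Poly_Mapping.lookup"

abbreviation expo :: "('v \<Rightarrow>\<^sub>0 nat) \<Rightarrow> 'v \<Rightarrow> nat" where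
  "expo \<equiv> Poly_Mapping.lookup"

definition Const :: "'k \<Rightarrow> ('v, 'k::comm_ring_1) mpoly" where
  "Const c = Poly_Mapping.single 0 c"

lemma poly_mapping_add_induct [case_names zero single add]:
  assumes "P 0" "\<And>m c. P (Poly_Mapping.single m c)" "\<And>p q. P p \<Longrightarrow> P q \<Longrightarrow> P (p + q)"
  shows "P (p :: 'a \<Rightarrow>\<^sub>0 'b::comm_monoid_add)"
proof (induction p rule: update_induct)
  case const
  show ?case by (rule assms)
next
  case (update f a b)
  have "Poly_Mapping.update a b f = f + Poly_Mapping.single a b"
    using update by (intro poly_mapping_eqI) (auto simp: lookup_update lookup_add lookup_single in_keys_iff)
  then show ?case using assms update by metis
qed

lemma single_add_split: "Poly_Mapping.single (m + n) c = Poly_Mapping.single m c * (Poly_Mapping.single n 1 :: ('v, 'k::comm_ring_1) mpoly)"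
  by (simp add: mult_single)

lemma Var_power: "(Var v :: ('v, 'k::comm_ring_1) mpoly) ^ n = Poly_Mapping.single (Poly_Mapping.single v n) 1"
  by (induction n) (simp_all add: Var_def mult_single single_add[symmetric])

lemma mpoly_induct [case_names Const Var add mult]:
  fixes p :: "('v, 'k::comm_ring_1) mpoly"
  assumes C: "\<And>c. P (Const c)" and V: "\<And>v. P (Var v)"
    and A: "\<And>p q. P p \<Longrightarrow> P q \<Longrightarrow> P (p + q)" and M: "\<And>p q. P p \<Longrightarrow> P q \<Longrightarrow> P (p * q)"
  shows "P p"
proof (induction p rule: poly_mapping_add_induct)
  case zero
  show ?case using C[of 0] by (simp add: Const_def)
next
  case (single m c)
  have pw: "P (Var v ^ n)" for v n
  proof (induction n)
    case 0
    show ?case using C[of 1] by (simp add: Const_def)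
  qed (simp add: M V)
  show ?case
  proof (induction m rule: poly_mapping_add_induct)
    case zero
    show ?case using C[of c] by (simp add: Const_def)
  next
    case (single v n)
    have "P (Const c * Var v ^ n)" by (intro M C pw)
    then show ?case by (simp add: Const_def Var_power mult_single)
  next
    case (add m n)
    show ?case
    proof (cases "P (Poly_Mapping.single n 1)")
      case True
      then show ?thesis using M[OF add(1)] by (simp add: single_add_split)
    next
      case False
      have "P (Poly_Mapping.single n 1)"
      proof (induction n rule: poly_mapping_add_induct)
        case zero
        show ?case using C[of 1] by (simp add: Const_def)
      next
        case (single v n)
        then show ?case using pw[of v n] by (simp add: Var_power)
      next
        case (add m n)
        then show ?case using M[OF add] by (simp add: mult_single)
      qed
      then show ?thesis using False by simp
    qed
  qed
next
  case (add p q)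
  then show ?case by (rule A)
qed

lemma Const_simps [simp]:
  "Const 0 = 0" "Const 1 = 1" "Const (a + b) = Const a + Const b" "Const (a * b) = Const a * Const b"
  by (simp_all add: Const_def single_add mult_single)

text \<open>The exponents over an unordered set of variables embed into those over the ordered variables \<^typ>\<open>nat\<close>.\<close>

definition var_index :: "'v::finite \<Rightarrow> nat" where
  "var_index = (SOME f. bij_betw f UNIV {..<card (UNIV :: 'v set)})"

lemma bij_var_index: "bij_betw (var_index :: 'v::finite \<Rightarrow> nat) UNIV {..<card (UNIV :: 'v set)}"
proof -
  have "\<exists>f. bij_betw f (UNIV :: 'v set) {..<card (UNIV :: 'v set)}"
    using ex_bij_betw_finite_nat[of "UNIV :: 'v set"] by (simp add: atLeast0LessThan)
  then show ?thesis unfolding var_index_def by (rule someI_ex)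
qed

lemma inj_var_index: "inj var_index"
  using bij_var_index by (rule bij_betw_imp_inj_on)

definition nat_expo :: "('v::finite \<Rightarrow>\<^sub>0 nat) \<Rightarrow> nat \<Rightarrow>\<^sub>0 nat" where
  "nat_expo m = (\<Sum>v\<in>UNIV. Poly_Mapping.single (var_index v) (expo m v))"

lemma nat_expo_add: "nat_expo (m + n) = nat_expo m + nat_expo n"
  by (simp add: nat_expo_def lookup_add single_add sum.distrib)

lemma lookup_nat_expo: "Poly_Mapping.lookup (nat_expo m) (var_index v) = expo m v"
  by (simp add: nat_expo_def lookup_sum lookup_single when_def inj_eq[OF inj_var_index])

lemma inj_nat_expo: "inj nat_expo"
  by (rule injI) (metis lookup_nat_expo poly_mapping_eqI)

definition nat_poly :: "('v::finite, 'k::comm_ring_1) mpoly \<Rightarrow> (nat, 'k) mpoly" where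
  "nat_poly p = (\<Sum>m\<in>Poly_Mapping.keys p. Poly_Mapping.single (nat_expo m) (coef p m))"

lemma nat_poly_superset:
  "finite S \<Longrightarrow> Poly_Mapping.keys p \<subseteq> S \<Longrightarrow> nat_poly p = (\<Sum>m\<in>S. Poly_Mapping.single (nat_expo m) (coef p m))"
  unfolding nat_poly_def by (rule sum.mono_neutral_left) (auto simp: in_keys_iff)

lemma nat_poly_single: "nat_poly (Poly_Mapping.single m c) = Poly_Mapping.single (nat_expo m) c"
  by (subst nat_poly_superset[of "{m}"]) auto

lemma nat_poly_add: "nat_poly (p + q) = nat_poly p + nat_poly q"
proof -
  let ?S = "Poly_Mapping.keys p \<union> Poly_Mapping.keys q"
  have "Poly_Mapping.keys (p + q) \<subseteq> ?S" by (rule keys_add)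
  then show ?thesis
    by (simp add: nat_poly_superset[of ?S] lookup_add single_add sum.distrib)
qed

lemma nat_poly_mult: "nat_poly (p * q) = nat_poly p * nat_poly q"
proof (induction p rule: poly_mapping_add_induct)
  case (single m c)
  show ?case
    by (induction q rule: poly_mapping_add_induct)
       (simp_all add: mult_single nat_poly_single nat_poly_add nat_expo_add distrib_left, simp_all add: nat_poly_def)
qed (simp_all add: distrib_right nat_poly_add, simp add: nat_poly_def)

lemma nat_poly_eq_0D: assumes "nat_poly p = 0" shows "p = 0"
proof (rule poly_mapping_eqI)
  fix n
  have "coef p n = Poly_Mapping.lookup (nat_poly p) (nat_expo n)"
    by (auto simp: nat_poly_def lookup_sum lookup_single when_def inj_eq[OF inj_nat_expo] in_keys_iff)
  then show "coef p n = coef 0 n" by (simp add: assms)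
qed

text \<open>Over the ordered exponents \<open>nat \<Rightarrow>\<^sub>0 nat\<close> leading terms
  multiply, so zero divisors are excluded after the embedding \<open>nat_poly\<close>.\<close>

lemma mpoly_mult_eq_0D:
  fixes p q :: "('v::finite, 'k::idom) mpoly"
  assumes "p * q = 0" shows "p = 0 \<or> q = 0"
proof -
  have "nat_poly p * nat_poly q = 0"
    using assms nat_poly_mult[of p q] by (simp add: nat_poly_def[of 0])
  then show ?thesis using nat_poly_eq_0D by auto
qed

lemma Var_nonzero: "(Var v :: ('v, 'k::comm_ring_1) mpoly) \<noteq> 0"
  unfolding Var_def by (metis keys_single keys_zero insert_not_empty zero_neq_one)

subsection \<open>Substitution\<close>

definition mono_subst :: "('v::finite \<Rightarrow> ('v, 'k::comm_ring_1) mpoly) \<Rightarrow> ('v \<Rightarrow>\<^sub>0 nat) \<Rightarrow> ('v, 'k) mpoly" where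
  "mono_subst f m = (\<Prod>v\<in>UNIV. f v ^ expo m v)"

text \<open>All substitutions needed (setting variables to zero, rescaling, parametrizing,
  evaluating at a point with constant coordinates) are endomorphisms of one ring, so no change of
  variable type is provided for.\<close>

definition poly_subst :: "('v::finite \<Rightarrow> ('v, 'k::comm_ring_1) mpoly) \<Rightarrow> ('v, 'k) mpoly \<Rightarrow> ('v, 'k) mpoly" where
  "poly_subst f p = (\<Sum>m\<in>Poly_Mapping.keys p. Const (coef p m) * mono_subst f m)"

lemma poly_subst_superset:
  "finite S \<Longrightarrow> Poly_Mapping.keys p \<subseteq> S \<Longrightarrow> poly_subst f p = (\<Sum>m\<in>S. Const (coef p m) * mono_subst f m)"
  unfolding poly_subst_def by (rule sum.mono_neutral_left) (auto simp: in_keys_iff)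

lemma poly_subst_single: "poly_subst f (Poly_Mapping.single m c) = Const c * mono_subst f m"
  by (subst poly_subst_superset[of "{m}"]) auto

lemma poly_subst_zero [simp]: "poly_subst f 0 = 0"
  by (simp add: poly_subst_def)

lemma poly_subst_add [simp]: "poly_subst f (p + q) = poly_subst f p + poly_subst f q"
proof -
  let ?S = "Poly_Mapping.keys p \<union> Poly_Mapping.keys q"
  have "Poly_Mapping.keys (p + q) \<subseteq> ?S" by (rule keys_add)
  then show ?thesis
    by (simp add: poly_subst_superset[of ?S] lookup_add sum.distrib distrib_right)
qed

lemma mono_subst_add: "mono_subst f (m + n) = mono_subst f m * mono_subst f n"
  by (simp add: mono_subst_def lookup_add power_add prod.distrib)

lemma poly_subst_mult [simp]: "poly_subst f (p * q) = poly_subst f p * poly_subst f q"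
proof (induction p rule: poly_mapping_add_induct)
  case (single m c)
  show ?case
  proof (induction q rule: poly_mapping_add_induct)
    case (single n d)
    have "poly_subst f (Poly_Mapping.single m c * Poly_Mapping.single n d)
        = (Const c * Const d) * (mono_subst f m * mono_subst f n)"
      by (simp add: mult_single poly_subst_single mono_subst_add)
    then show ?case by (simp add: poly_subst_single algebra_simps)
  qed (simp_all add: distrib_left)
qed (simp_all add: distrib_right)

lemma poly_subst_Const [simp]: "poly_subst f (Const c) = Const c"
  by (simp add: Const_def poly_subst_single mono_subst_def)

lemma poly_subst_one [simp]: "poly_subst f 1 = 1"
  using poly_subst_Const[of f 1] by simp

lemma poly_subst_Var [simp]: "poly_subst f (Var v) = f v"
proof -
  have "(\<Prod>w\<in>UNIV. f w ^ expo (Poly_Mapping.single v 1) w) = f v ^ 1 * (\<Prod>w\<in>UNIV-{v}. f w ^ 0)"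
    by (subst prod.remove[of UNIV v]) (simp_all add: lookup_single when_def)
  then show ?thesis by (simp add: Var_def poly_subst_single mono_subst_def)
qed

lemma poly_subst_uminus [simp]: "poly_subst f (- p) = - poly_subst f p"
proof -
  have "poly_subst f (- p) + poly_subst f p = poly_subst f (- p + p)"
    by (rule poly_subst_add[symmetric])
  then show ?thesis by (simp add: eq_neg_iff_add_eq_0)
qed

lemma poly_subst_diff [simp]: "poly_subst f (p - q) = poly_subst f p - poly_subst f q"
  using poly_subst_add[of f p "- q"] by simp

lemma poly_subst_sum [simp]: "poly_subst f (sum g A) = (\<Sum>x\<in>A. poly_subst f (g x))"
  by (induction A rule: infinite_finite_induct) auto

lemma poly_subst_prod [simp]: "poly_subst f (prod g A) = (\<Prod>x\<in>A. poly_subst f (g x))"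
  by (induction A rule: infinite_finite_induct) auto

lemma poly_subst_power [simp]: "poly_subst f (p ^ n) = poly_subst f p ^ n"
  by (induction n) auto

lemma poly_subst_span:
  assumes "p \<in> idl.span S" "\<And>g. g \<in> S \<Longrightarrow> poly_subst f g \<in> idl.span T"
  shows "poly_subst f p \<in> idl.span T"
  using assms(1)
proof (induction rule: idl.span_induct_alt)
  case base
  show ?case by (simp add: idl.span_zero)
next
  case (step c x y)
  then show ?case by (simp add: idl.span_add idl.span_scale assms(2))
qed

subsection \<open>Gradings\<close>

text \<open>Arbitrary integer weights: besides the total degree, the degree in the variables of one
  vertex and weights with values 1 and -1 given by a colouring occur.\<close>

definition wt :: "('v::finite \<Rightarrow> int) \<Rightarrow> ('v \<Rightarrow>\<^sub>0 nat) \<Rightarrow> int" where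
  "wt W m = (\<Sum>v\<in>UNIV. W v * int (expo m v))"

definition homog :: "('v::finite \<Rightarrow> int) \<Rightarrow> int \<Rightarrow> ('v, 'k::comm_ring_1) mpoly \<Rightarrow> bool" where
  "homog W j p \<longleftrightarrow> (\<forall>m\<in>Poly_Mapping.keys p. wt W m = j)"

definition hom_comp :: "('v::finite \<Rightarrow> int) \<Rightarrow> int \<Rightarrow> ('v, 'k::comm_ring_1) mpoly \<Rightarrow> ('v, 'k) mpoly" where
  "hom_comp W j p = Poly_Mapping.mapp (\<lambda>m c. if wt W m = j then c else 0) p"

lemma coef_comp: "coef (hom_comp W j p) m = (if wt W m = j then coef p m else 0)"
  by (simp add: hom_comp_def lookup_mapp when_def in_keys_iff)

lemma homog_iff: "homog W j p \<longleftrightarrow> (\<forall>m. coef p m \<noteq> 0 \<longrightarrow> wt W m = j)"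
  by (auto simp: homog_def in_keys_iff)

lemma wt_add: "wt W (m + n) = wt W m + wt W n"
  by (simp add: wt_def lookup_add distrib_left sum.distrib)

lemma wt_zero [simp]: "wt W 0 = 0"
  by (simp add: wt_def)

lemma wt_single [simp]: "wt W (Poly_Mapping.single v n) = W v * int n"
proof -
  have "(\<Sum>w\<in>UNIV. W w * int (expo (Poly_Mapping.single v n) w)) = (\<Sum>w\<in>UNIV. if v = w then W v * int n else 0)"
    by (rule sum.cong) (auto simp: lookup_single when_def)
  then show ?thesis by (simp add: wt_def)
qed

lemma homog_zero [simp]: "homog W j 0"
  by (simp add: homog_def)

lemma homog_single: "homog W (wt W m) (Poly_Mapping.single m c)"
  by (simp add: homog_iff lookup_single when_def)

lemma homog_Const [simp]: "homog W 0 (Const c)"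
  using homog_single[of W 0 c] by (simp add: Const_def)

lemma homog_one [simp]: "homog W 0 1"
  using homog_Const[of W 1] by simp

lemma homog_Var: "W v = j \<Longrightarrow> homog W j (Var v)"
  using homog_single[of W "Poly_Mapping.single v 1" 1] by (simp add: Var_def)

lemma homog_add: "homog W j p \<Longrightarrow> homog W j q \<Longrightarrow> homog W j (p + q)"
  unfolding homog_iff by (metis lookup_add add.right_neutral)

lemma homog_uminus: "homog W j p \<Longrightarrow> homog W j (- p)"
  by (simp add: homog_iff)

lemma homog_diff: "homog W j p \<Longrightarrow> homog W j q \<Longrightarrow> homog W j (p - q)"
  using homog_add[of W j p "- q"] homog_uminus by force

lemma homog_sum: "(\<And>x. x \<in> A \<Longrightarrow> homog W j (g x)) \<Longrightarrow> homog W j (sum g A)"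
  by (induction A rule: infinite_finite_induct) (auto intro: homog_add)

lemma homog_mult: "homog W i p \<Longrightarrow> homog W j q \<Longrightarrow> homog W (i + j) (p * q)"
  unfolding homog_def using keys_mult[of p q] by (fastforce simp: wt_add)

lemma homog_mult': "homog W i p \<Longrightarrow> homog W j q \<Longrightarrow> i + j = k \<Longrightarrow> homog W k (p * q)"
  using homog_mult by blast

lemma homog_prod: "(\<And>x. x \<in> A \<Longrightarrow> homog W (j x) (g x)) \<Longrightarrow> homog W (sum j A) (prod g A)"
  by (induction A rule: infinite_finite_induct) (auto intro: homog_mult)

lemma hom_comp_zero [simp]: "hom_comp W j 0 = 0"
  by (rule poly_mapping_eqI) (simp add: coef_comp)

lemma hom_comp_add: "hom_comp W j (p + q) = hom_comp W j p + hom_comp W j q"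
  by (rule poly_mapping_eqI) (simp add: coef_comp lookup_add)

lemma hom_comp_diff: "hom_comp W j (p - q) = hom_comp W j p - hom_comp W j q"
  by (rule poly_mapping_eqI) (simp add: coef_comp lookup_minus)

lemma hom_comp_sum: "hom_comp W j (sum g A) = (\<Sum>x\<in>A. hom_comp W j (g x))"
  by (induction A rule: infinite_finite_induct) (auto simp: hom_comp_add)

lemma homog_comp [simp]: "homog W j (hom_comp W j p)"
  by (simp add: homog_iff coef_comp)

lemma homog_comp_other: "homog W i p \<Longrightarrow> homog W i (hom_comp W' j p)"
  by (simp add: homog_iff coef_comp)

lemma hom_comp_homog: "homog W i p \<Longrightarrow> hom_comp W j p = (if i = j then p else 0)"
  by (intro poly_mapping_eqI) (auto simp: coef_comp homog_iff)

lemma hom_comp_eq_0: "j \<notin> wt W ` Poly_Mapping.keys p \<Longrightarrow> hom_comp W j p = 0"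
  by (intro poly_mapping_eqI) (auto simp: coef_comp in_keys_iff)

lemma sum_comp: "(\<Sum>j\<in>wt W ` Poly_Mapping.keys p. hom_comp W j p) = p"
proof (rule poly_mapping_eqI)
  fix m
  have "(\<Sum>j\<in>wt W ` Poly_Mapping.keys p. coef (hom_comp W j p) m)
     = (\<Sum>j\<in>wt W ` Poly_Mapping.keys p. if wt W m = j then coef p m else 0)"
    by (rule sum.cong) (auto simp: coef_comp)
  also have "\<dots> = coef p m"
    by (subst sum.delta') (auto simp: in_keys_iff)
  finally show "coef (\<Sum>j\<in>wt W ` Poly_Mapping.keys p. hom_comp W j p) m = coef p m"
    by (simp add: lookup_sum)
qed

lemma hom_comp_mult_homog:
  assumes "homog W i x"
  shows "hom_comp W j (x * p) = x * hom_comp W (j - i) p"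
proof (induction p rule: poly_mapping_add_induct)
  case (single m c)
  have "homog W (i + wt W m) (x * Poly_Mapping.single m c)"
    by (intro homog_mult assms homog_single)
  then show ?case
    by (auto simp: hom_comp_homog[of W] hom_comp_homog[OF homog_single])
qed (simp_all add: hom_comp_add distrib_left)

text \<open>The component of \<open>c * x\<close> is a component of \<open>c\<close> times
  \<open>x\<close>, because \<open>x\<close> is homogeneous. Any auxiliary weight for which the
  generators are homogeneous may thus be used to cut a membership into pieces.\<close>

lemma hom_comp_span:
  assumes "p \<in> idl.span S" "\<And>g. g \<in> S \<Longrightarrow> \<exists>i. homog W i g"
  shows "hom_comp W j p \<in> idl.span S"
  using assms(1)
proof (induction rule: idl.span_induct_alt)
  case base
  show ?case by (simp add: idl.span_zero)
next
  case (step c x y)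
  obtain i where "homog W i x" using assms(2) step by blast
  then have "hom_comp W j (c * x) = hom_comp W (j - i) c * x"
    using hom_comp_mult_homog[of W i x j c] by (simp add: mult.commute)
  then show ?case using step by (simp add: hom_comp_add idl.span_add idl.span_scale idl.span_base)
qed

lemma span_if_comps: "(\<And>j. hom_comp W j p \<in> idl.span S) \<Longrightarrow> p \<in> idl.span S"
  by (subst sum_comp[of W p, symmetric]) (rule idl.span_sum)

lemma wt_1: "wt (\<lambda>_. 1) m = int (monom_degree m)"
proof -
  have "(\<Sum>v\<in>UNIV. int (expo m v)) = (\<Sum>v\<in>Poly_Mapping.keys m. int (expo m v))"
    by (rule sum.mono_neutral_right) (auto simp: in_keys_iff)
  then show ?thesis by (simp add: wt_def monom_degree_def)
qed

lemma homogeneous_diff_iff: "p \<in> homogeneous_diff e a \<longleftrightarrow> homog (\<lambda>_. 1) (int e - int a) p"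
  by (auto simp: homogeneous_diff_def homog_def wt_1)

section \<open>Forests\<close>

definition linked :: "'n set set \<Rightarrow> 'n \<Rightarrow> 'n set" where
  "linked E u = {w. (u, w) \<in> {(a, b). {a, b} \<in> E}\<^sup>*}"

text \<open>Acyclicity in the form "every edge is a bridge". It passes to subsets, and deleting an
  edge separates its two ends, hence also the variables of the two sides.\<close>

definition bridged :: "'n set set \<Rightarrow> bool" where
  "bridged E \<longleftrightarrow> (\<forall>e\<in>E. card e = 2) \<and> (\<forall>u v. {u, v} \<in> E \<longrightarrow> v \<notin> linked (E - {{u, v}}) u)"

lemma linked_refl [simp]: "u \<in> linked E u"
  by (simp add: linked_def)

lemma linked_step: "w \<in> linked E u \<Longrightarrow> {w, x} \<in> E \<Longrightarrow> x \<in> linked E u"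
  unfolding linked_def by (auto intro: rtrancl_into_rtrancl)

lemma linked_edge: "{w, x} \<in> E \<Longrightarrow> w \<in> linked E u \<longleftrightarrow> x \<in> linked E u"
  using linked_step[of w E u x] linked_step[of x E u w] by (auto simp: insert_commute)

lemma linked_mono: "E \<subseteq> F \<Longrightarrow> linked E u \<subseteq> linked F u"
  unfolding linked_def by (auto intro: rtrancl_mono[THEN subsetD, rotated])

lemma bridgedD: "bridged E \<Longrightarrow> {u, v} \<in> E \<Longrightarrow> v \<notin> linked (E - {{u, v}}) u"
  by (simp add: bridged_def)

lemma bridged_neq: "bridged E \<Longrightarrow> {u, v} \<in> E \<Longrightarrow> u \<noteq> v"
  using bridgedD[of E u v] by auto

lemma bridged_edgeE:
  assumes "bridged E" "e \<in> E"
  obtains a b where "e = {a, b}" "a \<noteq> b"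
  using assms by (auto simp: bridged_def card_2_iff)

lemma bridged_subset:
  assumes "bridged E" "F \<subseteq> E" shows "bridged F"
  unfolding bridged_def
proof (intro conjI ballI allI impI)
  fix e assume "e \<in> F" then show "card e = 2" using assms by (auto simp: bridged_def)
next
  fix u v assume uv: "{u, v} \<in> F"
  have "linked (F - {{u, v}}) u \<subseteq> linked (E - {{u, v}}) u" using assms by (intro linked_mono) auto
  then show "v \<notin> linked (F - {{u, v}}) u" using bridgedD[OF assms(1), of u v] assms(2) uv by blast
qed

lemma linked_distinct_path:
  assumes "w \<in> linked E u"
  shows "\<exists>vs. vs \<noteq> [] \<and> hd vs = u \<and> last vs = w \<and> distinct vs \<and> successively (\<lambda>a b. {a, b} \<in> E) vs"
proof -
  have "(u, w) \<in> {(a, b). {a, b} \<in> E}\<^sup>*" using assms by (simp add: linked_def)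
  then show ?thesis
  proof (induction rule: rtrancl_induct)
    case base
    show ?case by (rule exI[of _ "[u]"]) simp
  next
    case (step w x)
    then obtain vs where vs: "vs \<noteq> []" "hd vs = u" "last vs = w" "distinct vs"
      "successively (\<lambda>a b. {a, b} \<in> E) vs" by blast
    show ?case
    proof (cases "x \<in> set vs")
      case True
      \<comment> \<open>The walk returns to an earlier vertex, so it is cut at that
        occurrence.\<close>
      then obtain xs ys where xs: "vs = xs @ x # ys" by (meson split_list)
      have "hd (xs @ [x]) = u" using vs xs by (cases xs) auto
      moreover have "successively (\<lambda>a b. {a, b} \<in> E) (xs @ [x])"
        using vs(5) unfolding xs by (auto simp: successively_append_iff)
      ultimately show ?thesis using vs xs by (intro exI[of _ "xs @ [x]"]) auto
    next
      case False
      then show ?thesis using vs step by (intro exI[of _ "vs @ [x]"]) (auto simp: successively_append_iff)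
    qed
  qed
qed

text \<open>If the ends of an edge stay linked after its deletion, a path between them closes up
  with the edge. The path has at least three vertices, since two vertices would mean the deleted
  edge itself.\<close>

lemma forest_bridged:
  assumes "forest E" shows "bridged E"
  unfolding bridged_def
proof (intro conjI allI impI notI)
  show "\<forall>e\<in>E. card e = 2" using assms by (simp add: forest_def simple_graph_def)
next
  fix u v assume uv: "{u, v} \<in> E" and l: "v \<in> linked (E - {{u, v}}) u"
  have neq: "u \<noteq> v" using assms uv by (auto simp: forest_def simple_graph_def)
  obtain vs where vs: "vs \<noteq> []" "hd vs = u" "last vs = v" "distinct vs"
    "successively (\<lambda>a b. {a, b} \<in> E - {{u, v}}) vs"
    using linked_distinct_path[OF l] by blast
  have nth: "{vs ! i, vs ! Suc i} \<in> E - {{u, v}}" if "Suc i < length vs" for i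
    using vs(5) that by (auto simp: successively_conv_nth)
  have ends: "vs ! 0 = u" "vs ! (length vs - 1) = v"
    using vs by (simp_all add: hd_conv_nth last_conv_nth)
  have "length vs \<noteq> 1" using ends neq by auto
  moreover have "length vs \<noteq> 2" using ends nth[of 0] by auto
  moreover have "length vs \<noteq> 0" using vs by auto
  ultimately have 3: "3 \<le> length vs" by linarith
  have "{vs ! i, vs ! (Suc i mod length vs)} \<in> E" if "i < length vs" for i
  proof (cases "Suc i < length vs")
    case True
    then show ?thesis using nth by auto
  next
    case False
    then have "Suc i = length vs" using that by simp
    then have "i = length vs - 1" "Suc i mod length vs = 0" by auto
    then show ?thesis using ends uv by (simp add: insert_commute)
  qed
  then have "graph_cycle E vs" using 3 vs by (simp add: graph_cycle_def)
  then show False using assms by (auto simp: forest_def)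
qed

text \<open>Edges are added one by one. A new edge joins two different components, so if its ends
  have the same colour, the colours can be exchanged on one of the components.\<close>

lemma bridged_2_colouring:
  fixes E :: "'n::finite set set"
  assumes "bridged E"
  shows "\<exists>c :: 'n \<Rightarrow> bool. \<forall>a b. {a, b} \<in> E \<longrightarrow> c a \<noteq> c b"
  using finite[of E] assms
proof (induction E rule: finite_induct)
  case (insert e F)
  obtain a b where ab: "e = {a, b}" using bridged_edgeE[OF insert.prems, of e] by blast
  obtain c :: "'n \<Rightarrow> bool" where c: "\<And>x y. {x, y} \<in> F \<Longrightarrow> c x \<noteq> c y"
    using insert.IH[OF bridged_subset[OF insert.prems subset_insertI]] by metis
  have F: "insert e F - {e} = F" using insert by auto
  have nl: "a \<notin> linked F b"
    using bridgedD[OF insert.prems, of b a] ab F by (simp add: insert_commute)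
  define c' where "c' x = (if x \<in> linked F b \<and> c a = c b then \<not> c x else c x)" for x
  have "c' a \<noteq> c' b" using nl by (auto simp: c'_def)
  moreover have "c' x \<noteq> c' y" if "{x, y} \<in> F" for x y
    using c[OF that] linked_edge[OF that, of b] by (auto simp: c'_def)
  ultimately have "\<forall>x y. {x, y} \<in> insert e F \<longrightarrow> c' x \<noteq> c' y"
    using ab by (auto simp: doubleton_eq_iff)
  then show ?case by blast
qed simp

text \<open>Walk away from \<open>a\<close> through \<open>b\<close> and search in the part beyond
  \<open>b\<close>. The condition \<open>l \<noteq> a\<close> carries the induction: the leaf found
  beyond \<open>b\<close> differs from \<open>b\<close>, so the edge \<open>{a, b}\<close> removed
  before does not meet it.\<close>

lemma bridged_leaf:
  fixes E :: "'n::finite set set"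
  assumes "bridged E" "{a, b} \<in> E"
  shows "\<exists>u l. l \<noteq> a \<and> {u, l} \<in> E \<and> (\<forall>e\<in>E. l \<in> e \<longrightarrow> e = {u, l})"
  using assms
proof (induction "card E" arbitrary: E a b rule: less_induct)
  case less
  let ?F = "E - {{a, b}}"
  let ?C = "linked ?F b"
  define E1 where "E1 = {e \<in> ?F. e \<subseteq> ?C}"
  have aC: "a \<notin> ?C" using bridgedD[of E b a] less.prems by (simp add: insert_commute)
  have inE1: "e \<in> E1" if "e \<in> ?F" "x \<in> e" "x \<in> ?C" for e x
  proof -
    obtain p q where "e = {p, q}" using bridged_edgeE[OF less.prems(1), of e] \<open>e \<in> ?F\<close> by blast
    then show ?thesis using that linked_edge[of p q ?F b] by (auto simp: E1_def)
  qed
  show ?case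
  proof (cases "\<exists>y. {b, y} \<in> ?F")
    case False
    have star: "e = {a, b}" if e: "e \<in> E" "b \<in> e" for e
    proof -
      obtain p q where "e = {p, q}" using bridged_edgeE[OF less.prems(1), of e] e by blast
      then show ?thesis using False e by (cases "p = b") (auto simp: insert_commute)
    qed
    show ?thesis
    proof (intro exI conjI ballI impI)
      show "b \<noteq> a" using bridged_neq[OF less.prems] by simp
      show "{a, b} \<in> E" by (rule less.prems)
    qed (rule star)
  next
    case True
    then obtain y where y: "{b, y} \<in> ?F" by blast
    have "{b, y} \<in> E1" by (rule inE1[OF y, of b]) simp_all
    moreover have "card E1 < card E" using less.prems(2) by (intro psubset_card_mono) (auto simp: E1_def)
    moreover have "bridged E1" using less.prems(1) by (rule bridged_subset) (auto simp: E1_def)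
    ultimately have "\<exists>u l. l \<noteq> b \<and> {u, l} \<in> E1 \<and> (\<forall>e\<in>E1. l \<in> e \<longrightarrow> e = {u, l})"
      by (intro less.hyps)
    then obtain u l where ul: "l \<noteq> b" "{u, l} \<in> E1" "\<And>e. e \<in> E1 \<Longrightarrow> l \<in> e \<Longrightarrow> e = {u, l}"
      by auto
    have lC: "l \<in> ?C" using ul(2) by (auto simp: E1_def)
    have "e = {u, l}" if e: "e \<in> E" "l \<in> e" for e
    proof -
      have "l \<noteq> a" using lC aC by metis
      then have "e \<noteq> {a, b}" using e(2) ul(1) by blast
      then have "e \<in> E1" using inE1[of e l] e lC by blast
      then show ?thesis using e(2) by (rule ul(3))
    qed
    moreover have "l \<noteq> a" using lC aC by metis
    moreover have "{u, l} \<in> E" using ul(2) by (simp add: E1_def)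
    ultimately show ?thesis by blast
  qed
qed

definition edge_deg :: "'n::finite set set \<Rightarrow> 'n \<Rightarrow> nat" where
  "edge_deg E v = card {e \<in> E. v \<in> e}"

lemma edge_deg_remove: "e \<in> E \<Longrightarrow> v \<in> e \<Longrightarrow> edge_deg E v = Suc (edge_deg (E - {e}) v)"
proof -
  assume "e \<in> E" "v \<in> e"
  then have "{e \<in> E. v \<in> e} = insert e {x \<in> E - {e}. v \<in> x}" by auto
  then show ?thesis unfolding edge_deg_def by (simp add: card_insert_if)
qed

lemma edge_deg_remove_other: "v \<notin> e \<Longrightarrow> edge_deg (E - {e}) v = edge_deg E v"
  unfolding edge_deg_def by (rule arg_cong[of _ _ card]) auto

section \<open>Ideals in disjoint sets of variables\<close>

definition poly_in :: "'v set \<Rightarrow> ('v, 'k::comm_ring_1) mpoly \<Rightarrow> bool" where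
  "poly_in Z p \<longleftrightarrow> (\<forall>m\<in>Poly_Mapping.keys p. Poly_Mapping.keys m \<subseteq> Z)"

lemma poly_in_zero [simp]: "poly_in Z 0"
  by (simp add: poly_in_def)

lemma poly_in_single: "Poly_Mapping.keys m \<subseteq> Z \<Longrightarrow> poly_in Z (Poly_Mapping.single m c)"
  by (simp add: poly_in_def)

lemma poly_in_Const [simp]: "poly_in Z (Const c)"
  by (simp add: Const_def poly_in_single)

lemma poly_in_Var: "v \<in> Z \<Longrightarrow> poly_in Z (Var v)"
  by (simp add: Var_def poly_in_single)

lemma poly_in_add: "poly_in Z p \<Longrightarrow> poly_in Z q \<Longrightarrow> poly_in Z (p + q)"
  unfolding poly_in_def using keys_add[of p q] by blast

lemma poly_in_mult: "poly_in Z p \<Longrightarrow> poly_in Z q \<Longrightarrow> poly_in Z (p * q)"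
  unfolding poly_in_def
proof
  fix m
  assume *: "\<forall>m\<in>Poly_Mapping.keys p. Poly_Mapping.keys m \<subseteq> Z" "\<forall>m\<in>Poly_Mapping.keys q. Poly_Mapping.keys m \<subseteq> Z"
  assume "m \<in> Poly_Mapping.keys (p * q)"
  then obtain a b where "m = a + b" "a \<in> Poly_Mapping.keys p" "b \<in> Poly_Mapping.keys q"
    using keys_mult[of p q] by blast
  then show "Poly_Mapping.keys m \<subseteq> Z" using * keys_add[of a b] by blast
qed

lemma poly_in_sum: "(\<And>x. x \<in> A \<Longrightarrow> poly_in Z (g x)) \<Longrightarrow> poly_in Z (sum g A)"
  by (induction A rule: infinite_finite_induct) (auto intro: poly_in_add)

lemma poly_in_uminus: "poly_in Z p \<Longrightarrow> poly_in Z (- p)"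
  by (auto simp: poly_in_def in_keys_iff)

lemma sum_single: "(\<Sum>m\<in>Poly_Mapping.keys p. Poly_Mapping.single m (coef p m)) = p"
  by (rule poly_mapping_eqI) (auto simp: lookup_sum lookup_single when_def in_keys_iff)

definition restr :: "'v set \<Rightarrow> ('v \<Rightarrow>\<^sub>0 nat) \<Rightarrow> 'v \<Rightarrow>\<^sub>0 nat" where
  "restr A m = Poly_Mapping.mapp (\<lambda>v n. if v \<in> A then n else 0) m"

lemma lookup_restr: "expo (restr A m) v = (if v \<in> A then expo m v else 0)"
  by (simp add: restr_def lookup_mapp when_def in_keys_iff)

lemma keys_restr: "Poly_Mapping.keys (restr A m) \<subseteq> A"
  by (auto simp: in_keys_iff lookup_restr split: if_splits)

lemma restr_add_eq:
  assumes "Poly_Mapping.keys a \<subseteq> A"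
  shows "restr A (a + m) = a + restr A m"
  using assms by (intro poly_mapping_eqI) (auto simp: lookup_restr lookup_add in_keys_iff)

lemma restr_add_disjoint:
  assumes "Poly_Mapping.keys a \<inter> A = {}"
  shows "restr A (a + m) = restr A m"
  using assms by (intro poly_mapping_eqI) (auto simp: lookup_restr lookup_add in_keys_iff)

lemma restr_compl: "restr (- Z) m + restr Z m = m"
  by (intro poly_mapping_eqI) (auto simp: lookup_restr lookup_add)

lemma restr_id: "Poly_Mapping.keys m \<subseteq> Z \<Longrightarrow> restr Z m = m"
  by (intro poly_mapping_eqI) (auto simp: lookup_restr in_keys_iff)

lemma restr_disjoint: "Poly_Mapping.keys m \<inter> A = {} \<Longrightarrow> restr A m = 0"
  by (intro poly_mapping_eqI) (auto simp: lookup_restr in_keys_iff)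

text \<open>A basis of \<open>N\<close> is extended to a basis of the whole space, and
  \<open>f\<close> kills the former and fixes the added vectors. Such an \<open>f\<close> stands in
  for the quotient by \<open>N\<close>.\<close>

lemma (in vector_space) subspace_projection:
  assumes N: "subspace N"
  shows "\<exists>f. Vector_Spaces.linear scale scale f \<and> (\<forall>x\<in>N. f x = 0) \<and> (\<forall>x. x - f x \<in> N)"
proof -
  interpret P: vector_space_pair scale scale ..
  obtain B where B: "B \<subseteq> N" "independent B" "N \<subseteq> span B"
    using maximal_independent_subset by blast
  obtain C where C: "B \<subseteq> C" "C \<subseteq> UNIV" "independent C" "UNIV \<subseteq> span C"
    using maximal_independent_subset_extend[of B UNIV] B by blast
  define f where "f = P.construct C (\<lambda>b. if b \<in> B then 0 else b)"
  have lin: "Vector_Spaces.linear scale scale f"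
    unfolding f_def by (rule P.linear_construct) (rule C)
  then interpret f: Vector_Spaces.linear scale scale f .
  have fb: "f b = (if b \<in> B then 0 else b)" if "b \<in> C" for b
    unfolding f_def by (rule P.construct_basis) (use C that in auto)
  have "f x = 0" if "x \<in> N" for x
  proof -
    have "x \<in> span B" using that B by auto
    then show ?thesis
      by (induction rule: span_induct_alt) (use fb C in \<open>auto simp: f.add f.scale\<close>)
  qed
  moreover have "x - f x \<in> N" for x
  proof -
    have "x \<in> span C" using C by auto
    then show ?thesis
    proof (induction rule: span_induct_alt)
      case (step c x y)
      have "x - f x \<in> N" using step fb[of x] B N by (auto simp: subspace_0)
      then have "scale c (x - f x) + (y - f y) \<in> N"
        using step N by (intro subspace_add subspace_scale)
      then show ?case by (simp add: f.add f.scale scale_right_diff_distrib algebra_simps)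
    qed (use N in \<open>simp add: subspace_0\<close>)
  qed
  ultimately show ?thesis using lin by blast
qed

text \<open>The assumptions say that \<open>f\<close> induces an injection from V/N into the
  quotient by \<open>L\<close>. Over a field it has a left inverse, stated here on
  representatives.\<close>

lemma (in vector_space) left_inverse_modulo:
  assumes V: "subspace V" and N: "subspace N" "N \<subseteq> V" and L: "subspace L"
    and f: "Vector_Spaces.linear scale scale f" and fN: "\<And>v. v \<in> V \<Longrightarrow> f v \<in> L \<longleftrightarrow> v \<in> N"
  shows "\<exists>g. Vector_Spaces.linear scale scale g \<and> (\<forall>l\<in>L. g l = 0) \<and> (\<forall>v\<in>V. g (f v) - v \<in> N)"
proof -
  interpret P: vector_space_pair scale scale ..
  interpret f: Vector_Spaces.linear scale scale f by (rule f)
  obtain p where p: "Vector_Spaces.linear scale scale p" "\<And>x. x \<in> N \<Longrightarrow> p x = 0" "\<And>x. x - p x \<in> N"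
    using subspace_projection[OF N(1)] by blast
  obtain q where q: "Vector_Spaces.linear scale scale q" "\<And>x. x \<in> L \<Longrightarrow> q x = 0" "\<And>x. x - q x \<in> L"
    using subspace_projection[OF L] by blast
  interpret p: Vector_Spaces.linear scale scale p by (rule p)
  interpret q: Vector_Spaces.linear scale scale q by (rule q)
  have C: "subspace (p ` V)" using V by (rule p.subspace_image)
  have CV: "p x \<in> V" if "x \<in> V" for x
    using subspace_diff[OF V that, of "x - p x"] p(3)[of x] N(2) by auto
  have lin: "Vector_Spaces.linear scale scale (q \<circ> f)"
    using module_hom_compose[of scale scale f scale q] f q(1) by (simp add: module_hom_iff_linear)
  have ker: "p x = 0" if "x \<in> V" "q (f (p x)) = 0" for x
  proof -
    have "f (p x) \<in> L" using q(3)[of "f (p x)"] that by simp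
    then have "p x \<in> N" using fN[OF CV[OF that(1)]] by simp
    then have "(x - p x) + p x \<in> N" using p(3) N(1) by (intro subspace_add)
    then show ?thesis using p(2) by simp
  qed
  have "inj_on (q \<circ> f) (p ` V)"
  proof (rule inj_onI)
    fix a b assume "a \<in> p ` V" "b \<in> p ` V" and eq: "(q \<circ> f) a = (q \<circ> f) b"
    then obtain x y where xy: "x \<in> V" "y \<in> V" "a = p x" "b = p y" by auto
    have "q (f (p (x - y))) = 0" using eq xy by (simp add: p.diff f.diff q.diff)
    then have "p (x - y) = 0" using ker[of "x - y"] xy V by (simp add: subspace_diff)
    then show "a = b" using xy by (simp add: p.diff)
  qed
  then obtain g where g: "Vector_Spaces.linear scale scale g" "\<And>x. x \<in> V \<Longrightarrow> g (q (f (p x))) = p x"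
    using P.linear_exists_left_inverse_on[OF lin C] by auto
  interpret g: Vector_Spaces.linear scale scale g by (rule g)
  have "g (q l) = 0" if "l \<in> L" for l using q(2)[OF that] by simp
  moreover have "g (q (f v)) - v \<in> N" if v: "v \<in> V" for v
  proof -
    have "f (v - p v) \<in> L" using fN[of "v - p v"] p(3)[of v] N(2) by auto
    then have "q (f (v - p v)) = 0" by (rule q(2))
    then have "q (f v) = q (f (p v))" by (simp add: f.diff q.diff)
    then have "g (q (f v)) - v = - (v - p v)" using g(2)[OF v] by simp
    then show ?thesis using subspace_neg[OF N(1) p(3)] by simp
  qed
  ultimately show ?thesis
    \<comment> \<open>Composing with \<open>q\<close> first makes the inverse vanish on all of
      \<open>L\<close>.\<close>
    using module_hom_compose[of scale scale q scale g] q(1) g(1)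
    by (intro exI[of _ "g \<circ> q"]) (simp add: module_hom_iff_linear)
qed

text \<open>The functor \<open>K[Y]/Q \<otimes> _\<close> is exact: the quotient \<open>K[Z]/L\<close> has a linear left inverse of the
  multiplication by \<open>z\<close> modulo \<open>L : z\<close>, which extends \<open>K[Y]\<close>-linearly.\<close>

lemma colon_disjoint_variables:
  fixes h :: "('v::finite, 'k::field) mpoly"
  assumes SQ: "\<And>q. q \<in> SQ \<Longrightarrow> poly_in (- Z) q" and SL: "\<And>l. l \<in> SL \<Longrightarrow> poly_in Z l"
    and z: "poly_in Z z" and zh: "z * h \<in> idl.span (SQ \<union> SL)"
  shows "h \<in> idl.span (SQ \<union> {n. poly_in Z n \<and> z * n \<in> idl.span SL})"
proof -
  let ?s = "\<lambda>c (p :: ('v, 'k) mpoly). Const c * p"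
  interpret kv: vector_space ?s
    by unfold_locales (simp_all add: algebra_simps)
  define V where "V = {p :: ('v, 'k) mpoly. poly_in Z p}"
  define L where "L = V \<inter> idl.span SL"
  define N where "N = {n. poly_in Z n \<and> z * n \<in> idl.span SL}"
  have V: "kv.subspace V"
    by (auto simp: kv.subspace_def V_def poly_in_add poly_in_mult)
  have L: "kv.subspace L" using V
    by (auto simp: kv.subspace_def L_def idl.span_add idl.span_zero idl.span_scale)
  have N: "kv.subspace N"
    by (auto simp: kv.subspace_def N_def poly_in_add poly_in_mult distrib_left idl.span_add
        idl.span_zero idl.span_scale mult.left_commute[of z])
  have lin: "Vector_Spaces.linear ?s ?s ((*) z)"
    by unfold_locales (simp_all add: algebra_simps)
  have NV: "N \<subseteq> V" by (auto simp: N_def V_def)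
  have "z * v \<in> L \<longleftrightarrow> v \<in> N" if "v \<in> V" for v
    using that z by (auto simp: L_def N_def V_def poly_in_mult)
  then obtain g where g: "Vector_Spaces.linear ?s ?s g" "\<And>l. l \<in> L \<Longrightarrow> g l = 0"
    "\<And>v. v \<in> V \<Longrightarrow> g (z * v) - v \<in> N"
    using kv.left_inverse_modulo[OF V N NV L lin] by blast
  interpret g: Vector_Spaces.linear ?s ?s g by (rule g(1))
  \<comment> \<open>The extension of \<open>g\<close> that is linear over the polynomials in the
    variables outside \<open>Z\<close>: each monomial is split into its factors outside and inside
    \<open>Z\<close>, and \<open>g\<close> sees only the latter.\<close>
  define G where "G p = (\<Sum>m\<in>Poly_Mapping.keys p.
      Poly_Mapping.single (restr (- Z) m) 1 * g (Poly_Mapping.single (restr Z m) (coef p m)))" for p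
  have G_superset: "G p = (\<Sum>m\<in>S. Poly_Mapping.single (restr (- Z) m) 1 * g (Poly_Mapping.single (restr Z m) (coef p m)))"
    if "finite S" "Poly_Mapping.keys p \<subseteq> S" for p S
    unfolding G_def by (rule sum.mono_neutral_left) (use that in \<open>auto simp: in_keys_iff g.zero\<close>)
  have G_add: "G (p + q) = G p + G q" for p q
  proof -
    let ?S = "Poly_Mapping.keys p \<union> Poly_Mapping.keys q"
    have "Poly_Mapping.keys (p + q) \<subseteq> ?S" by (rule keys_add)
    then show ?thesis
      by (simp add: G_superset[of ?S] lookup_add single_add g.add distrib_left sum.distrib)
  qed
  have G_single: "G (Poly_Mapping.single m c) = Poly_Mapping.single (restr (- Z) m) 1 * g (Poly_Mapping.single (restr Z m) c)" for m c
    by (subst G_superset[of "{m}"]) auto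
  have G_zero: "G 0 = 0" by (simp add: G_def)
  have G_sum: "G (sum f A) = (\<Sum>x\<in>A. G (f x))" for f :: "('v \<Rightarrow>\<^sub>0 nat) \<Rightarrow> ('v, 'k) mpoly" and A
    by (induction A rule: infinite_finite_induct) (auto simp: G_add G_zero)
  have g_sum: "g (sum f A) = (\<Sum>x\<in>A. g (f x))" for f :: "('v \<Rightarrow>\<^sub>0 nat) \<Rightarrow> ('v, 'k) mpoly" and A
    by (rule g.sum)
  have G_shift: "G (Poly_Mapping.single a 1 * p) = Poly_Mapping.single a 1 * G p"
    if a: "Poly_Mapping.keys a \<subseteq> - Z" for a p
  proof (induction p rule: poly_mapping_add_induct)
    case (single m c)
    have "restr (- Z) (a + m) = a + restr (- Z) m" "restr Z (a + m) = restr Z m"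
      using a by (auto intro: restr_add_eq restr_add_disjoint)
    then show ?case
      by (simp add: mult_single G_single mult.assoc[symmetric])
  qed (simp_all add: G_add G_zero distrib_left)
  have G_Const: "G (Const k * p) = Const k * G p" for k p
  proof (induction p rule: poly_mapping_add_induct)
    case (single m c)
    have 1: "Const k * Poly_Mapping.single n c = Poly_Mapping.single n (k * c)" for n :: "'v \<Rightarrow>\<^sub>0 nat"
      by (simp add: Const_def mult_single)
    have "g (Poly_Mapping.single n (k * c)) = Const k * g (Poly_Mapping.single n c)" for n
      using g.scale[of k "Poly_Mapping.single n c"] by (simp add: 1)
    then show ?case by (simp add: 1 G_single algebra_simps)
  qed (simp_all add: G_add G_zero distrib_left)
  have G_lin: "G (q * p) = q * G p" if q: "poly_in (- Z) q" for q p
  proof -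
    have "G (Poly_Mapping.single m (coef q m) * p) = Poly_Mapping.single m (coef q m) * G p"
      if "m \<in> Poly_Mapping.keys q" for m
    proof -
      have m: "Poly_Mapping.keys m \<subseteq> - Z" using q that by (auto simp: poly_in_def)
      have "Poly_Mapping.single m (coef q m) = Const (coef q m) * Poly_Mapping.single m 1"
        by (simp add: Const_def mult_single)
      then show ?thesis using G_Const[of "coef q m" "Poly_Mapping.single m 1 * p"] G_shift[OF m, of p]
        by (simp add: mult.assoc)
    qed
    then have "G ((\<Sum>m\<in>Poly_Mapping.keys q. Poly_Mapping.single m (coef q m)) * p)
        = (\<Sum>m\<in>Poly_Mapping.keys q. Poly_Mapping.single m (coef q m)) * G p"
      by (simp add: sum_distrib_right G_sum)
    then show ?thesis by (simp add: sum_single)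
  qed
  have G_Z: "G c = g c" if c: "poly_in Z c" for c
  proof -
    have "G (Poly_Mapping.single m (coef c m)) = g (Poly_Mapping.single m (coef c m))"
      if "m \<in> Poly_Mapping.keys c" for m
    proof -
      have "Poly_Mapping.keys m \<subseteq> Z" using c that by (auto simp: poly_in_def)
      then have "restr Z m = m" "restr (- Z) m = 0" by (auto intro: restr_id restr_disjoint)
      then show ?thesis by (simp add: G_single)
    qed
    then have "G (\<Sum>m\<in>Poly_Mapping.keys c. Poly_Mapping.single m (coef c m))
        = g (\<Sum>m\<in>Poly_Mapping.keys c. Poly_Mapping.single m (coef c m))"
      by (simp add: G_sum g_sum)
    then show ?thesis by (simp add: sum_single)
  qed
  have split: "Poly_Mapping.single m c = Poly_Mapping.single (restr (- Z) m) 1 * Poly_Mapping.single (restr Z m) c"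
    for m and c :: 'k
    by (simp add: mult_single restr_compl)
  have GL: "G (r * l) = 0" if l: "l \<in> SL" for r l
  proof (induction r rule: poly_mapping_add_induct)
    case (single m c)
    have "Poly_Mapping.single (restr Z m) c * l \<in> L"
      using l SL by (auto simp: L_def V_def poly_in_mult poly_in_single keys_restr idl.span_scale idl.span_base)
    moreover have "poly_in Z (Poly_Mapping.single (restr Z m) c * l)"
      using l SL by (auto simp: poly_in_mult poly_in_single keys_restr)
    ultimately have "G (Poly_Mapping.single (restr Z m) c * l) = 0" by (simp add: G_Z g(2))
    then show ?case
      using G_shift[of "restr (- Z) m" "Poly_Mapping.single (restr Z m) c * l"] keys_restr[of "- Z" m]
      by (simp add: split[of m c] mult.assoc)
  qed (simp_all add: G_add G_zero distrib_right)
  \<comment> \<open>Generators in \<open>SL\<close> die under \<open>G\<close>, and those in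
    \<open>SQ\<close> can be pulled out of it by linearity.\<close>
  have "G p \<in> idl.span (SQ \<union> N)" if "p \<in> idl.span (SQ \<union> SL)" for p
    using that
  proof (induction rule: idl.span_induct_alt)
    case base
    show ?case by (simp add: G_zero idl.span_zero)
  next
    case (step c x y)
    have "G (c * x) \<in> idl.span (SQ \<union> N)"
    proof (cases "x \<in> SL")
      case True
      then show ?thesis using GL by (simp add: idl.span_zero)
    next
      case False
      then have x: "x \<in> SQ" using step by auto
      have "G (c * x) = G c * x" using G_lin[OF SQ[OF x], of c] by (simp add: mult.commute)
      then show ?thesis using x by (simp add: idl.span_scale idl.span_base)
    qed
    then show ?case using step by (simp add: G_add idl.span_add)
  qed
  then have 1: "G (z * h) \<in> idl.span (SQ \<union> N)" using zh by blast
  \<comment> \<open>\<open>G\<close> undoes the multiplication by \<open>z\<close> modulo the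
    claimed ideal; applied to \<open>h\<close>, this and the previous fact give the result.\<close>
  have 2: "G (z * p) - p \<in> idl.span (SQ \<union> N)" for p
  proof (induction p rule: poly_mapping_add_induct)
    case (single m c)
    let ?a = "Poly_Mapping.single (restr (- Z) m) 1 :: ('v, 'k) mpoly"
    let ?c = "Poly_Mapping.single (restr Z m) c"
    have c: "poly_in Z ?c" by (simp add: poly_in_single keys_restr)
    have "G (?a * (z * ?c)) = ?a * G (z * ?c)" by (rule G_shift) (rule keys_restr)
    then have "G (z * (?a * ?c)) - ?a * ?c = ?a * (g (z * ?c) - ?c)"
      using G_Z[of "z * ?c"] c z by (simp add: poly_in_mult algebra_simps)
    moreover have "g (z * ?c) - ?c \<in> N" using c by (intro g(3)) (simp add: V_def)
    ultimately show ?case by (simp add: split[of m c, symmetric] idl.span_scale idl.span_base)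
  next
    case (add p q)
    then have "(G (z * p) - p) + (G (z * q) - q) \<in> idl.span (SQ \<union> N)" by (rule idl.span_add)
    then show ?case by (simp add: distrib_left G_add algebra_simps)
  qed (simp add: G_zero idl.span_zero)
  show ?thesis using idl.span_diff[OF 1 2[of h]] by (simp add: N_def)
qed

section \<open>Zero divisors modulo Lov\'asz--Saks--Schrijver ideals\<close>

lemma homog_mono_subst:
  assumes "\<And>x. homog W' (W x) (f x)"
  shows "homog W' (wt W m) (mono_subst f m)"
proof -
  have "homog W' (W x * int n) (f x ^ n)" for x n
    by (induction n) (auto intro!: homog_mult' assms simp: algebra_simps)
  then show ?thesis unfolding mono_subst_def wt_def by (intro homog_prod) simp
qed

lemma homog_poly_subst:
  assumes "homog W j p" "\<And>x. homog W' (W x) (f x)"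
  shows "homog W' j (poly_subst f p)"
  unfolding poly_subst_def
proof (rule homog_sum)
  fix m assume "m \<in> Poly_Mapping.keys p"
  then have "wt W m = j" using assms(1) by (simp add: homog_def)
  then show "homog W' j (Const (coef p m) * mono_subst f m)"
    using homog_mono_subst[of W' W f m] assms(2) by (auto intro!: homog_mult'[of _ 0 _ j])
qed

lemma hom_comp_neg_eq_0:
  assumes "\<And>x. 0 \<le> W x" "j < 0" shows "hom_comp W j p = 0"
proof (rule hom_comp_eq_0)
  have "0 \<le> wt W m" for m using assms(1) unfolding wt_def by (intro sum_nonneg) simp
  then have "wt W m \<noteq> j" for m using assms(2) by (metis not_le)
  then show "j \<notin> wt W ` Poly_Mapping.keys p" by blast
qed

section \<open>Setting variables to zero\<close>

definition kill :: "'v set \<Rightarrow> 'v \<Rightarrow> ('v, 'k::comm_ring_1) mpoly" where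
  "kill A x = (if x \<in> A then 0 else Var x)"

lemma kill_decomp: "\<exists>q. p = poly_subst (kill {x}) p + Var x * q"
proof (induction p rule: mpoly_induct)
  case (Const c)
  show ?case by (rule exI[of _ 0]) simp
next
  case (Var v)
  show ?case by (cases "v = x") (auto intro: exI[of _ 1] exI[of _ 0] simp: kill_def)
next
  case (add p q)
  then obtain a b where *: "p = poly_subst (kill {x}) p + Var x * a" "q = poly_subst (kill {x}) q + Var x * b" by blast
  have "p + q = (poly_subst (kill {x}) p + Var x * a) + (poly_subst (kill {x}) q + Var x * b)"
    by (rule arg_cong2[OF *, of "(+)"])
  also have "\<dots> = poly_subst (kill {x}) (p + q) + Var x * (a + b)"
    by (simp add: algebra_simps)
  finally show ?case by blast
next
  case (mult p q)
  then obtain a b where *: "p = poly_subst (kill {x}) p + Var x * a" "q = poly_subst (kill {x}) q + Var x * b" by blast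
  have "p * q = (poly_subst (kill {x}) p + Var x * a) * (poly_subst (kill {x}) q + Var x * b)"
    by (rule arg_cong2[OF *, of "(*)"])
  also have "\<dots> = poly_subst (kill {x}) (p * q) + Var x * (a * (poly_subst (kill {x}) q + Var x * b) + poly_subst (kill {x}) p * b)"
    by (simp add: algebra_simps)
  finally show ?case by blast
qed

lemma mult_Var_cancel:
  fixes p q :: "('v::finite, 'k::field) mpoly"
  assumes "Var x * p = Var x * q" shows "p = q"
proof -
  have "Var x * (p - q) = 0" using assms by (simp add: right_diff_distrib)
  then have "p - q = 0" using mpoly_mult_eq_0D[of "Var x" "p - q"] Var_nonzero[of x] by auto
  then show ?thesis by simp
qed

text \<open>An element of the ideal splits into its value at x = 0 and a multiple x q with q again
  in the ideal, since the generators do not change at x = 0. For the element x h the first summand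
  vanishes and x cancels.\<close>

lemma span_free_variable:
  fixes h :: "('v::finite, 'k::field) mpoly"
  assumes S: "\<And>g. g \<in> S \<Longrightarrow> poly_subst (kill {x}) g = g" and h: "Var x * h \<in> idl.span S"
  shows "h \<in> idl.span S"
proof -
  have "\<exists>q\<in>idl.span S. p = poly_subst (kill {x}) p + Var x * q" if "p \<in> idl.span S" for p
    using that
  proof (induction rule: idl.span_induct_alt)
    case base
    show ?case by (rule bexI[of _ 0]) (simp_all add: idl.span_zero)
  next
    case (step c g y)
    obtain c' where c': "c = poly_subst (kill {x}) c + Var x * c'" using kill_decomp by blast
    obtain q where q: "q \<in> idl.span S" "y = poly_subst (kill {x}) y + Var x * q" using step by blast
    have "c * g + y = (poly_subst (kill {x}) c + Var x * c') * g + (poly_subst (kill {x}) y + Var x * q)"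
      by (rule arg_cong2[OF arg_cong[OF c', of "\<lambda>c. c * g"] q(2), of "(+)"])
    also have "\<dots> = poly_subst (kill {x}) (c * g + y) + Var x * (c' * g + q)"
      by (simp add: S step(1) algebra_simps)
    finally show ?case using step(1) q(1) by (blast intro: idl.span_add idl.span_scale idl.span_base)
  qed
  from this[OF h] obtain q where q: "q \<in> idl.span S" "Var x * h = Var x * q"
    by (auto simp: kill_def)
  then show ?thesis using mult_Var_cancel by blast
qed

section \<open>The generators and their multidegrees\<close>

definition dot :: "'d set \<Rightarrow> 'n \<Rightarrow> 'n \<Rightarrow> ('n \<times> 'd, 'k::comm_ring_1) mpoly" where
  "dot K i j = (\<Sum>k\<in>K. Var (i, k) * Var (j, k))"

lemma dot_commute: "dot K i j = dot K j i"
  by (simp add: dot_def mult.commute)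

definition lss_gens :: "'n set set \<Rightarrow> ('n \<times> 'd::finite, 'k::comm_ring_1) mpoly set" where
  "lss_gens E = {dot UNIV i j | i j. {i, j} \<in> E}"

lemma lss_ideal_eq: "lss_ideal E = idl.span (lss_gens E)"
  by (simp add: lss_ideal_def genideal_class_ring lss_gens_def dot_def)

text \<open>For a graph without loops these are the generators after the coordinates of the vector
  at \<open>v\<close> outside \<open>K\<close> have been set to zero. The induction below removes
  coordinates in this way, at one vertex only.\<close>

definition lss_gens_at :: "'n \<Rightarrow> 'd set \<Rightarrow> 'n set set \<Rightarrow> ('n \<times> 'd::finite, 'k::comm_ring_1) mpoly set" where
  "lss_gens_at v K E = {dot UNIV i j | i j. {i, j} \<in> E \<and> i \<noteq> v \<and> j \<noteq> v} \<union> {dot K v j | j. {v, j} \<in> E}"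

lemma lss_gens_at_UNIV: "lss_gens_at v UNIV E = lss_gens E"
proof
  show "lss_gens_at v UNIV E \<subseteq> (lss_gens E :: ('a \<times> 'b, 'c) mpoly set)"
    by (auto simp: lss_gens_at_def lss_gens_def)
  show "lss_gens E \<subseteq> (lss_gens_at v UNIV E :: ('a \<times> 'b, 'c) mpoly set)"
  proof
    fix g :: "('a \<times> 'b, 'c) mpoly" assume "g \<in> lss_gens E"
    then obtain i j where ij: "g = dot UNIV i j" "{i, j} \<in> E" by (auto simp: lss_gens_def)
    consider "i = v" | "j = v" | "i \<noteq> v" "j \<noteq> v" by blast
    then show "g \<in> lss_gens_at v UNIV E"
    proof cases
      case 2
      then have "g = dot UNIV v i" "{v, i} \<in> E" using ij by (simp_all add: dot_commute insert_commute)
      then show ?thesis by (auto simp: lss_gens_at_def)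
    qed (use ij in \<open>auto simp: lss_gens_at_def\<close>)
  qed
qed

definition vdeg :: "'n \<Rightarrow> 'd set \<Rightarrow> 'n \<times> 'd \<Rightarrow> int" where
  "vdeg v K x = (if fst x = v \<and> snd x \<in> K then 1 else 0)"

lemma homog_dot:
  assumes "\<And>k. k \<in> K \<Longrightarrow> W (i, k) + W (j, k) = a"
  shows "homog W a (dot K i j :: ('n::finite \<times> 'd::finite, 'k::comm_ring_1) mpoly)"
  unfolding dot_def by (intro homog_sum homog_mult'[OF homog_Var homog_Var]) (use assms in auto)

lemma homog_lss_gens_at:
  assumes "bridged E" "g \<in> lss_gens_at v K E"
  shows "\<exists>a. homog (vdeg v K) a (g :: ('n::finite \<times> 'd::finite, 'k::comm_ring_1) mpoly)"
proof -
  consider i j where "g = dot UNIV i j" "i \<noteq> v" "j \<noteq> v" | j where "g = dot K v j" "{v, j} \<in> E"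
    using assms(2) by (auto simp: lss_gens_at_def)
  then show ?thesis
  proof cases
    case 1
    then have "homog (vdeg v K) 0 g" by (auto intro!: homog_dot simp: vdeg_def)
    then show ?thesis by blast
  next
    case 2
    then have "homog (vdeg v K) 1 g" using bridged_neq[OF assms(1) 2(2)]
      by (auto intro!: homog_dot simp: vdeg_def)
    then show ?thesis by blast
  qed
qed

lemma poly_in_dot: "i \<in> C \<Longrightarrow> j \<in> C \<Longrightarrow> poly_in (C \<times> UNIV) (dot K i j)"
  unfolding dot_def by (intro poly_in_sum poly_in_mult poly_in_Var) auto

lemma kill_dot:
  fixes K :: "'d::finite set"
  assumes "i \<noteq> j"
  shows "poly_subst (kill {(i, k)}) (dot K i j :: ('n::finite \<times> 'd, 'k::comm_ring_1) mpoly) = dot (K - {k}) i j"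
proof -
  have "poly_subst (kill {(i, k)}) (dot K i j :: ('n \<times> 'd, 'k) mpoly)
      = (\<Sum>l\<in>K. if l = k then 0 else Var (i, l) * Var (j, l))"
    unfolding dot_def poly_subst_sum by (rule sum.cong) (use assms in \<open>auto simp: kill_def\<close>)
  also have "\<dots> = dot (K - {k}) i j"
    unfolding dot_def by (rule sum.mono_neutral_cong_right) auto
  finally show ?thesis .
qed

lemma kill_dot_other:
  "i \<noteq> v \<Longrightarrow> j \<noteq> v \<Longrightarrow> poly_subst (kill {(v, k)}) (dot K i j :: ('n::finite \<times> 'd::finite, 'k::comm_ring_1) mpoly) = dot K i j"
  unfolding dot_def poly_subst_sum by (rule sum.cong) (auto simp: kill_def)

lemma dot_remove: "k \<in> K \<Longrightarrow> dot K i j = Var (i, k) * Var (j, k) + dot (K - {k :: 'd::finite}) i j"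
  unfolding dot_def by (rule sum.remove) auto

text \<open>
  Induction on the number of edges, for an edge \<open>{v, u}\<close>. Setting \<open>x\<^sub>v\<^sub>k = 0\<close> reduces to a syzygy of the
  generator \<open>X = \<Sum> x\<^sub>v\<^sub>l x\<^sub>u\<^sub>l\<close> with one coordinate fewer; that syzygy is analysed by its top component for the weight
  that sees only the \<open>k'\<close>-th coordinate on the component \<open>C\<close> of \<open>u\<close>, for which \<open>x\<^sub>v\<^sub>k\<^sub>' x\<^sub>u\<^sub>k\<^sub>'\<close> is the
  leading term of \<open>X\<close>.
\<close>

lemma Var_nonzerodivisor_homog:
  fixes E :: "'n::finite set set" and h :: "('n \<times> 'd::finite, 'k::field) mpoly"
  assumes "bridged E" "k \<in> K" "homog (vdeg v K) e h" "1 \<le> e \<or> edge_deg E v < card K"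
    and "Var (v, k) * h \<in> idl.span (lss_gens_at v K E)"
  shows "h \<in> idl.span (lss_gens_at v K E)"
  using assms
proof (induction "card E" arbitrary: E v K k e h rule: less_induct)
  case less
  note E = less.prems(1) and kK = less.prems(2) and hom_h = less.prems(3) and cond = less.prems(4)
    and xh = less.prems(5) and IH = less.hyps
  show ?case
  proof (cases "\<exists>u. {v, u} \<in> E")
    case False
    have "poly_subst (kill {(v, k)}) g = g" if "g \<in> lss_gens_at v K E" for g :: "('n \<times> 'd, 'k) mpoly"
      using that False by (auto simp: lss_gens_at_def kill_dot_other)
    then show ?thesis using xh by (rule span_free_variable)
  next
    case True
    then obtain u where vu: "{v, u} \<in> E" by blast
    define E' where "E' = E - {{v, u}}"
    define C where "C = linked E' u"
    define E1 where "E1 = {e \<in> E'. e \<subseteq> C}"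
    \<comment> \<open>Elements killed by every coordinate of the vector at \<open>u\<close>, modulo
      the ideal of the component of \<open>u\<close>. They will account for everything that the
      quadric of the edge \<open>{v, u}\<close> annihilates modulo the other generators.\<close>
    define NN where "NN = {n :: ('n \<times> 'd, 'k) mpoly. poly_in (C \<times> UNIV) n \<and> (\<forall>l. Var (u, l) * n \<in> idl.span (lss_gens E1))}"
    let ?G = "\<lambda>A. lss_gens_at v A E' :: ('n \<times> 'd, 'k) mpoly set"
    let ?X = "\<lambda>A. dot A v u :: ('n \<times> 'd, 'k) mpoly"
    let ?x = "\<lambda>l. Var (v, l) :: ('n \<times> 'd, 'k) mpoly" and ?z = "\<lambda>l. Var (u, l) :: ('n \<times> 'd, 'k) mpoly"
    have vnu: "v \<noteq> u" by (rule bridged_neq[OF E vu])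
    have uC: "u \<in> C" by (simp add: C_def)
    have vC: "v \<notin> C" using bridgedD[OF E, of u v] vu by (simp add: C_def E'_def insert_commute)
    have E'sub: "E' \<subseteq> E" "E1 \<subseteq> E'" by (auto simp: E'_def E1_def)
    have E'1: "bridged E'" by (rule bridged_subset[OF E E'sub(1)])
    have "E' \<subset> E" using vu by (auto simp: E'_def)
    then have "card E' < card E" by (rule psubset_card_mono[rotated]) simp
    note E' = E'1 this
    have "card E1 \<le> card E'" using E'sub by (intro card_mono) auto
    then have E1: "bridged E1" "card E1 < card E"
      using bridged_subset[OF E'(1) E'sub(2)] E' by auto
    have edgeC: "i \<in> C \<longleftrightarrow> j \<in> C" if "{i, j} \<in> E'" for i j
      using linked_edge[OF that, of u] by (simp add: C_def)
    have deg: "edge_deg E v = Suc (edge_deg E' v)"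
      using edge_deg_remove[OF vu, of v] by (simp add: E'_def)
    have cond': "1 \<le> e \<or> edge_deg E' v < card K" "1 \<le> e \<or> edge_deg E' v < card (K - {k})"
      using cond deg kK by auto
    have insG: "lss_gens_at v A E = insert (?X A) (?G A)" for A
    proof -
      have 1: "{v, j} \<in> E \<longleftrightarrow> j = u \<or> {v, j} \<in> E'" for j
        using vu vnu by (auto simp: E'_def doubleton_eq_iff)
      have 2: "{i, j} \<in> E \<longleftrightarrow> {i, j} \<in> E'" if "i \<noteq> v" "j \<noteq> v" for i j
        using that by (auto simp: E'_def doubleton_eq_iff)
      have "{dot A v j | j. {v, j} \<in> E} = insert (?X A) {dot A v j | j. {v, j} \<in> E'}"
        unfolding 1 by blast
      moreover have "{dot UNIV i j | i j. {i, j} \<in> E \<and> i \<noteq> v \<and> j \<noteq> v}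
          = ({dot UNIV i j | i j. {i, j} \<in> E' \<and> i \<noteq> v \<and> j \<noteq> v} :: ('n \<times> 'd, 'k) mpoly set)"
        by (rule Collect_cong) (use 2 in blast)
      ultimately show ?thesis unfolding lss_gens_at_def by simp
    qed
    have E1G: "lss_gens E1 \<subseteq> ?G A" for A
    proof
      fix g :: "('n \<times> 'd, 'k) mpoly" assume "g \<in> lss_gens E1"
      then obtain i j where "g = dot UNIV i j" "{i, j} \<in> E'" "i \<in> C" "j \<in> C"
        by (auto simp: lss_gens_def E1_def)
      moreover from this have "i \<noteq> v" "j \<noteq> v" using vC by metis+
      ultimately show "g \<in> ?G A" unfolding lss_gens_at_def by blast
    qed
    \<comment> \<open>The easy inclusion: \<open>?X A\<close> is a combination of the coordinates at
      \<open>u\<close>, so it multiplies \<open>NN\<close> into the ideal.\<close>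
    have XT: "?X A * t \<in> idl.span (?G A)" if "t \<in> idl.span (?G A \<union> NN)" for A t
      using that
    proof (induction rule: idl.span_induct_alt)
      case base
      show ?case by (simp add: idl.span_zero)
    next
      case (step c g y)
      have "?X A * g \<in> idl.span (?G A)"
      proof (cases "g \<in> ?G A")
        case True
        then show ?thesis by (simp add: idl.span_scale idl.span_base)
      next
        case False
        then have g: "g \<in> NN" using step by auto
        have "?X A * g = (\<Sum>l\<in>A. ?x l * (?z l * g))"
          by (simp add: dot_def sum_distrib_right mult.assoc)
        also have "\<dots> \<in> idl.span (lss_gens E1)"
          using g by (intro idl.span_sum, intro idl.span_scale[of "?z _ * g"]) (simp add: NN_def)
        finally show ?thesis using idl.span_mono[OF E1G[of A]] by blast
      qed
      then have "c * (?X A * g) + ?X A * y \<in> idl.span (?G A)"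
        using step(2) by (intro idl.span_add idl.span_scale[of "?X A * g"])
      then show ?case by (simp add: algebra_simps)
    qed
    define D where "D = vdeg v K"
    have homX: "homog D 1 (?X K)" unfolding D_def using vnu by (intro homog_dot) (simp add: vdeg_def)
    have homx: "homog D 1 (?x k)" using kK by (intro homog_Var) (simp add: D_def vdeg_def)
    have homG: "\<exists>a. homog D a g" if "g \<in> ?G K" for g
      unfolding D_def using homog_lss_gens_at[OF E'(1) that] .
    obtain w where w: "?x k * h - w * ?X K \<in> idl.span (?G K)"
      using xh unfolding insG idl.span_breakdown_eq by blast
    define w0 where "w0 = hom_comp D e w"
    have "hom_comp D (e + 1) (?x k * h - w * ?X K) \<in> idl.span (?G K)"
      by (rule hom_comp_span[OF w homG])
    then have w0: "?x k * h - ?X K * w0 \<in> idl.span (?G K)"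
      using hom_comp_mult_homog[OF homX, of "e + 1" w] hom_comp_mult_homog[OF homx, of "e + 1" h]
        hom_comp_homog[OF hom_h[folded D_def], of e]
      by (simp add: hom_comp_diff w0_def mult.commute)
    \<comment> \<open>Modulo \<open>?x k\<close>, the relation between \<open>?x k * h\<close> and
      \<open>?X K * w0\<close> becomes a relation \<open>?X K' * t\<close> in the ideal with one
      coordinate fewer.\<close>
    define K' where "K' = K - {k}"
    define t where "t = poly_subst (kill {(v, k)}) w0"
    have killG: "poly_subst (kill {(v, k)}) g \<in> idl.span (?G K')" if g: "g \<in> ?G K" for g
    proof -
      consider i j where "g = dot UNIV i j" "{i, j} \<in> E'" "i \<noteq> v" "j \<noteq> v" | j where "g = dot K v j" "{v, j} \<in> E'"
        using g unfolding lss_gens_at_def by blast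
      then have "poly_subst (kill {(v, k)}) g \<in> ?G K'"
      proof cases
        case 1
        then show ?thesis unfolding lss_gens_at_def by (simp add: kill_dot_other) blast
      next
        case 2
        then have "v \<noteq> j" using bridged_neq[OF E'(1)] by blast
        then show ?thesis unfolding lss_gens_at_def using 2 by (simp add: kill_dot K'_def) blast
      qed
      then show ?thesis by (rule idl.span_base)
    qed
    have "poly_subst (kill {(v, k)}) (?x k * h - ?X K * w0) \<in> idl.span (?G K')"
      by (rule poly_subst_span[OF w0 killG])
    then have "- (?X K' * t) \<in> idl.span (?G K')"
      by (simp add: kill_dot[OF vnu] t_def K'_def kill_def)
    then have Xt: "?X K' * t \<in> idl.span (?G K')" using idl.span_neg by fastforce
    have hom_t: "homog (vdeg v K') e t"
      unfolding t_def
    proof (rule homog_poly_subst)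
      show "homog D e w0" by (simp add: w0_def)
      show "homog (vdeg v K') (D x) (kill {(v, k)} x :: ('n \<times> 'd, 'k) mpoly)" for x
        by (cases x) (auto simp: kill_def D_def K'_def vdeg_def intro!: homog_Var)
    qed
    \<comment> \<open>The converse inclusion, in degree \<open>e\<close>: whatever
      \<open>?X K'\<close> multiplies into the ideal comes from the ideal and
      \<open>NN\<close>.\<close>
    have "t \<in> idl.span (?G K' \<union> NN)"
    proof (cases "K' = {}")
      case True
      \<comment> \<open>No coordinate is left at \<open>v\<close>. As \<open>v\<close> has an edge,
        \<open>edge_deg E v < card K\<close> fails, so \<open>e\<close> is positive and only
        \<open>t = 0\<close> has degree \<open>e\<close>.\<close>
      then have "card K = 1" using kK by (auto simp: K'_def card_1_singleton_iff)
      then have "1 \<le> e" using cond deg by auto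
      moreover have "wt (vdeg v {}) m = 0" for m :: "'n \<times> 'd \<Rightarrow>\<^sub>0 nat" by (simp add: wt_def vdeg_def)
      ultimately have "coef t m = 0" for m
        using hom_t True unfolding homog_iff by force
      then have "t = 0" by (intro poly_mapping_eqI) simp
      then show ?thesis by (simp add: idl.span_zero)
    next
      case False
      then obtain k' where k': "k' \<in> K'" by blast
      obtain c :: "'n \<Rightarrow> bool" where c: "\<And>a b. {a, b} \<in> E \<Longrightarrow> c a \<noteq> c b"
        using bridged_2_colouring[OF E] by blast
      \<comment> \<open>Opposite signs at the two ends of an edge inside \<open>C\<close> give all
        generators of \<open>?G K'\<close> weight 0, whereas \<open>v\<close> lies outside
        \<open>C\<close>, so that \<open>?x k' * ?z k'\<close> gets weight 1.\<close>
      define W :: "'n \<times> 'd \<Rightarrow> int" where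
        "W = (\<lambda>(x, l). if x \<in> C \<and> l = k' then if c x = c u then 1 else -1 else 0)"
      have homWG: "homog W 0 g" if g: "g \<in> ?G K'" for g :: "('n \<times> 'd, 'k) mpoly"
      proof -
        consider i j where "g = dot UNIV i j" "{i, j} \<in> E'" | j where "g = dot K' v j" "{v, j} \<in> E'"
          using g unfolding lss_gens_at_def by blast
        then show ?thesis
        proof cases
          case 1
          then have "c i \<noteq> c j" using c E'sub by auto
          then show ?thesis using 1 edgeC[of i j] by (auto intro!: homog_dot simp: W_def split: if_splits)
        next
          case 2
          then show ?thesis using edgeC[of v j] vC by (auto intro!: homog_dot simp: W_def)
        qed
      qed
      have homW1: "homog W 1 (?x k' * ?z k')"
        using vC uC by (intro homog_mult'[OF homog_Var homog_Var]) (auto simp: W_def)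
      have homW0: "homog W 0 (dot (K' - {k'}) v u :: ('n \<times> 'd, 'k) mpoly)"
        using vC uC by (intro homog_dot) (auto simp: W_def)
      \<comment> \<open>\<open>?z l * n\<close> has only components of positive degree at
        \<open>u\<close>, and there the induction hypothesis for \<open>E1\<close> cancels
        \<open>?z k'\<close> whatever the degree of the vertex \<open>u\<close> is.\<close>
      have colonE1: "?z l * n \<in> idl.span (lss_gens E1)" if n: "?z k' * n \<in> idl.span (lss_gens E1)" for n l
      proof (rule span_if_comps)
        fix j
        let ?D = "vdeg u (UNIV :: 'd set)"
        have z: "homog ?D 1 (?z m)" for m by (intro homog_Var) (simp add: vdeg_def)
        show "hom_comp ?D j (?z l * n) \<in> idl.span (lss_gens E1)"
        proof (cases "1 \<le> j")
          case False
          then have "hom_comp ?D (j - 1) n = 0" by (intro hom_comp_neg_eq_0) (auto simp: vdeg_def)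
          then show ?thesis by (simp add: hom_comp_mult_homog[OF z] idl.span_zero)
        next
          case True
          have "?z l * (?z k' * n) \<in> idl.span (lss_gens E1)" using n by (rule idl.span_scale)
          then have "hom_comp ?D (j + 1) (?z k' * (?z l * n)) \<in> idl.span (lss_gens E1)"
            using homog_lss_gens_at[OF E1(1), of _ u "UNIV :: 'd set"]
            by (intro hom_comp_span) (simp_all add: lss_gens_at_UNIV mult_ac)
          then have "?z k' * hom_comp ?D j (?z l * n) \<in> idl.span (lss_gens E1)"
            by (simp add: hom_comp_mult_homog[OF z, of "j + 1"])
          then show ?thesis
            using less.hyps[OF E1(2) E1(1), of k' UNIV u j "hom_comp ?D j (?z l * n)"] True
            by (simp add: lss_gens_at_UNIV)
        qed
      qed
      define Z where "Z = C \<times> (UNIV :: 'd set)"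
      define SQ where "SQ = {g \<in> ?G K'. poly_in (- Z) g}"
      have Z': "- Z = (- C) \<times> UNIV" by (auto simp: Z_def)
      have G_split: "?G K' \<subseteq> SQ \<union> lss_gens E1"
      proof
        fix g assume g: "g \<in> ?G K'"
        consider i j where "g = dot UNIV i j" "{i, j} \<in> E'" | j where "g = dot K' v j" "{v, j} \<in> E'"
          using g unfolding lss_gens_at_def by blast
        then show "g \<in> SQ \<union> lss_gens E1"
        proof cases
          case 1
          show ?thesis
          proof (cases "i \<in> C")
            case True
            then have "{i, j} \<in> E1" using 1 edgeC[of i j] by (simp add: E1_def)
            then show ?thesis using 1 unfolding lss_gens_def by blast
          next
            case False
            then have "poly_in (- Z) g" using 1 edgeC[of i j] by (simp add: Z' poly_in_dot)
            then show ?thesis using g by (simp add: SQ_def)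
          qed
        next
          case 2
          then have "poly_in (- Z) g" using edgeC[of v j] vC by (simp add: Z' poly_in_dot)
          then show ?thesis using g by (simp add: SQ_def)
        qed
      qed
      have colon: "s \<in> idl.span (?G K' \<union> NN)" if s: "?z k' * s \<in> idl.span (?G K')" for s
      proof -
        have "poly_in Z l" if "l \<in> lss_gens E1" for l :: "('n \<times> 'd, 'k) mpoly"
          using that by (auto simp: lss_gens_def E1_def Z_def intro!: poly_in_dot)
        moreover have "poly_in Z (?z k')" using uC by (intro poly_in_Var) (simp add: Z_def)
        moreover have "?z k' * s \<in> idl.span (SQ \<union> lss_gens E1)"
          using s idl.span_mono[OF G_split] by blast
        ultimately have "s \<in> idl.span (SQ \<union> {n. poly_in Z n \<and> ?z k' * n \<in> idl.span (lss_gens E1)})"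
          by (intro colon_disjoint_variables) (auto simp: SQ_def)
        moreover have "SQ \<union> {n. poly_in Z n \<and> ?z k' * n \<in> idl.span (lss_gens E1)} \<subseteq> ?G K' \<union> NN"
          using colonE1 unfolding SQ_def NN_def Z_def by blast
        ultimately show ?thesis using idl.span_mono by blast
      qed
      \<comment> \<open>Induction on the number of nonzero weight components. The top component is
        shown to lie in the claimed ideal and is subtracted; by \<open>XT\<close> the hypothesis on
        \<open>s\<close> survives the subtraction.\<close>
      have "s \<in> idl.span (?G K' \<union> NN)"
        if "homog (vdeg v K') e s" "?X K' * s \<in> idl.span (?G K')" for s
        using that
      proof (induction "card {j. hom_comp W j s \<noteq> 0}" arbitrary: s rule: less_induct)
        case (less s)
        let ?J = "{j. hom_comp W j s \<noteq> 0}"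
        have "?J \<subseteq> wt W ` Poly_Mapping.keys s" using hom_comp_eq_0 by blast
        then have fin: "finite ?J" by (rule finite_subset) simp
        show ?case
        proof (cases "?J = {}")
          case True
          then have "s = 0" using sum_comp[of W s] by simp
          then show ?thesis by (simp add: idl.span_zero)
        next
          case False
          define j where "j = Max ?J"
          have j: "hom_comp W j s \<noteq> 0" using Max_in[OF fin False] by (simp add: j_def)
          have j1: "hom_comp W (j + 1) s = 0" using Max_ge[OF fin, of "j + 1"] by (auto simp: j_def)
          let ?s = "hom_comp W j s"
          have "hom_comp W (j + 1) (?X K' * s) \<in> idl.span (?G K')"
            using less.prems(2) homWG by (intro hom_comp_span) auto
          also have "hom_comp W (j + 1) (?X K' * s) = ?x k' * (?z k' * ?s)"
            using hom_comp_mult_homog[OF homW1, of "j + 1" s] hom_comp_mult_homog[OF homW0, of "j + 1" s] j1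
            by (simp add: dot_remove[OF k'] distrib_right hom_comp_add mult.assoc)
          finally have "?x k' * (?z k' * ?s) \<in> idl.span (?G K')" .
          moreover have "homog (vdeg v K') e (?z k' * ?s)"
            using vnu less.prems(1)
            by (intro homog_mult'[OF homog_Var homog_comp_other, of _ _ _ _ _ e]) (auto simp: vdeg_def)
          \<comment> \<open>The first factor \<open>?x k'\<close> of the leading term cancels by the
            induction hypothesis: the degree of \<open>v\<close> and the number of coordinates have
            both dropped by one. The second factor is handled by \<open>colon\<close>.\<close>
          ultimately have "?z k' * ?s \<in> idl.span (?G K')"
            using IH[OF E'(2) E'(1) k', of v e "?z k' * ?s"] cond'(2) by (simp add: K'_def)
          then have sT: "?s \<in> idl.span (?G K' \<union> NN)" by (rule colon)
          have diff: "hom_comp W i (s - ?s) = (if i = j then 0 else hom_comp W i s)" for i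
            by (simp add: hom_comp_diff hom_comp_homog[OF homog_comp])
          have "{i. hom_comp W i (s - ?s) \<noteq> 0} \<subset> ?J" using j by (auto simp: diff)
          then have "card {i. hom_comp W i (s - ?s) \<noteq> 0} < card ?J" using fin by (rule psubset_card_mono[rotated])
          moreover have "homog (vdeg v K') e (s - ?s)"
            using less.prems(1) by (intro homog_diff homog_comp_other)
          moreover have "?X K' * (s - ?s) \<in> idl.span (?G K')"
            using idl.span_diff[OF less.prems(2) XT[OF sT]] by (simp add: right_diff_distrib)
          ultimately have "s - ?s \<in> idl.span (?G K' \<union> NN)" by (rule less.hyps)
          then show ?thesis using idl.span_add[OF _ sT, of "s - ?s"] by simp
        qed
      qed
      then show ?thesis using hom_t Xt by blast
    qed
    \<comment> \<open>Back to all coordinates in \<open>K\<close>: putting back the coordinate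
      \<open>k\<close> changes a generator only by a multiple of \<open>?x k\<close>.\<close>
    have "\<exists>a\<in>idl.span (?G K \<union> NN). \<exists>q. p = a + ?x k * q" if "p \<in> idl.span (?G K' \<union> NN)" for p
      using that
    proof (induction rule: idl.span_induct_alt)
      case base
      show ?case by (rule bexI[of _ 0]) (auto simp: idl.span_zero intro: exI[of _ 0])
    next
      case (step c g y)
      then obtain a q where aq: "a \<in> idl.span (?G K \<union> NN)" "y = a + ?x k * q" by blast
      have "\<exists>b\<in>?G K \<union> NN. \<exists>r. g = b + ?x k * r"
      proof (cases "\<exists>j. g = dot K' v j \<and> {v, j} \<in> E'")
        case True
        then obtain j where j: "g = dot K' v j" "{v, j} \<in> E'" by blast
        have "g = dot K v j + ?x k * - Var (j, k)"
          by (simp add: j K'_def dot_remove[OF kK, of v j])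
        moreover have "dot K v j \<in> ?G K" using j unfolding lss_gens_at_def by blast
        ultimately show ?thesis by blast
      next
        case False
        then have "g \<in> ?G K \<union> NN" using step(1) unfolding lss_gens_at_def by blast
        moreover have "g = g + ?x k * 0" by simp
        ultimately show ?thesis by blast
      qed
      then obtain b r where br: "b \<in> ?G K \<union> NN" "g = b + ?x k * r" by blast
      have "c * g + y = (c * b + a) + ?x k * (c * r + q)"
        unfolding br(2) aq(2) by (simp add: algebra_simps)
      moreover have "c * b + a \<in> idl.span (?G K \<union> NN)"
        by (rule idl.span_add[OF idl.span_scale[OF idl.span_base[OF br(1)]] aq(1)])
      ultimately show ?case by blast
    qed
    from this[OF \<open>t \<in> idl.span (?G K' \<union> NN)\<close>] obtain a q where aq: "a \<in> idl.span (?G K \<union> NN)" "t = a + ?x k * q"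
      by blast
    obtain r where r: "w0 = t + ?x k * r"
      using kill_decomp[of w0 "(v, k)"] unfolding t_def by blast
    \<comment> \<open>Up to \<open>a\<close>, which \<open>?X K\<close> multiplies into the ideal,
      the coefficient \<open>w0\<close> is divisible by \<open>?x k\<close>. The whole relation is
      then \<open>?x k\<close> times an element, and \<open>?x k\<close> cancels for the smaller
      graph.\<close>
    define w2 where "w2 = q + r"
    have w2: "w0 = a + ?x k * w2" by (simp add: r aq(2) w2_def distrib_left)
    have "(?x k * h - ?X K * w0) + ?X K * a \<in> idl.span (?G K)"
      by (rule idl.span_add[OF w0 XT[OF aq(1)]])
    also have "(?x k * h - ?X K * w0) + ?X K * a = ?x k * (h - ?X K * w2)"
      by (simp add: w2 algebra_simps)
    finally have "hom_comp D (e + 1) (?x k * (h - ?X K * w2)) \<in> idl.span (?G K)"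
      using homG by (rule hom_comp_span)
    then have "?x k * hom_comp D e (h - ?X K * w2) \<in> idl.span (?G K)"
      by (simp add: hom_comp_mult_homog[OF homx])
    moreover have "homog D e (hom_comp D e (h - ?X K * w2))" by simp
    ultimately have "hom_comp D e (h - ?X K * w2) \<in> idl.span (?G K)"
      using IH[OF E'(2) E'(1) kK, of v e "hom_comp D e (h - ?X K * w2)"] cond'(1) by (simp add: D_def)
    then have "h - ?X K * hom_comp D (e - 1) w2 \<in> idl.span (?G K)"
      using hom_comp_mult_homog[OF homX, of e w2] hom_comp_homog[OF hom_h[folded D_def], of e] by (simp add: hom_comp_diff)
    then show ?thesis unfolding insG idl.span_breakdown_eq by (metis mult.commute)
  qed
qed

lemma homog_lss_gens:
  assumes "bridged E" "g \<in> lss_gens E"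
  shows "\<exists>a. homog (vdeg v UNIV) a (g :: ('n::finite \<times> 'd::finite, 'k::comm_ring_1) mpoly)"
  using homog_lss_gens_at[OF assms(1), of g v UNIV] assms(2) by (simp add: lss_gens_at_UNIV)

lemma hom_comp_in_lss_if_Var_mult:
  fixes E :: "'n::finite set set" and h :: "('n \<times> 'd::finite, 'k::field) mpoly"
  assumes E: "bridged E" and h: "Var (v, k) * h \<in> idl.span (lss_gens E)"
    and e: "1 \<le> e \<or> edge_deg E v < card (UNIV :: 'd set)"
  shows "hom_comp (vdeg v UNIV) e h \<in> idl.span (lss_gens E)"
proof -
  have x: "homog (vdeg v UNIV) 1 (Var (v, k) :: ('n \<times> 'd, 'k) mpoly)"
    by (intro homog_Var) (simp add: vdeg_def)
  have "hom_comp (vdeg v UNIV) (e + 1) (Var (v, k) * h) \<in> idl.span (lss_gens E)"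
    by (rule hom_comp_span[OF h homog_lss_gens[OF E]])
  then show ?thesis
    using Var_nonzerodivisor_homog[OF E, of k UNIV v e "hom_comp (vdeg v UNIV) e h"] e
    by (simp add: hom_comp_mult_homog[OF x] lss_gens_at_UNIV)
qed

lemma Var_nonzerodivisor:
  fixes E :: "'n::finite set set" and h :: "('n \<times> 'd::finite, 'k::field) mpoly"
  assumes "bridged E" "edge_deg E v < card (UNIV :: 'd set)" "Var (v, k) * h \<in> idl.span (lss_gens E)"
  shows "h \<in> idl.span (lss_gens E)"
proof (rule span_if_comps)
  show "hom_comp (vdeg v UNIV) e h \<in> idl.span (lss_gens E)" for e
    by (rule hom_comp_in_lss_if_Var_mult[OF assms(1,3)]) (simp add: assms(2))
qed

text \<open>The polynomial \<open>Var (v, k) * h\<close> has no component of degree 0 at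
  \<open>v\<close>, and in positive degree the variable cancels for vertices of any degree.\<close>

lemma Var_square_cancel:
  fixes E :: "'n::finite set set" and h :: "('n \<times> 'd::finite, 'k::field) mpoly"
  assumes E: "bridged E" and h: "Var (v, k) * (Var (v, k) * h) \<in> idl.span (lss_gens E)"
  shows "Var (v, k) * h \<in> idl.span (lss_gens E)"
proof (rule span_if_comps)
  fix e
  have x: "homog (vdeg v UNIV) 1 (Var (v, k) :: ('n \<times> 'd, 'k) mpoly)"
    by (intro homog_Var) (simp add: vdeg_def)
  show "hom_comp (vdeg v UNIV) e (Var (v, k) * h) \<in> idl.span (lss_gens E)"
  proof (cases "1 \<le> e")
    case True
    then show ?thesis using hom_comp_in_lss_if_Var_mult[OF E h] by blast
  next
    case False
    then have "hom_comp (vdeg v UNIV) (e - 1) h = 0" by (intro hom_comp_neg_eq_0) (auto simp: vdeg_def)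
    then show ?thesis by (simp add: hom_comp_mult_homog[OF x] idl.span_zero)
  qed
qed

lemma Var_power_cancel:
  fixes E :: "'n::finite set set" and h :: "('n \<times> 'd::finite, 'k::field) mpoly"
  assumes E: "bridged E" and h: "Var (v, k) ^ n * h \<in> idl.span (lss_gens E)"
  shows "Var (v, k) * h \<in> idl.span (lss_gens E)"
  using h
proof (induction n)
  case (Suc n)
  show ?case
  proof (cases n)
    case (Suc m)
    then have "Var (v, k) * (Var (v, k) * (Var (v, k) ^ m * h)) \<in> idl.span (lss_gens E)"
      using Suc.prems by (simp add: mult_ac)
    then have "Var (v, k) * (Var (v, k) ^ m * h) \<in> idl.span (lss_gens E)" by (rule Var_square_cancel[OF E])
    then show ?thesis using Suc.IH Suc by (simp add: mult_ac)
  qed (use Suc in simp)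
qed (simp add: idl.span_scale)

section \<open>An associated prime\<close>

definition pmon :: "'d \<Rightarrow> ('n \<Rightarrow> nat) \<Rightarrow> 'n set \<Rightarrow> ('n::finite \<times> 'd::finite, 'k::comm_ring_1) mpoly" where
  "pmon k n A = (\<Prod>v\<in>A. Var (v, k) ^ n v)"

lemma pmon_add: "pmon k n A * pmon k m A = pmon k (\<lambda>v. n v + m v) A"
  by (simp add: pmon_def power_add prod.distrib)

text \<open>Vertex by vertex: a power of a variable may be replaced by its first power, and at a
  vertex of degree less than d it may be dropped.\<close>

lemma pmon_reduce:
  fixes E :: "'n::finite set set" and h :: "('n \<times> 'd::finite, 'k::field) mpoly"
  assumes E: "bridged E" and h: "pmon k n A * h \<in> idl.span (lss_gens E)"
  shows "pmon k (\<lambda>_. 1) {v \<in> A. card (UNIV :: 'd set) \<le> edge_deg E v} * h \<in> idl.span (lss_gens E)"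
  using finite[of A] h
proof (induction A arbitrary: h rule: finite_induct)
  case (insert v A)
  let ?B = "\<lambda>A. {v \<in> A. card (UNIV :: 'd set) \<le> edge_deg E v}"
  have "pmon k n A * (Var (v, k) ^ n v * h) \<in> idl.span (lss_gens E)"
    using insert by (simp add: pmon_def mult_ac)
  then have "pmon k (\<lambda>_. 1) (?B A) * (Var (v, k) ^ n v * h) \<in> idl.span (lss_gens E)"
    by (rule insert.IH)
  then have "Var (v, k) ^ n v * (pmon k (\<lambda>_. 1) (?B A) * h) \<in> idl.span (lss_gens E)"
    by (simp add: mult_ac)
  then have 1: "Var (v, k) * (pmon k (\<lambda>_. 1) (?B A) * h) \<in> idl.span (lss_gens E)"
    by (rule Var_power_cancel[OF E])
  show ?case
  proof (cases "card (UNIV :: 'd set) \<le> edge_deg E v")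
    case True
    then have "?B (insert v A) = insert v (?B A)" by auto
    then show ?thesis using 1 insert by (simp add: pmon_def mult_ac)
  next
    case False
    then have "?B (insert v A) = ?B A" by auto
    then show ?thesis using Var_nonzerodivisor[OF E _ 1] False by simp
  qed
qed (simp add: pmon_def)

text \<open>The saturation of the ideal by the variables \<open>x\<^sub>v\<^sub>k\<close>; its zero set is the closure of the orthogonal representations all of whose
  vectors have nonzero \<open>k\<close>-th coordinate.\<close>

definition lss_sat :: "'d \<Rightarrow> 'n set set \<Rightarrow> ('n::finite \<times> 'd::finite, 'k::comm_ring_1) mpoly set" where
  "lss_sat k E = {g. \<exists>n. pmon k n UNIV * g \<in> idl.span (lss_gens E)}"

lemma lss_sat_superset: "idl.span (lss_gens E) \<subseteq> lss_sat k E"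
  by (auto simp: lss_sat_def idl.span_scale)

lemma lss_sat_subspace: "idl.subspace (lss_sat k E :: ('n::finite \<times> 'd::finite, 'k::comm_ring_1) mpoly set)"
proof (rule idl.subspaceI)
  show "0 \<in> lss_sat k E" by (simp add: lss_sat_def idl.span_zero)
next
  fix x y :: "('n \<times> 'd, 'k) mpoly" assume "x \<in> lss_sat k E" "y \<in> lss_sat k E"
  then obtain n m where nm: "pmon k n UNIV * x \<in> idl.span (lss_gens E)" "pmon k m UNIV * y \<in> idl.span (lss_gens E)"
    by (auto simp: lss_sat_def)
  have "pmon k m UNIV * (pmon k n UNIV * x) + pmon k n UNIV * (pmon k m UNIV * y) \<in> idl.span (lss_gens E)"
    by (rule idl.span_add[OF idl.span_scale[OF nm(1)] idl.span_scale[OF nm(2)]])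
  then have "pmon k (\<lambda>v. n v + m v) UNIV * (x + y) \<in> idl.span (lss_gens E)"
    by (simp add: pmon_add[symmetric] algebra_simps)
  then show "x + y \<in> lss_sat k E" by (auto simp: lss_sat_def)
next
  fix c x :: "('n \<times> 'd, 'k) mpoly" assume "x \<in> lss_sat k E"
  then obtain n where "pmon k n UNIV * x \<in> idl.span (lss_gens E)" by (auto simp: lss_sat_def)
  then have "c * (pmon k n UNIV * x) \<in> idl.span (lss_gens E)" by (rule idl.span_scale)
  then have "pmon k n UNIV * (c * x) \<in> idl.span (lss_gens E)" by (simp only: mult.left_commute)
  then show "c * x \<in> lss_sat k E" by (auto simp: lss_sat_def)
qed

lemma colon_pmon:
  fixes E :: "'n::finite set set"
  assumes E: "bridged E"
  shows "colon (idl.span (lss_gens E)) (pmon k (\<lambda>_. 1) {v. card (UNIV :: 'd set) \<le> edge_deg E v})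
    = (lss_sat k E :: ('n \<times> 'd::finite, 'k::field) mpoly set)" (is "colon ?L (pmon k _ ?B) = _")
proof
  show "colon ?L (pmon k (\<lambda>_. 1) ?B) \<subseteq> lss_sat k E"
  proof
    fix g :: "('n \<times> 'd, 'k) mpoly" assume "g \<in> colon ?L (pmon k (\<lambda>_. 1) ?B)"
    \<comment> \<open>The product over the vertices of large degree is a monomial over all vertices
      with exponents 0 and 1, as the saturation requires.\<close>
    moreover have "pmon k (\<lambda>v. of_bool (v \<in> ?B)) UNIV = (pmon k (\<lambda>_. 1) ?B :: ('n \<times> 'd, 'k) mpoly)"
      unfolding pmon_def by (rule prod.mono_neutral_cong_right) auto
    ultimately have "pmon k (\<lambda>v. of_bool (v \<in> ?B)) UNIV * g \<in> ?L"
      by (simp only: colon_def mem_Collect_eq mult.commute)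
    then show "g \<in> lss_sat k E" unfolding lss_sat_def by blast
  qed
  show "lss_sat k E \<subseteq> colon ?L (pmon k (\<lambda>_. 1) ?B)"
    using pmon_reduce[OF E, of k _ UNIV] by (auto simp: lss_sat_def colon_def mult.commute)
qed

text \<open>An orthogonal representation of a properly 2-coloured graph: every vector has entry 1 at
  \<open>k0\<close>, entry 1 or -1 at \<open>k1\<close> according to its colour, and 0 elsewhere.
  Adjacent vectors have inner product 1 - 1 = 0. The coordinates are constant polynomials so that
  \<open>poly_subst\<close> evaluates at the point.\<close>

definition special_point :: "'d \<Rightarrow> 'd \<Rightarrow> ('n \<Rightarrow> bool) \<Rightarrow> 'n \<times> 'd \<Rightarrow> ('n \<times> 'd, 'k::comm_ring_1) mpoly" where
  "special_point k0 k1 c x = (if snd x = k0 then 1 else if snd x = k1 then (if c (fst x) then 1 else -1) else 0)"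

lemma sum_special_point:
  fixes c :: "'n::finite \<Rightarrow> bool"
  assumes "k0 \<noteq> k1" "c i \<noteq> c j"
  shows "(\<Sum>k\<in>UNIV - {k0}. special_point k0 k1 c (i, k) * special_point k0 k1 c (j, k)) =
     (- 1 :: ('n \<times> 'd::finite, 'k::comm_ring_1) mpoly)"
proof -
  have "(\<Sum>k\<in>UNIV - {k0}. special_point k0 k1 c (i, k) * special_point k0 k1 c (j, k)) =
     (\<Sum>k\<in>UNIV - {k0}. if k = k1 then (- 1 :: ('n \<times> 'd, 'k) mpoly) else 0)"
    by (rule sum.cong) (use assms in \<open>auto simp: special_point_def\<close>)
  also have "\<dots> = -1" using assms by simp
  finally show ?thesis .
qed

lemma subst_special_point:
  fixes E :: "'n::finite set set" and g :: "('n \<times> 'd::finite, 'k::comm_ring_1) mpoly"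
  assumes c: "\<And>a b. {a, b} \<in> E \<Longrightarrow> c a \<noteq> c b" and k: "k0 \<noteq> k1" and g: "g \<in> idl.span (lss_gens E)"
  shows "poly_subst (special_point k0 k1 c) g = 0"
proof -
  have "poly_subst (special_point k0 k1 c) g \<in> idl.span {}"
  proof (rule poly_subst_span[OF g])
    fix g :: "('n \<times> 'd, 'k) mpoly" assume "g \<in> lss_gens E"
    then obtain i j where ij: "g = dot UNIV i j" "{i, j} \<in> E" by (auto simp: lss_gens_def)
    have "poly_subst (special_point k0 k1 c) g = (\<Sum>k\<in>UNIV. special_point k0 k1 c (i, k) * special_point k0 k1 c (j, k))"
      by (simp add: ij dot_def)
    also have "\<dots> = special_point k0 k1 c (i, k0) * special_point k0 k1 c (j, k0) + (-1)"
      using sum_special_point[OF k, of c i j] c[OF ij(2)] by (subst sum.remove[of UNIV k0]) auto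
    also have "\<dots> = 0" by (simp add: special_point_def)
    finally show "poly_subst (special_point k0 k1 c) g \<in> idl.span {}" by simp
  qed
  then show ?thesis by simp
qed

text \<open>At the special point the ideal vanishes while each monomial in the coordinates
  \<open>k0\<close> takes the value 1.\<close>

lemma one_notin_lss_sat:
  fixes E :: "'n::finite set set"
  assumes "bridged E" "k0 \<noteq> k1"
  shows "(1 :: ('n \<times> 'd::finite, 'k::field) mpoly) \<notin> lss_sat k0 E"
proof
  assume "(1 :: ('n \<times> 'd, 'k) mpoly) \<in> lss_sat k0 E"
  then obtain n where n: "(pmon k0 n UNIV :: ('n \<times> 'd, 'k) mpoly) \<in> idl.span (lss_gens E)"
    by (auto simp: lss_sat_def)
  obtain c :: "'n \<Rightarrow> bool" where "\<And>a b. {a, b} \<in> E \<Longrightarrow> c a \<noteq> c b"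
    using bridged_2_colouring[OF assms(1)] by blast
  from subst_special_point[OF this assms(2) n] show False
    by (simp add: pmon_def special_point_def)
qed

lemma hom_comp_poly_subst:
  assumes "\<And>x. homog W' (W x) (f x)"
  shows "hom_comp W' j (poly_subst f p) = poly_subst f (hom_comp W j p)"
proof (induction p rule: poly_mapping_add_induct)
  case (single m c)
  have "homog W' (wt W m) (poly_subst f (Poly_Mapping.single m c))"
    by (rule homog_poly_subst[OF homog_single assms])
  then show ?case by (simp add: hom_comp_homog[OF homog_single] hom_comp_homog)
qed (simp_all add: hom_comp_add)

lemma poly_subst_ident [simp]: "poly_subst Var p = p"
  by (induction p rule: mpoly_induct) auto

lemma poly_subst_scale:
  assumes "homog (\<lambda>x. int (d x)) (int j) p"
  shows "poly_subst (\<lambda>x. y ^ d x * Var x) p = y ^ j * p"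
proof -
  have "mono_subst (\<lambda>x. y ^ d x * Var x) m = y ^ j * mono_subst Var m" if "m \<in> Poly_Mapping.keys p" for m
  proof -
    have "int (\<Sum>x\<in>UNIV. d x * expo m x) = int j"
      using assms that by (simp add: homog_def wt_def)
    then have *: "(\<Sum>x\<in>UNIV. d x * expo m x) = j" by linarith
    have "mono_subst (\<lambda>x. y ^ d x * Var x) m = (\<Prod>x\<in>UNIV. y ^ (d x * expo m x)) * mono_subst Var m"
      by (simp add: mono_subst_def power_mult_distrib prod.distrib power_mult)
    then show ?thesis by (simp add: power_sum[symmetric] *)
  qed
  then have "poly_subst (\<lambda>x. y ^ d x * Var x) p = y ^ j * poly_subst Var p"
    unfolding poly_subst_def by (simp add: sum_distrib_left mult.left_commute)
  then show ?thesis by simp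
qed

text \<open>A leaf \<open>l\<close> at \<open>u\<close> is eliminated by the homogenized parametrization of the solutions \<open>x\<^sub>l\<close> of \<open>x\<^sub>u \<cdot> x\<^sub>l = 0\<close>.\<close>

lemma lss_sat_prime:
  fixes E :: "'n::finite set set" and a b :: "('n \<times> 'd::finite, 'k::field) mpoly"
  assumes "bridged E" "k0 \<noteq> k1" "a * b \<in> lss_sat k0 E"
  shows "a \<in> lss_sat k0 E \<or> b \<in> lss_sat k0 E"
  using assms
proof (induction "card E" arbitrary: E a b rule: less_induct)
  case less
  note E = less.prems(1) and k01 = less.prems(2)
  show ?case
  proof (cases "E = {}")
    case True
    then have gens: "idl.span (lss_gens E) = ({0} :: ('n \<times> 'd, 'k) mpoly set)"
      by (simp add: lss_gens_def)
    have 0: "(0 :: ('n \<times> 'd, 'k) mpoly) \<in> lss_sat k0 E" by (rule idl.subspace_0[OF lss_sat_subspace])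
    obtain n where n: "pmon k0 n UNIV * (a * b) = 0" using less.prems(3) gens by (auto simp: lss_sat_def)
    have "(pmon k0 n UNIV :: ('n \<times> 'd, 'k) mpoly) \<noteq> 0"
      using one_notin_lss_sat[OF E k01, where 'k = 'k] gens by (auto simp: lss_sat_def)
    then have "a * b = 0" using mpoly_mult_eq_0D[OF n] by blast
    then show ?thesis using mpoly_mult_eq_0D[of a b] 0 by auto
  next
    case False
    then obtain p q where pq: "{p, q} \<in> E" using bridged_edgeE[OF E] by blast
    then obtain u l where ul: "{u, l} \<in> E" "\<And>e. e \<in> E \<Longrightarrow> l \<in> e \<Longrightarrow> e = {u, l}"
      using bridged_leaf[OF E pq] by blast
    define E' where "E' = E - {{u, l}}"
    have lE': "l \<notin> e" if "e \<in> E'" for e using ul(2)[of e] that by (auto simp: E'_def)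
    have unl: "u \<noteq> l" by (rule bridged_neq[OF E ul(1)])
    have E': "bridged E'" by (rule bridged_subset[OF E]) (auto simp: E'_def)
    have "E' \<subset> E" using ul(1) by (auto simp: E'_def)
    then have cE': "card E' < card E" by (rule psubset_card_mono[rotated]) simp
    let ?L = "idl.span (lss_gens E) :: ('n \<times> 'd, 'k) mpoly set"
    let ?L' = "idl.span (lss_gens E') :: ('n \<times> 'd, 'k) mpoly set"
    have LL: "?L' \<subseteq> ?L" by (rule idl.span_mono) (auto simp: lss_gens_def E'_def)
    define x where "x = (Var (u, k0) :: ('n \<times> 'd, 'k) mpoly)"
    define s where "s = (- (\<Sum>k\<in>UNIV - {k0}. Var (u, k) * Var (l, k)) :: ('n \<times> 'd, 'k) mpoly)"
    \<comment> \<open>Solving the equation of the edge for the coordinate \<open>k0\<close> of the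
      leaf gives \<open>s / x\<close>. Multiplying all coordinates of the leaf by \<open>x\<close>
      clears the denominator; \<open>f'\<close> is this rescaling without the solving.\<close>
    define f where "f y = (if y = (l, k0) then s else if fst y = l then x * Var y else Var y)" for y
    define f' where "f' y = x ^ (if fst y = l then 1 else 0) * Var y" for y
    define D where "D = (\<lambda>y :: 'n \<times> 'd. int (if fst y = l then 1 else 0))"
    have f_dot: "poly_subst f (dot UNIV u l) = 0"
    proof -
      have "poly_subst f (dot UNIV u l) = x * s + (\<Sum>k\<in>UNIV - {k0}. Var (u, k) * (x * Var (l, k)))"
        unfolding dot_def poly_subst_sum using unl
        by (subst sum.remove[of UNIV k0]) (auto simp: f_def x_def intro!: sum.cong)
      also have "\<dots> = 0"
        by (simp add: s_def sum_distrib_left mult.left_commute)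
      finally show ?thesis .
    qed
    have f_gen: "poly_subst f g = g" if "g \<in> lss_gens E'" for g
    proof -
      obtain i j where ij: "g = dot UNIV i j" "{i, j} \<in> E'" using \<open>g \<in> lss_gens E'\<close> by (auto simp: lss_gens_def)
      then have "i \<noteq> l" "j \<noteq> l" using lE'[OF ij(2)] by auto
      then show ?thesis by (simp add: ij dot_def f_def)
    qed
    have f_L: "poly_subst f g \<in> ?L'" if g: "g \<in> ?L" for g
    proof (rule poly_subst_span[OF g])
      fix g :: "('n \<times> 'd, 'k) mpoly" assume "g \<in> lss_gens E"
      then obtain i j where ij: "g = dot UNIV i j" "{i, j} \<in> E" by (auto simp: lss_gens_def)
      show "poly_subst f g \<in> ?L'"
      proof (cases "{i, j} = {u, l}")
        case True
        then have "g = dot UNIV u l" using ij by (auto simp: doubleton_eq_iff dot_commute)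
        then show ?thesis by (simp add: f_dot idl.span_zero)
      next
        case False
        then have "g \<in> lss_gens E'" using ij by (auto simp: lss_gens_def E'_def)
        then show ?thesis by (simp add: f_gen idl.span_base)
      qed
    qed
    obtain c :: "'n \<Rightarrow> bool" where c: "\<And>a b. {a, b} \<in> E \<Longrightarrow> c a \<noteq> c b"
      using bridged_2_colouring[OF E] by blast
    \<comment> \<open>The image of the monomial has to be cancelled in the saturation for
      \<open>E'\<close>. This ideal is prime by induction, and the special point shows that the
      image lies outside it.\<close>
    have to: "poly_subst f g \<in> lss_sat k0 E'" if g: "g \<in> lss_sat k0 E" for g
    proof -
      obtain n where n: "pmon k0 n UNIV * g \<in> ?L" using g by (auto simp: lss_sat_def)
      then have "poly_subst f (pmon k0 n UNIV) * poly_subst f g \<in> lss_sat k0 E'"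
        using f_L[OF n] lss_sat_superset by auto
      then have "poly_subst f (pmon k0 n UNIV) \<in> lss_sat k0 E' \<or> poly_subst f g \<in> lss_sat k0 E'"
        by (rule less.hyps[OF cE' E' k01])
      moreover have "poly_subst f (pmon k0 n UNIV) \<notin> lss_sat k0 E'"
      proof
        assume "poly_subst f (pmon k0 n UNIV) \<in> lss_sat k0 E'"
        then obtain m where m: "pmon k0 m UNIV * poly_subst f (pmon k0 n UNIV) \<in> ?L'"
          by (auto simp: lss_sat_def)
        have "poly_subst (special_point k0 k1 c) (f (v, k0)) = 1" for v
          using sum_special_point[OF k01, of c u l, where 'k = 'k] c[OF ul(1)]
          by (auto simp: f_def s_def special_point_def)
        then have "poly_subst (special_point k0 k1 c) (pmon k0 m UNIV * poly_subst f (pmon k0 n UNIV)) = 1"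
          by (simp add: pmon_def special_point_def)
        moreover have "\<And>a b. {a, b} \<in> E' \<Longrightarrow> c a \<noteq> c b" using c by (simp add: E'_def)
        ultimately show False using subst_special_point[OF _ k01 m, of c] by simp
      qed
      ultimately show ?thesis by blast
    qed
    have homf: "homog D (D y) (f y)" for y
      using unl unfolding f_def s_def x_def
      by (cases y) (auto intro!: homog_uminus homog_sum homog_mult'[OF homog_Var homog_Var] homog_Var simp: D_def)
    \<comment> \<open>The two substitutions differ only at \<open>(l, k0)\<close>, where the
      difference is the generator of the removed edge.\<close>
    have ff': "poly_subst f' g - poly_subst f g \<in> ?L" for g
    proof (induction g rule: mpoly_induct)
      case (Var y)
      have "x * Var (l, k0) - s = dot UNIV u l"
        by (simp add: x_def s_def dot_remove[of k0 UNIV u l] dot_def[of "UNIV - {k0}"])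
      moreover have "dot UNIV u l \<in> ?L" using ul(1) by (intro idl.span_base) (auto simp: lss_gens_def)
      ultimately show ?case by (cases "y = (l, k0)") (auto simp: f_def f'_def idl.span_zero)
    next
      case (add p q)
      then show ?case using idl.span_add[OF add] by (simp add: algebra_simps)
    next
      case (mult p q)
      have "poly_subst f' p * (poly_subst f' q - poly_subst f q) + poly_subst f q * (poly_subst f' p - poly_subst f p) \<in> ?L"
        by (rule idl.span_add[OF idl.span_scale[OF mult(2)] idl.span_scale[OF mult(1)]])
      then show ?case by (simp add: algebra_simps)
    qed (simp add: idl.span_zero)
    \<comment> \<open>On polynomials of degree i in the variables of the leaf, \<open>f'\<close> is
      multiplication by \<open>x ^ i\<close>, which the saturation absorbs. Hence the passage to
      components for the weight \<open>D\<close>.\<close>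
    have from': "g \<in> lss_sat k0 E" if g: "poly_subst f g \<in> lss_sat k0 E'" for g
    proof -
      obtain n where n: "pmon k0 n UNIV * poly_subst f g \<in> ?L'" using g by (auto simp: lss_sat_def)
      have "homog D (int (n l)) (\<Prod>v\<in>UNIV. Var (v, k0) ^ n v :: ('n \<times> 'd, 'k) mpoly)"
      proof -
        have "homog D (D (v, k0) * int m) (Var (v, k0) ^ m :: ('n \<times> 'd, 'k) mpoly)" for v m
          by (induction m) (auto intro!: homog_mult' homog_Var simp: algebra_simps)
        then have "homog D (\<Sum>v\<in>UNIV. D (v, k0) * int (n v)) (\<Prod>v\<in>UNIV. Var (v, k0) ^ n v :: ('n \<times> 'd, 'k) mpoly)"
          by (intro homog_prod)
        moreover have "(\<Sum>v\<in>UNIV. D (v, k0) * int (n v)) = (\<Sum>v\<in>UNIV. if v = l then int (n v) else 0)"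
          by (rule sum.cong) (auto simp: D_def)
        ultimately show ?thesis by simp
      qed
      then have hn: "homog D (int (n l)) (pmon k0 n UNIV :: ('n \<times> 'd, 'k) mpoly)" by (simp add: pmon_def)
      have hom_comp_in: "hom_comp D j g \<in> lss_sat k0 E" for j
      proof (cases "j < 0")
        case True
        then have "hom_comp D j g = 0" by (intro hom_comp_neg_eq_0) (auto simp: D_def)
        then show ?thesis by (simp add: idl.subspace_0[OF lss_sat_subspace])
      next
        case False
        then obtain i where i: "j = int i" by (metis nonneg_int_cases not_less)
        have "\<exists>a. homog D a g" if "g \<in> lss_gens E'" for g :: "('n \<times> 'd, 'k) mpoly"
        proof -
          obtain p q where "g = dot UNIV p q" "{p, q} \<in> E'" using \<open>g \<in> lss_gens E'\<close> by (auto simp: lss_gens_def)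
          then have "homog D 0 g" using lE'[of "{p, q}"] by (auto intro!: homog_dot simp: D_def)
          then show ?thesis by blast
        qed
        then have "hom_comp D (j + int (n l)) (pmon k0 n UNIV * poly_subst f g) \<in> ?L'"
          by (intro hom_comp_span[OF n])
        then have "pmon k0 n UNIV * poly_subst f (hom_comp D j g) \<in> ?L'"
          by (simp add: hom_comp_mult_homog[OF hn] hom_comp_poly_subst[OF homf])
        then have "pmon k0 n UNIV * poly_subst f (hom_comp D j g) +
            pmon k0 n UNIV * (poly_subst f' (hom_comp D j g) - poly_subst f (hom_comp D j g)) \<in> ?L"
          using LL by (intro idl.span_add[OF _ idl.span_scale[OF ff']]) auto
        then have "pmon k0 n UNIV * poly_subst f' (hom_comp D j g) \<in> ?L" by (simp add: algebra_simps)
        moreover have "poly_subst f' (hom_comp D j g) = x ^ i * hom_comp D j g"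
          using poly_subst_scale[of "\<lambda>y. if fst y = l then 1 else 0" i "hom_comp D j g" x]
          by (simp add: f'_def[abs_def] D_def i)
        ultimately have "pmon k0 n UNIV * (x ^ i * hom_comp D j g) \<in> ?L" by simp
        moreover have "pmon k0 (\<lambda>v. if v = u then i else 0) UNIV = x ^ i"
        proof -
          have "pmon k0 (\<lambda>v. if v = u then i else 0) UNIV = (\<Prod>v\<in>UNIV. if v = u then x ^ i else 1)"
            unfolding pmon_def by (rule prod.cong) (auto simp: x_def)
          then show ?thesis by simp
        qed
        ultimately have "pmon k0 (\<lambda>v. n v + (if v = u then i else 0)) UNIV * hom_comp D j g \<in> ?L"
          by (simp add: pmon_add[symmetric] mult.assoc)
        then show ?thesis unfolding lss_sat_def by blast
      qed
      have "(\<Sum>j\<in>wt D ` Poly_Mapping.keys g. hom_comp D j g) \<in> lss_sat k0 E"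
        by (rule idl.subspace_sum[OF lss_sat_subspace hom_comp_in])
      then show ?thesis by (simp add: sum_comp)
    qed
    have "poly_subst f a * poly_subst f b \<in> lss_sat k0 E'" using to[OF less.prems(3)] by simp
    then have "poly_subst f a \<in> lss_sat k0 E' \<or> poly_subst f b \<in> lss_sat k0 E'"
      by (rule less.hyps[OF cE' E' k01])
    then show ?thesis using from' by blast
  qed
qed

lemma v_number_le:
  assumes "f \<in> homogeneous e" "colon I f \<in> Ass I"
  shows "v_number I \<le> e"
  unfolding v_number_def by (rule Least_le) (use assms in blast)

lemma v_number_lss_le:
  fixes E :: "'n::finite set set"
  assumes E: "bridged E" and k: "k0 \<noteq> (k1 :: 'd::finite)"
  shows "v_number (lss_ideal E :: ('n \<times> 'd, 'k::field) mpoly set) \<le> card {v. card (UNIV :: 'd set) \<le> edge_deg E v}"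
proof (rule v_number_le)
  let ?B = "{v. card (UNIV :: 'd set) \<le> edge_deg E v}"
  let ?f = "pmon k0 (\<lambda>_. 1) ?B :: ('n \<times> 'd, 'k) mpoly"
  have "homog (\<lambda>_. 1) (\<Sum>v\<in>?B. 1) ?f"
    unfolding pmon_def by (intro homog_prod) (simp add: homog_Var)
  then show "?f \<in> homogeneous (card ?B)" by (simp add: homogeneous_diff_iff)
  have "primeideal (lss_sat k0 E :: ('n \<times> 'd, 'k) mpoly set) class_ring"
    by (intro primeideal_class_ringI lss_sat_subspace one_notin_lss_sat[OF E k] lss_sat_prime[OF E k])
  then show "colon (lss_ideal E) ?f \<in> Ass (lss_ideal E)"
    using colon_pmon[OF E, of k0, where 'k = 'k] by (auto simp: Ass_def lss_ideal_eq)
qed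

section \<open>The Koszul complex of the variables\<close>

text \<open>The sign in \<open>e_v \<and> e_A = \<plusminus> e_{A \<union> {v}}\<close> for
  \<open>v\<close> outside \<open>A\<close>, where basis elements are wedges in the order of
  \<open>var_index\<close>.\<close>

definition ksgn :: "'v::finite \<Rightarrow> 'v set \<Rightarrow> ('v, 'k::comm_ring_1) mpoly" where
  "ksgn v A = (-1) ^ card {a \<in> A. var_index a < var_index v}"

text \<open>The Koszul differential of the variables in \<open>V\<close>, read coefficientwise: the
  coefficient of the boundary at \<open>e_A\<close> collects the basis elements with one more
  index.\<close>

definition koszul_on :: "'v set \<Rightarrow> ('v::finite set \<Rightarrow> ('v, 'k::comm_ring_1) mpoly) \<Rightarrow> 'v set \<Rightarrow> ('v, 'k) mpoly" where
  "koszul_on V w A = (\<Sum>v\<in>V - A. ksgn v A * Var v * w (insert v A))"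

text \<open>A chain is given by its coefficients at the basis elements \<open>e\<^sub>A\<close> of the exterior algebra.\<close>

abbreviation koszul :: "('v::finite set \<Rightarrow> ('v, 'k::comm_ring_1) mpoly) \<Rightarrow> 'v set \<Rightarrow> ('v, 'k) mpoly" where
  "koszul \<equiv> koszul_on UNIV"

text \<open>Left multiplication by the 1-chain with coefficients \<open>b\<close> in the exterior
  algebra.\<close>

definition wedge :: "('v \<Rightarrow> ('v, 'k) mpoly) \<Rightarrow> ('v::finite set \<Rightarrow> ('v, 'k::comm_ring_1) mpoly) \<Rightarrow> 'v set \<Rightarrow> ('v, 'k) mpoly" where
  "wedge b w A = (\<Sum>v\<in>A. ksgn v (A - {v}) * b v * w (A - {v}))"

lemma ksgn_sq: "ksgn v A * (ksgn v A * p) = p"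
  by (simp add: ksgn_def mult.assoc[symmetric] power_add[symmetric] mult_2[symmetric])

lemma ksgn_insert:
  assumes "w \<notin> A"
  shows "ksgn v (insert w A) = (if var_index w < var_index v then - 1 else 1) * ksgn v A"
proof -
  have "{a \<in> insert w A. var_index a < var_index v} =
    (if var_index w < var_index v then insert w {a \<in> A. var_index a < var_index v} else {a \<in> A. var_index a < var_index v})"
    by auto
  then show ?thesis using assms by (simp add: ksgn_def)
qed

lemma ksgn_swap:
  assumes "w \<notin> A" "v \<notin> A" "v \<noteq> w"
  shows "ksgn v (insert w A) * ksgn w (insert v A) = - (ksgn v A * ksgn w A)"
  using assms inj_var_index by (auto simp: ksgn_insert dest: injD[of var_index v w] intro: linorder_cases[of "var_index v" "var_index w"])

lemma koszul_on_diff: "koszul_on V (\<lambda>A. x A - y A) A = koszul_on V x A - koszul_on V y A"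
  by (simp add: koszul_on_def right_diff_distrib sum_subtractf)

lemma koszul_on_scale: "koszul_on V (\<lambda>A. c * x A) A = c * koszul_on V x A"
  by (simp add: koszul_on_def sum_distrib_left mult_ac)

lemma koszul_on_sum: "koszul_on V (\<lambda>A. \<Sum>i\<in>I. x i A) A = (\<Sum>i\<in>I. koszul_on V (x i) A)"
  unfolding koszul_on_def sum_distrib_left by (rule sum.swap)

lemma koszul_on_mem: "idl.subspace I \<Longrightarrow> (\<And>A. w A \<in> I) \<Longrightarrow> koszul_on V w A \<in> I"
  unfolding koszul_on_def by (intro idl.subspace_sum idl.subspace_scale) auto

lemma wedge_mem: "idl.subspace I \<Longrightarrow> (\<And>A. w A \<in> I) \<Longrightarrow> wedge b w A \<in> I"
  unfolding wedge_def by (intro idl.subspace_sum idl.subspace_scale) auto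

text \<open>The pairs are matched by means of an ordering. Comparing the sum with its negative would
  only show that its double is zero, which says nothing in characteristic 2.\<close>

lemma sum_antisymmetric:
  fixes g :: "'v::finite \<Rightarrow> 'v \<Rightarrow> 'a::ab_group_add"
  assumes "\<And>v w. v \<in> B \<Longrightarrow> w \<in> B \<Longrightarrow> v \<noteq> w \<Longrightarrow> g w v = - g v w"
  shows "(\<Sum>v\<in>B. \<Sum>w\<in>B - {v}. g v w) = 0"
proof -
  let ?lt = "\<lambda>v w. var_index v < var_index w"
  have eq: "v = w" if "\<not> ?lt v w" "\<not> ?lt w v" for v w :: 'v
    using that inj_var_index by (meson injD linorder_neqE_nat)
  have "(\<Sum>v\<in>B. \<Sum>w\<in>B - {v}. g v w) = (\<Sum>v\<in>B. (\<Sum>w\<in>{w \<in> B. ?lt v w}. g v w) + (\<Sum>w\<in>{w \<in> B. ?lt w v}. g v w))"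
  proof (rule sum.cong[OF refl])
    fix v
    have "B - {v} = {w \<in> B. ?lt v w} \<union> {w \<in> B. ?lt w v}" using eq by blast
    moreover have "{w \<in> B. ?lt v w} \<inter> {w \<in> B. ?lt w v} = {}" by auto
    ultimately show "(\<Sum>w\<in>B - {v}. g v w) = (\<Sum>w\<in>{w \<in> B. ?lt v w}. g v w) + (\<Sum>w\<in>{w \<in> B. ?lt w v}. g v w)"
      by (simp add: sum.union_disjoint)
  qed
  also have "\<dots> = (\<Sum>v\<in>B. \<Sum>w\<in>{w \<in> B. ?lt v w}. g v w) + (\<Sum>v\<in>B. \<Sum>w\<in>{w \<in> B. ?lt w v}. g v w)"
    by (rule sum.distrib)
  also have "(\<Sum>v\<in>B. \<Sum>w\<in>{w \<in> B. ?lt w v}. g v w) = (\<Sum>w\<in>B. \<Sum>v\<in>{v \<in> B. ?lt w v}. g v w)"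
    by (rule sum.swap_restrict) auto
  also have "\<dots> = (\<Sum>w\<in>B. \<Sum>v\<in>{v \<in> B. ?lt w v}. - g w v)"
    by (intro sum.cong refl assms) auto
  finally show ?thesis by (simp add: sum_negf)
qed

lemma koszul_koszul: "koszul (koszul w) A = 0"
proof -
  have "koszul (koszul w) A = (\<Sum>v\<in>- A. \<Sum>u\<in>- A - {v}. ksgn v A * Var v * (ksgn u (insert v A) * Var u * w (insert u (insert v A))))"
    unfolding koszul_on_def Compl_eq_Diff_UNIV[symmetric] sum_distrib_left
    by (intro sum.cong) auto
  also have "\<dots> = 0"
  proof (rule sum_antisymmetric)
    fix v u assume *: "v \<in> - A" "u \<in> - A" "v \<noteq> u"
    have "var_index u < var_index v \<longleftrightarrow> \<not> var_index v < var_index u"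
      using *(3) inj_var_index by (metis injD linorder_neqE_nat not_less_iff_gr_or_eq)
    then show "ksgn u A * Var u * (ksgn v (insert u A) * Var v * w (insert v (insert u A)))
        = - (ksgn v A * Var v * (ksgn u (insert v A) * Var u * w (insert u (insert v A))))"
      using * by (simp add: ksgn_insert insert_commute mult_ac)
  qed
  finally show ?thesis .
qed

text \<open>The Leibniz rule for the product with a 1-chain. Terms that insert and remove the same
  index add up to the boundary of the 1-chain; for different indices the terms of the two iterated
  sums cancel by \<open>ksgn_swap\<close>.\<close>

lemma koszul_wedge:
  "koszul (wedge b w) A = (\<Sum>v\<in>UNIV. Var v * b v) * w A - wedge b (koszul w) A"
proof -
  have 1: "koszul (wedge b w) A = (\<Sum>v\<in>- A. Var v * b v * w A +
      (\<Sum>u\<in>A. ksgn v A * Var v * (ksgn u (insert v (A - {u})) * b u * w (insert v (A - {u})))))"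
    unfolding koszul_on_def Compl_eq_Diff_UNIV[symmetric]
  proof (rule sum.cong[OF refl])
    fix v assume v: "v \<in> - A"
    have "wedge b w (insert v A) = ksgn v A * b v * w A + (\<Sum>u\<in>A. ksgn u (insert v A - {u}) * b u * w (insert v A - {u}))"
      unfolding wedge_def using v by (subst sum.insert) auto
    also have "(\<Sum>u\<in>A. ksgn u (insert v A - {u}) * b u * w (insert v A - {u})) =
        (\<Sum>u\<in>A. ksgn u (insert v (A - {u})) * b u * w (insert v (A - {u})))"
    proof (rule sum.cong[OF refl])
      fix u assume "u \<in> A"
      then have "insert v A - {u} = insert v (A - {u})" using v by auto
      then show "ksgn u (insert v A - {u}) * b u * w (insert v A - {u}) = ksgn u (insert v (A - {u})) * b u * w (insert v (A - {u}))"
        by simp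
    qed
    finally show "ksgn v A * Var v * wedge b w (insert v A) = Var v * b v * w A +
       (\<Sum>u\<in>A. ksgn v A * Var v * (ksgn u (insert v (A - {u})) * b u * w (insert v (A - {u}))))"
      using ksgn_sq[of v A "Var v * b v * w A"] by (simp add: distrib_left sum_distrib_left mult_ac)
  qed
  have 2: "wedge b (koszul w) A = (\<Sum>u\<in>A. Var u * b u * w A +
      (\<Sum>v\<in>- A. ksgn u (A - {u}) * b u * (ksgn v (A - {u}) * Var v * w (insert v (A - {u})))))"
    unfolding wedge_def
  proof (rule sum.cong[OF refl])
    fix u assume u: "u \<in> A"
    have "UNIV - (A - {u}) = insert u (- A)" using u by auto
    then have "koszul w (A - {u}) = ksgn u (A - {u}) * Var u * w A + (\<Sum>v\<in>- A. ksgn v (A - {u}) * Var v * w (insert v (A - {u})))"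
      unfolding koszul_on_def using u by (simp add: insert_absorb)
    then show "ksgn u (A - {u}) * b u * koszul w (A - {u}) = Var u * b u * w A +
      (\<Sum>v\<in>- A. ksgn u (A - {u}) * b u * (ksgn v (A - {u}) * Var v * w (insert v (A - {u}))))"
      using ksgn_sq[of u "A - {u}" "Var u * b u * w A"] by (simp add: distrib_left sum_distrib_left mult_ac)
  qed
  have 3: "(\<Sum>v\<in>- A. \<Sum>u\<in>A. ksgn v A * Var v * (ksgn u (insert v (A - {u})) * b u * w (insert v (A - {u})))) =
    - (\<Sum>u\<in>A. \<Sum>v\<in>- A. ksgn u (A - {u}) * b u * (ksgn v (A - {u}) * Var v * w (insert v (A - {u}))))"
  proof -
    have "ksgn v A * Var v * (ksgn u (insert v (A - {u})) * b u * w (insert v (A - {u})))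
      = - (ksgn u (A - {u}) * b u * (ksgn v (A - {u}) * Var v * w (insert v (A - {u}))))"
      if "v \<in> - A" "u \<in> A" for u v
    proof -
      have "ksgn v (insert u (A - {u})) * ksgn u (insert v (A - {u})) = - (ksgn v (A - {u}) * ksgn u (A - {u}) :: ('a, 'b) mpoly)"
        by (rule ksgn_swap) (use that in auto)
      then have "ksgn v A * ksgn u (insert v (A - {u})) * (Var v * b u * w (insert v (A - {u})))
         = - (ksgn v (A - {u}) * ksgn u (A - {u})) * (Var v * b u * w (insert v (A - {u})))"
        using that by (simp add: insert_absorb)
      then show ?thesis by (simp add: mult_ac)
    qed
    then show ?thesis by (subst sum.swap) (simp add: sum_negf)
  qed
  have 4: "(\<Sum>v\<in>UNIV. Var v * b v) * w A = (\<Sum>v\<in>- A. Var v * b v * w A) + (\<Sum>u\<in>A. Var u * b u * w A)"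
    by (subst sum.union_disjoint[symmetric]) (auto simp: sum_distrib_right)
  show ?thesis unfolding 1 2 4 sum.distrib 3 by simp
qed

section \<open>Exactness of the Koszul complex\<close>

lemma poly_subst_kill_UNIV: "poly_subst (kill UNIV) p = Const (coef p 0)"
proof (induction p rule: poly_mapping_add_induct)
  case (single m c)
  show ?case
  proof (cases "m = 0")
    case True
    then show ?thesis by (simp add: poly_subst_single mono_subst_def)
  next
    case False
    then obtain v where "expo m v \<noteq> 0" by (metis lookup_zero poly_mapping_eqI)
    then have "kill UNIV v ^ expo m v = (0 :: ('a, 'b) mpoly)" by (simp add: kill_def power_0_left)
    then have "mono_subst (kill UNIV) m = (0 :: ('a, 'b) mpoly)"
      unfolding mono_subst_def by (intro prod_zero bexI[of _ v]) auto
    then show ?thesis using False by (simp add: poly_subst_single lookup_single)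
  qed
qed (simp_all add: lookup_add)

lemma diff_kill_in_span:
  fixes p :: "('v::finite, 'k::comm_ring_1) mpoly"
  shows "p - poly_subst (kill S) p \<in> idl.span (Var ` S)"
proof (induction p rule: mpoly_induct)
  case (add p q)
  then show ?case using idl.span_add[OF add] by (simp add: algebra_simps)
next
  case (mult p q)
  then show ?case using idl.span_add[OF idl.span_scale[OF mult(2), of p] idl.span_scale[OF mult(1), of "poly_subst (kill S) q"]]
    by (simp add: algebra_simps)
qed (auto simp: kill_def idl.span_zero intro: idl.span_base)

lemma in_span_range_Var:
  fixes p :: "('v::finite, 'k::comm_ring_1) mpoly"
  shows "coef p 0 = 0 \<Longrightarrow> p \<in> idl.span (range Var)"
  using diff_kill_in_span[of p UNIV] by (simp add: poly_subst_kill_UNIV)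

text \<open>Induction on the number of variables, as for a mapping cone: a chain splits into a part
  without and a part with the new index. In exterior degree 0 every chain is a cycle and the
  homology is the quotient by the variables, which explains the condition on
  \<open>w {}\<close>.\<close>

lemma koszul_on_exact:
  fixes w :: "'v::finite set \<Rightarrow> ('v, 'k::field) mpoly"
  defines "V \<equiv> \<lambda>n. {v :: 'v. var_index v < n}"
  assumes "\<And>A. w A \<noteq> 0 \<Longrightarrow> A \<subseteq> V n" "\<And>A. A \<subseteq> V n \<Longrightarrow> koszul_on (V n) w A = 0" "w {} \<in> idl.span (Var ` V n)"
  shows "\<exists>y. (\<forall>A. y A \<noteq> 0 \<longrightarrow> A \<subseteq> V n) \<and> (\<forall>A. A \<subseteq> V n \<longrightarrow> koszul_on (V n) y A = w A)"
  using assms(2-)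
proof (induction n arbitrary: w)
  case 0
  then have "w A = 0" if "A \<subseteq> V 0" for A using that by (simp add: V_def)
  then show ?case by (intro exI[of _ "\<lambda>_. 0"]) (simp add: koszul_on_def)
next
  case (Suc n)
  show ?case
  proof (cases "\<exists>v :: 'v. var_index v = n")
    case False
    then have "V (Suc n) = V n" by (auto simp: V_def less_Suc_eq)
    then show ?thesis using Suc by simp
  next
    case True
    then obtain v :: 'v where v: "var_index v = n" by blast
    have VS: "V (Suc n) = insert v (V n)" using v inj_var_index by (auto simp: V_def less_Suc_eq dest: injD)
    have vV: "v \<notin> V n" using v by (simp add: V_def)
    let ?d = "koszul_on (V n)"
    \<comment> \<open>The new variable has the largest index, so its sign counts all elements of
      \<open>A\<close>.\<close>
    define e :: "'v set \<Rightarrow> ('v, 'k) mpoly" where "e A = (-1) ^ card A" for A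
    have sv: "ksgn v A = e A" if "A \<subseteq> V n" for A
    proof -
      have "{a \<in> A. var_index a < var_index v} = A" using that v by (auto simp: V_def)
      then show ?thesis by (simp add: ksgn_def e_def)
    qed
    have sw: "ksgn u (insert v A) = ksgn u A" if "A \<subseteq> V n" "u \<in> V n" for u A
      using that vV v by (subst ksgn_insert) (auto simp: V_def)
    have d1: "koszul_on (V (Suc n)) y A = ?d y A + e A * Var v * y (insert v A)" if A: "A \<subseteq> V n" for y :: "'v set \<Rightarrow> ('v, 'k) mpoly" and A
    proof -
      have "V (Suc n) - A = insert v (V n - A)" using A vV VS by auto
      then show ?thesis unfolding koszul_on_def using vV A by (simp add: sv)
    qed
    have d2: "koszul_on (V (Suc n)) y (insert v A) = ?d (\<lambda>A. y (insert v A)) A" if A: "A \<subseteq> V n" for y :: "'v set \<Rightarrow> ('v, 'k) mpoly" and A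
    proof -
      have "V (Suc n) - insert v A = V n - A" using A vV VS by auto
      then show ?thesis unfolding koszul_on_def using A by (auto simp: sw insert_commute intro!: sum.cong)
    qed
    have dcong: "?d y A = ?d y' A" if "A \<subseteq> V n" "\<And>B. B \<subseteq> V n \<Longrightarrow> B \<noteq> {} \<Longrightarrow> y B = y' B" for y y' :: "'v set \<Rightarrow> ('v, 'k) mpoly" and A
      unfolding koszul_on_def using that by (intro sum.cong) auto
    define b where "b A = (if A \<subseteq> V n then w (insert v A) else 0)" for A
    have db: "?d b A = 0" if A: "A \<subseteq> V n" for A
    proof -
      have "?d b A = ?d (\<lambda>A. w (insert v A)) A" using A by (rule dcong) (simp add: b_def)
      also have "\<dots> = 0" using d2[OF A, of w] Suc.prems(2)[of "insert v A"] A VS by auto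
      finally show ?thesis .
    qed
    have dw: "?d w A + e A * Var v * b A = 0" if A: "A \<subseteq> V n" for A
      using d1[OF A, of w] Suc.prems(2)[of A] A VS by (auto simp: b_def)
    have "?d w {} \<in> idl.span (Var ` V n)"
      unfolding koszul_on_def
    proof (rule idl.span_sum)
      fix u assume "u \<in> V n - {}"
      then have "(ksgn u {} * w {u}) * Var u \<in> idl.span (Var ` V n)"
        by (intro idl.span_scale idl.span_base) auto
      then show "ksgn u {} * Var u * w {u} \<in> idl.span (Var ` V n)" by (simp add: mult_ac)
    qed
    \<comment> \<open>The part with the new index inherits the condition at the empty set because
      the new variable is a nonzerodivisor modulo the earlier ones.\<close>
    then have "Var v * b {} \<in> idl.span (Var ` V n)"
      using dw[of "{}"] idl.span_neg[of "?d w {}" "Var ` V n"] by (simp add: e_def eq_neg_iff_add_eq_0[symmetric])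
    then have "b {} \<in> idl.span (Var ` V n)"
      by (rule span_free_variable[rotated]) (use vV in \<open>auto simp: kill_def\<close>)
    then have "\<exists>y. (\<forall>A. y A \<noteq> 0 \<longrightarrow> A \<subseteq> V n) \<and> (\<forall>A. A \<subseteq> V n \<longrightarrow> ?d y A = b A)"
      by (intro Suc.IH db) (auto simp: b_def split: if_splits)
    then obtain c where c: "\<And>A. c A \<noteq> 0 \<Longrightarrow> A \<subseteq> V n" "\<And>A. A \<subseteq> V n \<Longrightarrow> ?d c A = b A"
      by blast
    obtain r where r: "w {} - r * Var v \<in> idl.span (Var ` V n)"
      using Suc.prems(3) unfolding VS image_insert idl.span_breakdown_eq by blast
    \<comment> \<open>A boundary does not see the coefficient at the empty set, so it may be chosen
      freely. The value \<open>r\<close> makes the remaining part \<open>a\<close> satisfy the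
      condition at the empty set.\<close>
    define c' where "c' = c({} := r)"
    have c': "?d c' A = b A" if "A \<subseteq> V n" for A
      using dcong[OF that, of c' c] c(2)[OF that] by (simp add: c'_def)
    define a where "a A = (if A \<subseteq> V n then w A - e A * Var v * c' A else 0)" for A
    have da: "?d a A = 0" if A: "A \<subseteq> V n" for A
    proof -
      have "?d a A = ?d (\<lambda>A. w A - Var v * (e A * c' A)) A"
        using A by (rule dcong) (simp add: a_def mult_ac)
      also have "\<dots> = ?d w A - Var v * ?d (\<lambda>A. e A * c' A) A"
        by (simp add: koszul_on_diff koszul_on_scale)
      also have "?d (\<lambda>A. e A * c' A) A = - (e A * ?d c' A)"
        unfolding koszul_on_def sum_distrib_left sum_negf[symmetric]
      proof (rule sum.cong[OF refl])
        fix u assume "u \<in> V n - A"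
        then have "e (insert u A) = - e A" by (simp add: e_def)
        then show "ksgn u A * Var u * (e (insert u A) * c' (insert u A)) = - (e A * (ksgn u A * Var u * c' (insert u A)))"
          by (simp add: mult_ac)
      qed
      also have "?d w A - Var v * - (e A * ?d c' A) = ?d w A + e A * Var v * b A"
        by (simp add: c'[OF A] mult_ac)
      finally show ?thesis using dw[OF A] by simp
    qed
    have "a {} \<in> idl.span (Var ` V n)" using r by (simp add: a_def e_def c'_def mult_ac)
    then have "\<exists>y. (\<forall>A. y A \<noteq> 0 \<longrightarrow> A \<subseteq> V n) \<and> (\<forall>A. A \<subseteq> V n \<longrightarrow> ?d y A = a A)"
      by (intro Suc.IH da) (auto simp: a_def split: if_splits)
    then obtain g where g: "\<And>A. g A \<noteq> 0 \<Longrightarrow> A \<subseteq> V n" "\<And>A. A \<subseteq> V n \<Longrightarrow> ?d g A = a A"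
      by blast
    define y where "y B = (if v \<in> B then c' (B - {v}) else g B)" for B
    have yA: "y A = g A" "y (insert v A) = c' A" if "A \<subseteq> V n" for A
      using that vV by (auto simp: y_def insert_absorb intro!: arg_cong[of _ _ c'])
    have "A \<subseteq> V (Suc n)" if "y A \<noteq> 0" for A
      using that g(1)[of A] c(1)[of "A - {v}"] by (auto simp: y_def c'_def VS split: if_splits)
    moreover have "koszul_on (V (Suc n)) y A = w A" if A: "A \<subseteq> V (Suc n)" for A
    proof (cases "v \<in> A")
      case False
      then have A': "A \<subseteq> V n" using A VS by auto
      have "?d y A = ?d g A" using A' by (rule dcong) (simp add: yA)
      then show ?thesis using d1[OF A', of y] g(2)[OF A'] yA[OF A'] A' by (simp add: a_def)
    next
      case True
      define B where "B = A - {v}"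
      have B: "A = insert v B" "B \<subseteq> V n" using True A VS by (auto simp: B_def)
      have "?d (\<lambda>A. y (insert v A)) B = ?d c' B" using B(2) by (rule dcong) (simp add: yA)
      then show ?thesis using d2[OF B(2), of y] c'[OF B(2)] B by (simp add: b_def)
    qed
    ultimately show ?thesis by blast
  qed
qed

text \<open>The chain and its preimage are kept in single exterior degrees. The condition on the
  constant term has content only for \<open>i = 0\<close>, since otherwise
  \<open>w {} = 0\<close>.\<close>

lemma koszul_exact:
  fixes w :: "'v::finite set \<Rightarrow> ('v, 'k::field) mpoly"
  assumes w: "\<And>A. card A \<noteq> i \<Longrightarrow> w A = 0" and d: "\<And>A. koszul w A = 0"
    and c: "coef (w {}) 0 = 0"
  shows "\<exists>y. (\<forall>A. card A \<noteq> Suc i \<longrightarrow> y A = 0) \<and> (\<forall>A. koszul y A = w A)"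
proof -
  have V: "{v :: 'v. var_index v < card (UNIV :: 'v set)} = UNIV"
    using bij_var_index by (auto simp: bij_betw_def)
  obtain y where y: "\<And>A. koszul y A = w A"
    using koszul_on_exact[of w "card (UNIV :: 'v set)"] d in_span_range_Var[OF c] unfolding V by auto
  define y' where "y' A = (if card A = Suc i then y A else 0)" for A
  have "koszul y' A = w A" for A
  proof (cases "card A = i")
    case True
    then have "koszul y' A = koszul y A"
      unfolding koszul_on_def by (intro sum.cong) (auto simp: y'_def)
    then show ?thesis by (simp add: y)
  next
    case False
    then have "koszul y' A = 0"
      unfolding koszul_on_def by (intro sum.neutral) (auto simp: y'_def)
    then show ?thesis using w False by simp
  qed
  then show ?thesis by (intro exI[of _ y']) (simp add: y'_def)
qed

section \<open>Koszul homology and free resolutions\<close>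

text \<open>
  Both edges of the double complex \<open>K(x) \<otimes> F\<close> compute \<open>Tor(R/I, K)\<close>: a Koszul cycle modulo \<open>I\<close> is lifted
  step by step through \<open>F\<close> (the \<open>y\<close>), and if its last lift lay in \<open>\<mm> F\<^sub>N\<close>, descending again (the \<open>w\<close>)
  would make the cycle a boundary.
\<close>

lemma koszul_class_degree:
  fixes I :: "('v::finite, 'k::field) mpoly set"
  assumes I: "idl.subspace I" and Ihom: "\<And>p j. p \<in> I \<Longrightarrow> hom_comp (\<lambda>_. 1) j p \<in> I"
    and res: "graded_free_resolution I s \<phi> \<epsilon>"
    and z_supp: "\<And>A. card A \<noteq> N \<Longrightarrow> z A = 0" and z_hom: "\<And>A. homog (\<lambda>_. 1) (int N) (z A)"
    and z_cyc: "\<And>A. koszul z A \<in> I" and z_bd: "\<nexists>y. \<forall>A. z A - koszul y A \<in> I"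
  shows "2 * N \<in> set (s N)"
proof (rule ccontr)
  assume no_deg: "2 * N \<notin> set (s N)"
  define n where "n i = length (s i)" for i
  define P where "P i r c = \<phi> i $$ (r, c)" for i r c
  define e where "e r = \<epsilon> $ r" for r
  let ?h = "homog (\<lambda>_ :: 'v. 1)"
  have dims: "\<epsilon> \<in> carrier_vec (n 0)" "\<phi> i \<in> carrier_mat (n i) (n (Suc i))" for i
    using res by (simp_all add: graded_free_resolution_def n_def)
  have he: "?h (int (s 0 ! r)) (e r)" if "r < n 0" for r
    using res that by (auto simp: graded_free_resolution_def n_def e_def homogeneous_diff_iff)
  have hP: "?h (int (s (Suc i) ! c) - int (s i ! r)) (P i r c)" if "r < n i" "c < n (Suc i)" for i r c
    using res that by (auto simp: graded_free_resolution_def n_def P_def homogeneous_diff_iff)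
  have mv: "(\<phi> i *\<^sub>v vec (n (Suc i)) b) $ r = (\<Sum>c<n (Suc i). P i r c * b c)" if "r < n i" for i b r
    using dims(2)[of i] that
    by (auto simp: scalar_prod_def P_def atLeast0LessThan intro!: sum.cong)
  have sp: "\<epsilon> \<bullet> vec (n 0) b = (\<Sum>r<n 0. e r * b r)" for b
    using dims(1) by (simp add: scalar_prod_def e_def atLeast0LessThan)
  have vec_ex: "v = vec (dim_vec v) (\<lambda>i. v $ i)" for v :: "('v, 'k) mpoly vec"
    by (rule eq_vecI) auto
  \<comment> \<open>Cycles of the resolution at place i; at place 0 these are the vectors that the
    augmentation sends into \<open>I\<close>.\<close>
  define cyc where "cyc i b = (case i of 0 \<Rightarrow> (\<Sum>r<n 0. e r * b r) \<in> I
     | Suc j \<Rightarrow> \<forall>r<n j. (\<Sum>c<n (Suc j). P j r c * b c) = 0)" for i b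
  define im where "im i b \<longleftrightarrow> vec (n i) b \<in> mat_image (\<phi> i)" for i b
  have im_iff: "im i b \<longleftrightarrow> (\<exists>a. \<forall>r<n i. b r = (\<Sum>c<n (Suc i). P i r c * a c))" for i b
  proof
    assume "im i b"
    then obtain v where v: "v \<in> carrier_vec (n (Suc i))" "vec (n i) b = \<phi> i *\<^sub>v v"
      using dims(2)[of i] by (auto simp: im_def mat_image_def)
    have "b r = (\<Sum>c<n (Suc i). P i r c * v $ c)" if "r < n i" for r
    proof -
      have "b r = (\<phi> i *\<^sub>v v) $ r" using that v(2) by (metis index_vec)
      also have "v = vec (n (Suc i)) (\<lambda>c. v $ c)" using v(1) vec_ex[of v] by auto
      finally show ?thesis using mv[OF that] by simp
    qed
    then show "\<exists>a. \<forall>r<n i. b r = (\<Sum>c<n (Suc i). P i r c * a c)" by (intro exI[of _ "\<lambda>c. v $ c"]) simp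
  next
    assume "\<exists>a. \<forall>r<n i. b r = (\<Sum>c<n (Suc i). P i r c * a c)"
    then obtain a where a: "\<And>r. r < n i \<Longrightarrow> b r = (\<Sum>c<n (Suc i). P i r c * a c)" by blast
    have "vec (n i) b = \<phi> i *\<^sub>v vec (n (Suc i)) a"
      by (rule eq_vecI) (use dims(2)[of i] a in \<open>auto simp: mv simp del: index_mult_mat_vec\<close>)
    then show "im i b" using dims(2)[of i] by (auto simp: im_def mat_image_def)
  qed
  have cyc_iff_im: "cyc i b \<longleftrightarrow> im i b" for i b
  proof (cases i)
    case 0
    have "mat_image (\<phi> 0) = {v \<in> carrier_vec (n 0). \<epsilon> \<bullet> v \<in> I}"
      using res by (simp add: graded_free_resolution_def n_def)
    then have "im 0 b \<longleftrightarrow> \<epsilon> \<bullet> vec (n 0) b \<in> I" by (simp add: im_def)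
    then show ?thesis by (simp add: 0 cyc_def sp)
  next
    case (Suc j)
    have "mat_kernel (\<phi> j) = mat_image (\<phi> (Suc j))"
      using res by (simp add: graded_free_resolution_def)
    then have "im (Suc j) b \<longleftrightarrow> vec (n (Suc j)) b \<in> mat_kernel (\<phi> j)" by (simp add: im_def)
    also have "\<dots> \<longleftrightarrow> \<phi> j *\<^sub>v vec (n (Suc j)) b = 0\<^sub>v (n j)"
      using dims(2)[of j] by (auto simp: mat_kernel_def)
    also have "\<dots> \<longleftrightarrow> (\<forall>r<n j. (\<phi> j *\<^sub>v vec (n (Suc j)) b) $ r = 0)"
      using dims(2)[of j] by (auto simp: vec_eq_iff simp del: index_mult_mat_vec)
    also have "\<dots> \<longleftrightarrow> (\<forall>r<n j. (\<Sum>c<n (Suc j). P j r c * b c) = 0)" by (simp add: mv)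
    finally show ?thesis by (simp add: Suc cyc_def)
  qed
  have cyc_im: "cyc i (\<lambda>r. \<Sum>c<n (Suc i). P i r c * a c)" for i a
    unfolding cyc_iff_im im_iff by blast
  \<comment> \<open>A preimage of a homogeneous vector can be chosen homogeneous, by taking
    components. Degrees have to be controlled up to the last lift.\<close>
  have lift: "\<exists>a. (\<forall>r<n i. b r = (\<Sum>c<n (Suc i). P i r c * a c)) \<and> (\<forall>c<n (Suc i). ?h (t - int (s (Suc i) ! c)) (a c))"
    if cb: "cyc i b" and hb: "\<And>r. r < n i \<Longrightarrow> ?h (t - int (s i ! r)) (b r)" for i b t
  proof -
    obtain a where a: "\<And>r. r < n i \<Longrightarrow> b r = (\<Sum>c<n (Suc i). P i r c * a c)"
      using cb unfolding cyc_iff_im im_iff by blast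
    define a' where "a' c = hom_comp (\<lambda>_. 1) (t - int (s (Suc i) ! c)) (a c)" for c
    have "b r = (\<Sum>c<n (Suc i). P i r c * a' c)" if r: "r < n i" for r
    proof -
      have "b r = hom_comp (\<lambda>_. 1) (t - int (s i ! r)) (b r)" using hom_comp_homog[OF hb[OF r]] by simp
      also have "\<dots> = (\<Sum>c<n (Suc i). P i r c * a' c)"
        unfolding a[OF r] hom_comp_sum by (intro sum.cong refl) (simp add: hom_comp_mult_homog[OF hP[OF r]] a'_def)
      finally show ?thesis .
    qed
    then show ?thesis by (intro exI[of _ a']) (simp add: a'_def)
  qed
  have surj: "\<forall>f. \<exists>v\<in>carrier_vec (length (s 0)). f - \<epsilon> \<bullet> v \<in> I"
    using res unfolding graded_free_resolution_def by (elim conjE)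
  have start: "\<exists>b. f - (\<Sum>r<n 0. e r * b r) \<in> I \<and> (\<forall>r<n 0. ?h (t - int (s 0 ! r)) (b r))" if f: "?h t f" for f t
  proof -
    obtain v where v: "v \<in> carrier_vec (n 0)" "f - \<epsilon> \<bullet> v \<in> I"
      using surj n_def by metis
    have "v = vec (n 0) (\<lambda>r. v $ r)" using v(1) vec_ex[of v] by auto
    then have "\<epsilon> \<bullet> v = (\<Sum>r<n 0. e r * v $ r)" using sp by metis
    then have "f - (\<Sum>r<n 0. e r * v $ r) \<in> I" using v(2) by simp
    then have "hom_comp (\<lambda>_. 1) t (f - (\<Sum>r<n 0. e r * v $ r)) \<in> I" by (rule Ihom)
    also have "hom_comp (\<lambda>_. 1) t (f - (\<Sum>r<n 0. e r * v $ r)) = f - (\<Sum>r<n 0. e r * hom_comp (\<lambda>_. 1) (t - int (s 0 ! r)) (v $ r))"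
      using f by (simp add: hom_comp_diff hom_comp_homog hom_comp_sum hom_comp_mult_homog[OF he])
    finally show ?thesis by (intro exI[of _ "\<lambda>r. hom_comp (\<lambda>_. 1) (t - int (s 0 ! r)) (v $ r)"]) simp
  qed
  \<comment> \<open>The i-th lift lies in exterior degree N - i and in \<open>F_i\<close>. Counting
    degree 1 for each exterior index and the shift of the basis element, its total degree is 2N at
    every stage.\<close>
  define good where "good i y \<longleftrightarrow> (\<forall>k A. card A + i \<noteq> N \<longrightarrow> y k A = 0) \<and>
     (\<forall>k<n i. \<forall>A. ?h (int N + int i - int (s i ! k)) (y k A)) \<and> (\<forall>A. cyc i (\<lambda>k. koszul (y k) A))"
    for i and y :: "nat \<Rightarrow> 'v set \<Rightarrow> ('v, 'k) mpoly"
  define link where "link i y y' \<longleftrightarrow> (\<forall>r<n i. \<forall>A. koszul (y r) A = (\<Sum>c<n (Suc i). P i r c * y' c A))"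
    for i and y y' :: "nat \<Rightarrow> 'v set \<Rightarrow> ('v, 'k) mpoly"
  have koszul_P: "koszul (\<lambda>A. \<Sum>c\<in>C. q c * y c A) A = (\<Sum>c\<in>C. q c * koszul (y c) A)"
    for q :: "nat \<Rightarrow> ('v, 'k) mpoly" and y :: "nat \<Rightarrow> 'v set \<Rightarrow> ('v, 'k) mpoly" and A C
    by (simp add: koszul_on_sum koszul_on_scale)
  have koszul_cong: "koszul x A = koszul x' A" if "\<And>A. x A = x' A" for x x' :: "'v set \<Rightarrow> ('v, 'k) mpoly" and A
    using that by (simp add: koszul_on_def)
  have koszul_supp: "koszul x A = 0" if "\<And>B. card B + i \<noteq> m \<Longrightarrow> x B = 0" "card A + Suc i \<noteq> m"
    for x :: "'v set \<Rightarrow> ('v, 'k) mpoly" and i m A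
    unfolding koszul_on_def using that by (intro sum.neutral) auto
  have koszul_hom: "?h (t + 1) (koszul x A)" if "\<And>A. ?h t (x A)" for t and x :: "'v set \<Rightarrow> ('v, 'k) mpoly" and A
  proof -
    have "?h 0 (ksgn v A :: ('v, 'k) mpoly)" for v
      unfolding ksgn_def by (cases "even (card {a \<in> A. var_index a < var_index v})") (auto intro: homog_uminus)
    then show ?thesis
      unfolding koszul_on_def
      by (intro homog_sum homog_mult'[OF homog_mult'[OF _ homog_Var] that]) auto
  qed
  have "\<exists>y0. good 0 y0 \<and> (\<forall>A. z A - (\<Sum>r<n 0. e r * y0 r A) \<in> I)"
  proof -
    let ?Q = "\<lambda>A b. z A - (\<Sum>r<n 0. e r * b r) \<in> I \<and> (\<forall>r<n 0. ?h (int N - int (s 0 ! r)) (b r)) \<and> (card A \<noteq> N \<longrightarrow> b = (\<lambda>_. 0))"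
    have "\<forall>A. \<exists>b. ?Q A b"
    proof
      fix A
      show "\<exists>b. ?Q A b"
      proof (cases "card A = N")
        case True
        then show ?thesis using start[OF z_hom[of A]] by blast
      next
        case False
        then show ?thesis using z_supp[of A] idl.subspace_0[OF I] by (intro exI[of _ "\<lambda>_. 0"]) simp
      qed
    qed
    from choice[OF this] obtain b where "\<forall>A. ?Q A (b A)" ..
    then have b: "\<And>A. z A - (\<Sum>r<n 0. e r * b A r) \<in> I"
      "\<And>A r. r < n 0 \<Longrightarrow> ?h (int N - int (s 0 ! r)) (b A r)" "\<And>A. card A \<noteq> N \<Longrightarrow> b A = (\<lambda>_. 0)"
      by blast+
    define y0 where "y0 r A = b A r" for r A
    have "(\<Sum>r<n 0. e r * koszul (y0 r) A) \<in> I" for A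
    proof -
      have "koszul (\<lambda>A. z A - (\<Sum>r<n 0. e r * y0 r A)) A \<in> I"
        by (rule koszul_on_mem[OF I]) (simp add: y0_def b)
      then have "koszul z A - (koszul z A - (\<Sum>r<n 0. e r * koszul (y0 r) A)) \<in> I"
        unfolding koszul_on_diff koszul_P by (rule idl.subspace_diff[OF I z_cyc])
      then show ?thesis by simp
    qed
    then have "good 0 y0" using b(2,3) by (auto simp: good_def y0_def cyc_def)
    then show ?thesis using b(1) by (auto simp: y0_def)
  qed
  then obtain y0 where y0: "good 0 y0" "\<And>A. z A - (\<Sum>r<n 0. e r * y0 r A) \<in> I" by blast
  have step: "\<exists>y'. good (Suc i) y' \<and> link i y y'" if g: "good i y" for i y
  proof -
    let ?Q = "\<lambda>A a. (\<forall>r<n i. koszul (y r) A = (\<Sum>c<n (Suc i). P i r c * a c)) \<and>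
       (\<forall>c<n (Suc i). ?h (int N + int (Suc i) - int (s (Suc i) ! c)) (a c)) \<and> (card A + Suc i \<noteq> N \<longrightarrow> a = (\<lambda>_. 0))"
    have "\<forall>A. \<exists>a. ?Q A a"
    proof
      fix A
      show "\<exists>a. ?Q A a"
      proof (cases "card A + Suc i = N")
        case True
        have "?h (int N + int (Suc i) - int (s i ! r)) (koszul (y r) A)" if "r < n i" for r
        proof -
          have "?h (int N + int i - int (s i ! r) + 1) (koszul (y r) A)"
            by (rule koszul_hom) (use g that in \<open>simp add: good_def\<close>)
          then show ?thesis by (simp add: algebra_simps)
        qed
        then show ?thesis using lift[of i "\<lambda>r. koszul (y r) A" "int N + int (Suc i)"] g True
          unfolding good_def by blast
      next
        case False
        have "koszul (y r) A = 0" for r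
          by (rule koszul_supp[of i N]) (use g False in \<open>auto simp: good_def\<close>)
        then show ?thesis by (intro exI[of _ "\<lambda>_. 0"]) simp
      qed
    qed
    from choice[OF this] obtain a where "\<forall>A. ?Q A (a A)" ..
    then have a: "\<And>A r. r < n i \<Longrightarrow> koszul (y r) A = (\<Sum>c<n (Suc i). P i r c * a A c)"
      "\<And>A c. c < n (Suc i) \<Longrightarrow> ?h (int N + int (Suc i) - int (s (Suc i) ! c)) (a A c)"
      "\<And>A. card A + Suc i \<noteq> N \<Longrightarrow> a A = (\<lambda>_. 0)"
      by blast+
    define y' where "y' c A = a A c" for c A
    have l: "link i y y'" using a(1) by (simp add: link_def y'_def)
    have "cyc (Suc i) (\<lambda>k. koszul (y' k) A)" for A
    proof -
      have "(\<Sum>c<n (Suc i). P i r c * koszul (y' c) A) = 0" if r: "r < n i" for r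
      proof -
        have "(\<Sum>c<n (Suc i). P i r c * koszul (y' c) A) = koszul (koszul (y r)) A"
          unfolding koszul_P[symmetric] by (rule koszul_cong) (use l r in \<open>simp add: link_def\<close>)
        then show ?thesis by (simp add: koszul_koszul)
      qed
      then show ?thesis by (simp add: cyc_def)
    qed
    then have "good (Suc i) y'" using a(2,3) by (simp add: good_def y'_def)
    then show ?thesis using l by blast
  qed
  obtain y where y: "y 0 = y0" "\<And>i. good i (y i)" "\<And>i. link i (y i) (y (Suc i))"
  proof -
    have "\<exists>f. \<forall>i. (good i (f i) \<and> (i = 0 \<longrightarrow> f i = y0)) \<and> link i (f i) (f (Suc i))"
    proof (rule dependent_nat_choice)
      show "\<exists>y. good 0 y \<and> (0 = (0 :: nat) \<longrightarrow> y = y0)" using y0(1) by blast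
      show "\<exists>y'. (good (Suc i) y' \<and> (Suc i = 0 \<longrightarrow> y' = y0)) \<and> link i y y'"
        if "good i y \<and> (i = 0 \<longrightarrow> y = y0)" for i y
        using step[of i y] that by auto
    qed
    then show ?thesis using that by blast
  qed
  \<comment> \<open>Downward from i = N: each lift is a Koszul boundary plus an element of the image
    of \<open>F_{i+1}\<close>. At i = 0 the second summand disappears modulo \<open>I\<close> and
    the original cycle becomes a boundary.\<close>
  have "\<exists>w w'. (\<forall>k A. card A + i \<noteq> Suc N \<longrightarrow> w k A = 0) \<and> (\<forall>k A. card A + Suc i \<noteq> Suc N \<longrightarrow> w' k A = 0) \<and>
      (\<forall>k<n i. \<forall>A. y i k A = koszul (w k) A + (\<Sum>c<n (Suc i). P i k c * w' c A))" if "i \<le> N" for i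
    using that
  proof (induction i rule: inc_induct)
    case base
    let ?Q = "\<lambda>k w. k < n N \<longrightarrow> (\<forall>A. card A \<noteq> Suc 0 \<longrightarrow> w A = 0) \<and> (\<forall>A. koszul w A = y N k A)"
    have "\<forall>k. \<exists>w. ?Q k w"
    proof
      fix k
      show "\<exists>w. ?Q k w"
      proof (cases "k < n N")
        case True
        have supp: "y N k A = 0" if "card A \<noteq> 0" for A using y(2)[of N] that by (simp add: good_def)
        have "koszul (y N k) A = 0" for A
          by (rule koszul_supp[of 0 0]) (use supp in auto)
        \<comment> \<open>The only use of the assumption on degrees: this coefficient is homogeneous
          of degree 2N minus the degree of the basis element, so its constant term can be nonzero
          only at a basis element of degree 2N.\<close>
        moreover have "coef (y N k {}) 0 = 0"
        proof -
          have h: "?h (int N + int N - int (s N ! k)) (y N k {})" using y(2)[of N] True by (simp add: good_def)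
          have "s N ! k \<in> set (s N)" using True by (simp add: n_def)
          then have ne: "s N ! k \<noteq> 2 * N" using no_deg by metis
          show ?thesis
          proof (rule ccontr)
            assume "coef (y N k {}) 0 \<noteq> 0"
            then have "wt (\<lambda>_ :: 'v. 1) 0 = int N + int N - int (s N ! k)" using h unfolding homog_iff by blast
            then show False using ne by simp
          qed
        qed
        ultimately show ?thesis using koszul_exact[of 0 "y N k"] supp by auto
      qed auto
    qed
    from choice[OF this] obtain w where "\<forall>k. ?Q k (w k)" ..
    then have w: "\<And>k A. k < n N \<Longrightarrow> card A \<noteq> Suc 0 \<Longrightarrow> w k A = 0" "\<And>k A. k < n N \<Longrightarrow> koszul (w k) A = y N k A"
      by blast+
    define w0 where "w0 k A = (if k < n N then w k A else 0)" for k A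
    have "koszul (w0 k) A = y N k A" if "k < n N" for k A
      using w(2)[OF that] that by (simp add: w0_def[abs_def])
    moreover have "w0 k A = 0" if "card A + N \<noteq> Suc N" for k A
      using w(1) that by (simp add: w0_def)
    ultimately show ?case
      by (intro exI[where P = "\<lambda>w. \<exists>w'. Q w w'" for Q, of _ w0] exI[of _ "\<lambda>_ _. 0"]) simp
  next
    case (step i)
    then obtain w w' where w: "\<And>k A. card A + Suc i \<noteq> Suc N \<Longrightarrow> w k A = 0"
      "\<And>k A. k < n (Suc i) \<Longrightarrow> y (Suc i) k A = koszul (w k) A + (\<Sum>c<n (Suc (Suc i)). P (Suc i) k c * w' c A)"
      by blast
    \<comment> \<open>Subtracting the image of the preimage found one stage higher leaves a Koszul
      cycle, as two consecutive maps of the resolution compose to zero.\<close>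
    define t where "t k A = y i k A - (\<Sum>c<n (Suc i). P i k c * w c A)" for k A
    have supp: "t k A = 0" if "card A \<noteq> N - i" for k A
      using that y(2)[of i] w(1)[of A] step.hyps by (auto simp: t_def good_def)
    have kt: "koszul (t k) A = 0" if k: "k < n i" for k A
    proof -
      have "koszul (t k) A = koszul (y i k) A - (\<Sum>c<n (Suc i). P i k c * koszul (w c) A)"
        by (simp add: t_def[abs_def] koszul_on_diff koszul_P)
      also have "koszul (y i k) A = (\<Sum>c<n (Suc i). P i k c * y (Suc i) c A)"
        using y(3)[of i] k by (simp add: link_def)
      also have "(\<Sum>c<n (Suc i). P i k c * y (Suc i) c A) - (\<Sum>c<n (Suc i). P i k c * koszul (w c) A)
          = (\<Sum>c<n (Suc i). P i k c * (\<Sum>m<n (Suc (Suc i)). P (Suc i) c m * w' m A))"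
        unfolding sum_subtractf[symmetric] by (intro sum.cong refl) (simp add: w(2) distrib_left)
      also have "\<dots> = 0" using cyc_im[of "Suc i" "\<lambda>m. w' m A"] k by (simp add: cyc_def)
      finally show ?thesis .
    qed
    let ?Q = "\<lambda>k v. k < n i \<longrightarrow> (\<forall>A. card A \<noteq> Suc (N - i) \<longrightarrow> v A = 0) \<and> (\<forall>A. koszul v A = t k A)"
    have "\<forall>k. \<exists>v. ?Q k v"
    proof
      fix k
      \<comment> \<open>Here i < N, so \<open>t k\<close> lives in positive exterior degree and its
        value at the empty set is zero.\<close>
      have "coef (t k {}) 0 = 0" using supp[of "{}" k] step.hyps by simp
      then show "\<exists>v. ?Q k v" using koszul_exact[OF supp kt] by blast
    qed
    from choice[OF this] obtain v where "\<forall>k. ?Q k (v k)" ..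
    then have v: "\<And>k A. k < n i \<Longrightarrow> card A \<noteq> Suc (N - i) \<Longrightarrow> v k A = 0" "\<And>k A. k < n i \<Longrightarrow> koszul (v k) A = t k A"
      by blast+
    define v0 where "v0 k A = (if k < n i then v k A else 0)" for k A
    have "koszul (v0 k) A = t k A" if "k < n i" for k A
      using v(2)[OF that] that by (simp add: v0_def[abs_def])
    moreover have "v0 k A = 0" if "card A + i \<noteq> Suc N" for k A
      using v(1)[of k A] that step.hyps by (auto simp: v0_def)
    ultimately show ?case using w(1)
      by (intro exI[where P = "\<lambda>w. \<exists>w'. Q w w'" for Q, of _ v0] exI[of _ w]) (simp add: t_def)
  qed
  from this[OF le0] obtain w w' where
    "\<forall>k<n 0. \<forall>A. y 0 k A = koszul (w k) A + (\<Sum>c<n (Suc 0). P 0 k c * w' c A)"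
    by blast
  then have w: "\<And>k A. k < n 0 \<Longrightarrow> y0 k A = koszul (w k) A + (\<Sum>c<n (Suc 0). P 0 k c * w' c A)"
    using y(1) by simp
  have "z A - koszul (\<lambda>A. \<Sum>r<n 0. e r * w r A) A \<in> I" for A
  proof -
    let ?T = "\<Sum>r<n 0. e r * (\<Sum>c<n (Suc 0). P 0 r c * w' c A)"
    have "(\<Sum>r<n 0. e r * y0 r A) = koszul (\<lambda>A. \<Sum>r<n 0. e r * w r A) A + ?T"
      unfolding koszul_P by (simp add: w distrib_left sum.distrib)
    then have eq: "z A - koszul (\<lambda>A. \<Sum>r<n 0. e r * w r A) A = (z A - (\<Sum>r<n 0. e r * y0 r A)) + ?T"
      by simp
    have "?T \<in> I" using cyc_im[of 0 "\<lambda>c. w' c A"] by (simp add: cyc_def)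
    then show ?thesis unfolding eq by (rule idl.subspace_add[OF I y0(2)])
  qed
  then show False using z_bd by blast
qed

section \<open>Noetherianity\<close>

lemma nat_mono_subseq:
  fixes f :: "nat \<Rightarrow> nat"
  shows "\<exists>r :: nat \<Rightarrow> nat. strict_mono r \<and> (\<forall>m n. m \<le> n \<longrightarrow> f (r m) \<le> f (r n))"
proof -
  obtain r :: "nat \<Rightarrow> nat" where r: "strict_mono r" "monoseq (\<lambda>n. f (r n))"
    using seq_monosub[of f] by blast
  show ?thesis
  proof (cases "\<forall>m n. m \<le> n \<longrightarrow> f (r m) \<le> f (r n)")
    case False
    then have dec: "f (r n) \<le> f (r m)" if "m \<le> n" for m n using r(2) that by (auto simp: monoseq_def)
    \<comment> \<open>A nonincreasing sequence of natural numbers is constant from the place where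
      it attains its minimum.\<close>
    define N where "N = (ARG_MIN (\<lambda>n. f (r n)) n. True)"
    have N: "f (r N) \<le> f (r n)" for n unfolding N_def by (rule arg_min_nat_le) simp
    have "f (r (N + n)) = f (r N)" for n using N[of "N + n"] dec[of N "N + n"] by simp
    moreover have "strict_mono (\<lambda>n. r (N + n))" using r(1) by (simp add: strict_mono_def)
    ultimately show ?thesis by (intro exI[of _ "\<lambda>n. r (N + n)"]) simp
  qed (use r in blast)
qed

text \<open>Passing to subsequences, one variable after the other, makes all exponents nondecreasing
  along the sequence.\<close>

lemma dickson:
  fixes f :: "nat \<Rightarrow> 'v::finite \<Rightarrow>\<^sub>0 nat"
  shows "\<exists>i j. i < j \<and> (\<forall>v. expo (f i) v \<le> expo (f j) v)"
proof -
  have "\<exists>r :: nat \<Rightarrow> nat. strict_mono r \<and> (\<forall>v\<in>A. \<forall>m n. m \<le> n \<longrightarrow> expo (f (r m)) v \<le> expo (f (r n)) v)"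
    if "finite A" for A :: "'v set"
    using that
  proof (induction A rule: finite_induct)
    case empty
    show ?case by (rule exI[of _ id]) (simp add: strict_mono_def)
  next
    case (insert a A)
    from insert.IH obtain r :: "nat \<Rightarrow> nat" where r1: "strict_mono r"
      and r2: "\<forall>v\<in>A. \<forall>m n. m \<le> n \<longrightarrow> expo (f (r m)) v \<le> expo (f (r n)) v"
      by (elim exE conjE)
    have r: "strict_mono r" "\<And>v m n. v \<in> A \<Longrightarrow> m \<le> n \<Longrightarrow> expo (f (r m)) v \<le> expo (f (r n)) v"
      using r1 r2 by auto
    obtain q :: "nat \<Rightarrow> nat" where q: "strict_mono q" "\<And>m n. m \<le> n \<Longrightarrow> expo (f (r (q m))) a \<le> expo (f (r (q n))) a"
      using nat_mono_subseq[of "\<lambda>n. expo (f (r n)) a"] by blast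
    have "strict_mono (\<lambda>n. r (q n))" using strict_mono_o[OF r(1) q(1)] by (simp add: o_def)
    moreover have "expo (f (r (q m))) v \<le> expo (f (r (q n))) v" if "v \<in> A" "m \<le> n" for v m n
      using r(2)[OF that(1), of "q m" "q n"] strict_mono_less_eq[OF q(1), of m n] that(2) by simp
    ultimately show ?case using q(2) by (intro exI[of _ "\<lambda>n. r (q n)"]) auto
  qed
  from this[OF finite, of UNIV] obtain r :: "nat \<Rightarrow> nat" where r: "strict_mono r"
    "\<And>v m n. m \<le> n \<Longrightarrow> expo (f (r m)) v \<le> expo (f (r n)) v" by auto
  have "r 0 < r 1" using r(1) by (simp add: strict_mono_less)
  then show ?thesis using r(2)[of 0 1] by (intro exI[of _ "r 0"] exI[of _ "r 1"]) simp
qed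

text \<open>The minimal elements for divisibility form an antichain, which is finite because an
  infinite one would give a sequence without comparable terms. Descent on the degree finds a minimal
  divisor of each element.\<close>

lemma dickson_finite:
  fixes M :: "('v::finite \<Rightarrow>\<^sub>0 nat) set"
  shows "\<exists>B\<subseteq>M. finite B \<and> (\<forall>m\<in>M. \<exists>b\<in>B. \<exists>c. m = b + c)"
proof -
  define le where "le a b \<longleftrightarrow> (\<forall>v. expo a v \<le> expo b v)" for a b :: "'v \<Rightarrow>\<^sub>0 nat"
  define B where "B = {b \<in> M. \<forall>a\<in>M. le a b \<longrightarrow> a = b}"
  have "finite B"
  proof (rule ccontr)
    assume "infinite B"
    then obtain f :: "nat \<Rightarrow> _" where f: "inj f" "range f \<subseteq> B" using infinite_countable_subset by blast
    obtain i j where ij: "i < j" "le (f i) (f j)" using dickson[of f] by (auto simp: le_def)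
    have "f i \<in> B" "f j \<in> B" using f(2) by auto
    then have "f i = f j" using ij(2) by (simp add: B_def)
    then show False using f(1) ij(1) by (auto dest: injD)
  qed
  moreover have "\<exists>b\<in>B. le b m" if "m \<in> M" for m
    using that
  proof (induction "monom_degree m" arbitrary: m rule: less_induct)
    case less
    show ?case
    proof (cases "m \<in> B")
      case True
      then show ?thesis by (auto simp: le_def)
    next
      case False
      then obtain a where a: "a \<in> M" "le a m" "a \<noteq> m" using less.prems by (auto simp: B_def)
      have "expo a v \<le> expo m v" for v using a(2) by (simp add: le_def)
      moreover obtain v where "expo a v \<noteq> expo m v" using a(3) by (metis poly_mapping_eqI)
      ultimately have "(\<Sum>v\<in>UNIV. expo a v) < (\<Sum>v\<in>UNIV. expo m v)"
        by (intro sum_strict_mono_ex1) (auto intro!: exI[of _ v] simp: le_neq_implies_less)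
      moreover have "monom_degree n = (\<Sum>v\<in>UNIV. expo n v)" for n :: "'v \<Rightarrow>\<^sub>0 nat"
        unfolding monom_degree_def by (rule sum.mono_neutral_left) (auto simp: in_keys_iff)
      ultimately have "\<exists>b\<in>B. le b a" using less.hyps[of a] a(1) by simp
      then show ?thesis using a(2) by (auto simp: le_def intro: order_trans)
    qed
  qed
  moreover have "\<exists>c. m = b + c" if "le b m" for b m
    using that by (intro exI[of _ "m - b"] poly_mapping_eqI) (simp add: le_def lookup_add lookup_minus)
  ultimately have "finite B" "\<forall>m\<in>M. \<exists>b\<in>B. \<exists>c. m = b + c" by blast+
  moreover have "B \<subseteq> M" by (auto simp: B_def)
  ultimately show ?thesis by blast
qed

section \<open>Leading monomials and the basis theorem\<close>

definition leading :: "('v::finite, 'k::comm_ring_1) mpoly \<Rightarrow> ('v \<Rightarrow>\<^sub>0 nat) \<Rightarrow> bool" where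
  "leading p m \<longleftrightarrow> coef p m \<noteq> 0 \<and> (\<forall>n. coef p n \<noteq> 0 \<longrightarrow> nat_expo n \<le> nat_expo m)"

lemma ex_leading: assumes "p \<noteq> 0" shows "\<exists>m. leading p m"
proof -
  let ?S = "nat_expo ` Poly_Mapping.keys p"
  have "Poly_Mapping.keys p \<noteq> {}" using assms by (metis poly_mapping_eqI lookup_zero in_keys_iff empty_iff)
  then have "Max ?S \<in> ?S" by (intro Max_in) auto
  then obtain m where m: "m \<in> Poly_Mapping.keys p" "nat_expo m = Max ?S" by auto
  have "nat_expo n \<le> nat_expo m" if "coef p n \<noteq> 0" for n
    unfolding m(2) using that by (intro Max_ge) (auto simp: in_keys_iff)
  then show ?thesis using m(1) by (auto simp: leading_def in_keys_iff)
qed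

lemma nat_poly_mapping_ge_0: "(0 :: nat \<Rightarrow>\<^sub>0 nat) \<le> p"
proof -
  have "\<not> p < 0" by transfer (auto simp: less_fun_def)
  then show ?thesis by simp
qed

text \<open>In an infinite descending sequence some term would divide a later one, and divisibility
  implies being smaller or equal in a monomial order.\<close>

lemma wf_nat_expo: "wf {(a, b :: 'v::finite \<Rightarrow>\<^sub>0 nat). nat_expo a < nat_expo b}"
proof (rule ccontr)
  assume "\<not> wf {(a, b :: 'v \<Rightarrow>\<^sub>0 nat). nat_expo a < nat_expo b}"
  then obtain f :: "nat \<Rightarrow> 'v \<Rightarrow>\<^sub>0 nat" where f: "\<And>i. nat_expo (f (Suc i)) < nat_expo (f i)"
    by (auto simp: wf_iff_no_infinite_down_chain)
  have lt: "nat_expo (f j) < nat_expo (f i)" if "i < j" for i j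
    using that
  proof (induction j)
    case (Suc j)
    then show ?case using f[of j] by (cases "i = j") auto
  qed simp
  obtain i j where ij: "i < j" "\<And>v. expo (f i) v \<le> expo (f j) v" using dickson[of f] by blast
  have "f j = f i + (f j - f i)"
    using ij(2) by (intro poly_mapping_eqI) (simp add: lookup_add lookup_minus)
  then have "nat_expo (f j) = nat_expo (f i) + nat_expo (f j - f i)" by (metis nat_expo_add)
  then have "nat_expo (f i) \<le> nat_expo (f j)"
    using add_left_mono[OF nat_poly_mapping_ge_0, of "nat_expo (f i)" "nat_expo (f j - f i)"] by simp
  then show False using lt[OF ij(1)] by simp
qed

lemma coef_single_mult: "coef (Poly_Mapping.single a c * p) (a + m) = c * coef p m"
proof (induction p rule: poly_mapping_add_induct)
  case (single n d)
  show ?case by (simp add: mult_single lookup_single when_def)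
qed (simp_all add: distrib_left lookup_add)

lemma coef_single_mult_nonzero:
  assumes "coef (Poly_Mapping.single a c * p) m \<noteq> 0" shows "\<exists>n. m = a + n \<and> coef p n \<noteq> 0"
proof -
  have "m \<in> Poly_Mapping.keys (Poly_Mapping.single a c * p)" using assms by (simp add: in_keys_iff)
  then show ?thesis using keys_mult[of "Poly_Mapping.single a c" p]
    by (auto simp: in_keys_iff lookup_single when_def split: if_splits)
qed

text \<open>The leading monomials of \<open>Z\<close> are multiples of finitely many of them.
  Polynomials realizing these generate \<open>Z\<close>: division cancels the leading term, and the
  order is well-founded.\<close>

theorem hilbert_basis:
  fixes Z :: "('v::finite, 'k::field) mpoly set"
  assumes Z: "idl.subspace Z"
  shows "\<exists>G\<subseteq>Z. finite G \<and> Z \<subseteq> idl.span G"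
proof -
  define M where "M = {m. \<exists>p\<in>Z. leading p m}"
  obtain B where B: "B \<subseteq> M" "finite B" "\<And>m. m \<in> M \<Longrightarrow> \<exists>b\<in>B. \<exists>c. m = b + c"
    using dickson_finite[of M] by blast
  have "\<forall>b\<in>B. \<exists>p. p \<in> Z \<and> leading p b" using B(1) by (auto simp: M_def)
  then obtain g where g: "\<And>b. b \<in> B \<Longrightarrow> g b \<in> Z \<and> leading (g b) b" by metis
  have "p \<in> idl.span (g ` B)" if "p \<in> Z" "leading p m" for p m
    using that
  proof (induction m arbitrary: p rule: wf_induct_rule[OF wf_nat_expo])
    case (1 m)
    obtain b c where b: "b \<in> B" "m = c + b" using B(3)[of m] 1 by (auto simp: M_def add.commute)
    note gb = g[OF b(1)]
    define a where "a = Poly_Mapping.single c (coef p m / coef (g b) b)"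
    define q where "q = p - a * g b"
    have gne: "coef (g b) b \<noteq> 0" using gb by (simp add: leading_def)
    have "coef (a * g b) m = coef p m" using gne by (simp add: a_def b(2) coef_single_mult)
    then have q0: "coef q m = 0" by (simp add: q_def lookup_minus)
    have le: "nat_expo n \<le> nat_expo m" if "coef q n \<noteq> 0" for n
    proof (cases "coef p n = 0")
      case False
      then show ?thesis using 1 by (simp add: leading_def)
    next
      case True
      then have "coef (a * g b) n \<noteq> 0" using that by (simp add: q_def lookup_minus)
      then obtain k where k: "n = c + k" "coef (g b) k \<noteq> 0" using coef_single_mult_nonzero unfolding a_def by blast
      then have "nat_expo k \<le> nat_expo b" using gb by (simp add: leading_def)
      then show ?thesis by (simp add: k b(2) nat_expo_add)
    qed
    have "q \<in> idl.span (g ` B)"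
    proof (cases "q = 0")
      case False
      then obtain n where n: "leading q n" using ex_leading by blast
      then have "n \<noteq> m" using q0 by (auto simp: leading_def)
      then have "nat_expo n < nat_expo m" using le[of n] n inj_nat_expo
        by (auto simp: leading_def order_le_less dest: injD)
      moreover have "q \<in> Z" using 1 gb Z by (auto simp: q_def intro!: idl.subspace_diff idl.subspace_scale)
      ultimately show ?thesis using 1 n by auto
    qed (simp add: idl.span_zero)
    then have "q + a * g b \<in> idl.span (g ` B)"
      using b(1) by (intro idl.span_add[OF _ idl.span_scale[OF idl.span_base]]) auto
    then show ?case by (simp add: q_def)
  qed
  then have "p \<in> idl.span (g ` B)" if "p \<in> Z" for p
    using that ex_leading[of p] idl.span_zero[of "g ` B"] by (cases "p = 0") auto
  then have "Z \<subseteq> idl.span (g ` B)" by blast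
  moreover have "g ` B \<subseteq> Z" using g by auto
  ultimately show ?thesis using B(2) by blast
qed

section \<open>Submodules of free modules\<close>

interpretation fm: Modules.module "\<lambda>(c :: 'a::comm_ring_1) (f :: nat \<Rightarrow> 'a) i. c * f i"
  by unfold_locales (auto simp: fun_eq_iff algebra_simps)

declare fm.scale_scale [simp del]

text \<open>Vectors of a free module of rank n are functions on the natural numbers that vanish from
  n on. Induction on the rank: the last coordinates form an ideal, and the vectors with last
  coordinate 0 form a submodule of smaller rank.\<close>

lemma noetherian_free_module:
  fixes Z :: "(nat \<Rightarrow> ('v::finite, 'k::field) mpoly) set"
  assumes "fm.subspace Z" "\<And>z i. z \<in> Z \<Longrightarrow> n \<le> i \<Longrightarrow> z i = 0"
  shows "\<exists>G\<subseteq>Z. finite G \<and> Z \<subseteq> fm.span G"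
  using assms
proof (induction n arbitrary: Z)
  case 0
  then have "z = 0" if "z \<in> Z" for z using that by (auto simp: fun_eq_iff)
  then have "Z \<subseteq> fm.span {}" by auto
  then show ?case by (intro exI[of _ "{}"]) simp
next
  case (Suc n)
  define J where "J = (\<lambda>z. z n) ` Z"
  have "idl.subspace J"
    unfolding J_def idl.subspace_def
  proof (intro conjI ballI allI)
    show "0 \<in> (\<lambda>z. z n) ` Z" by (rule image_eqI[OF _ fm.subspace_0[OF Suc.prems(1)]]) simp
  next
    fix x y assume "x \<in> (\<lambda>z. z n) ` Z" "y \<in> (\<lambda>z. z n) ` Z"
    then obtain a b where "a \<in> Z" "b \<in> Z" "x = a n" "y = b n" by auto
    then show "x + y \<in> (\<lambda>z. z n) ` Z" by (intro image_eqI[OF _ fm.subspace_add[OF Suc.prems(1), of a b]]) simp_all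
  next
    fix c x assume "x \<in> (\<lambda>z. z n) ` Z"
    then obtain a where "a \<in> Z" "x = a n" by auto
    then show "c * x \<in> (\<lambda>z. z n) ` Z" by (intro image_eqI[OF _ fm.subspace_scale[OF Suc.prems(1), of a c]]) simp_all
  qed
  then obtain G where G: "G \<subseteq> J" "finite G" "J \<subseteq> idl.span G" using hilbert_basis by blast
  have "\<forall>g\<in>G. \<exists>z. z \<in> Z \<and> z n = g" using G(1) by (auto simp: J_def)
  then obtain h where h: "\<And>g. g \<in> G \<Longrightarrow> h g \<in> Z \<and> h g n = g" by metis
  define Z0 where "Z0 = {z \<in> Z. z n = 0}"
  have "fm.subspace Z0" using Suc.prems(1) by (auto simp: Z0_def fm.subspace_def)
  moreover have "z i = 0" if "z \<in> Z0" "n \<le> i" for z i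
    using that Suc.prems(2)[of z i] by (cases "i = n") (auto simp: Z0_def)
  ultimately obtain H where H: "H \<subseteq> Z0" "finite H" "Z0 \<subseteq> fm.span H" using Suc.IH by meson
  let ?G = "h ` G \<union> H"
  have hZ: "h ` G \<subseteq> Z" using h by auto
  have "z \<in> fm.span ?G" if z: "z \<in> Z" for z
  proof -
    have "\<exists>w\<in>fm.span (h ` G). w n = x" if "x \<in> idl.span G" for x
      using that
    proof (induction rule: idl.span_induct_alt)
      case base
      show ?case by (rule bexI[of _ 0]) (simp_all add: fm.span_zero)
    next
      case (step c x y)
      then obtain w where w: "w \<in> fm.span (h ` G)" "w n = y" by blast
      have "(\<lambda>i. c * h x i) + w \<in> fm.span (h ` G)"
        using step(1) w(1) by (intro fm.span_add[OF fm.span_scale[OF fm.span_base]]) auto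
      then show ?case using w(2) h[OF step(1)] by (intro bexI) auto
    qed
    moreover have "z n \<in> idl.span G" using G(3) z by (auto simp: J_def)
    ultimately obtain w where w: "w \<in> fm.span (h ` G)" "w n = z n" by blast
    have "w \<in> Z" using w(1) fm.span_minimal[OF hZ Suc.prems(1)] by blast
    then have "z - w \<in> Z0" using w(2) fm.subspace_diff[OF Suc.prems(1) z] by (simp add: Z0_def)
    then have "z - w \<in> fm.span ?G" using H(3) fm.span_mono[of H ?G] by auto
    moreover have "w \<in> fm.span ?G" using w(1) fm.span_mono[of "h ` G" ?G] by auto
    ultimately have "(z - w) + w \<in> fm.span ?G" by (rule fm.span_add)
    then show ?thesis by simp
  qed
  then show ?case using G(2) H hZ by (intro exI[of _ ?G]) (auto simp: Z0_def)
qed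

text \<open>The coefficients are indexed by \<open>G\<close> and not by the image, because
  \<open>f\<close> may identify elements of \<open>G\<close>.\<close>

lemma span_image_finite:
  assumes "finite G" "z \<in> fm.span (f ` G)"
  shows "\<exists>c. \<forall>i. z i = (\<Sum>x\<in>G. c x * f x i)"
  using assms(2)
proof (induction rule: fm.span_induct_alt)
  case base
  show ?case by (rule exI[of _ "\<lambda>_. 0"]) simp
next
  case (step a y z)
  then obtain c x where c: "\<And>i. z i = (\<Sum>x\<in>G. c x * f x i)" and x: "x \<in> G" "y = f x" by blast
  have "a * y i + z i = (\<Sum>w\<in>G. (if w = x then c w + a else c w) * f w i)" for i
  proof -
    have "(\<Sum>w\<in>G. (if w = x then c w + a else c w) * f w i) = (\<Sum>w\<in>G. c w * f w i + (if w = x then a * f w i else 0))"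
      by (rule sum.cong) (auto simp: algebra_simps)
    also have "\<dots> = z i + a * f x i" using assms(1) x by (simp add: sum.distrib c)
    finally show ?thesis using x by simp
  qed
  then show ?case by (intro exI[of _ "\<lambda>w. if w = x then c w + a else c w"]) simp
qed

section \<open>Minimal graded free resolutions\<close>

text \<open>The component of total degree \<open>t\<close> of a vector in a shifted free module: its
  i-th coordinate has degree \<open>t\<close> minus the degree of the i-th basis element.\<close>

definition vcomp :: "nat list \<Rightarrow> int \<Rightarrow> (nat \<Rightarrow> ('v::finite, 'k::comm_ring_1) mpoly) \<Rightarrow> nat \<Rightarrow> ('v, 'k) mpoly" where
  "vcomp ss t z i = (if i < length ss then hom_comp (\<lambda>_. 1) (t - int (ss ! i)) (z i) else 0)"

text \<open>A graded submodule, contained in the multiples of the irrelevant ideal, of the free module with basis degrees \<open>ss\<close>.\<close>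

definition graded_submodule :: "nat list \<Rightarrow> (nat \<Rightarrow> ('v::finite, 'k::comm_ring_1) mpoly) set \<Rightarrow> bool" where
  "graded_submodule ss Z \<longleftrightarrow> fm.subspace Z \<and> (\<forall>z\<in>Z. \<forall>i\<ge>length ss. z i = 0) \<and>
     (\<forall>z\<in>Z. \<forall>t. vcomp ss t z \<in> Z) \<and> (\<forall>z\<in>Z. \<forall>i. coef (z i) 0 = 0)"

definition mat_syzygies :: "'a::comm_ring_1 mat \<Rightarrow> (nat \<Rightarrow> 'a) set" where
  "mat_syzygies A = {b. (\<forall>i\<ge>dim_col A. b i = 0) \<and> (\<forall>r<dim_row A. (\<Sum>c<dim_col A. A $$ (r, c) * b c) = 0)}"

lemma mult_mat_vec_fun: "A *\<^sub>v vec (dim_col A) b = vec (dim_row A) (\<lambda>r. \<Sum>c<dim_col A. A $$ (r, c) * b c)"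
proof (rule eq_vecI)
  fix r assume "r < dim_vec (vec (dim_row A) (\<lambda>r. \<Sum>c<dim_col A. A $$ (r, c) * b c))"
  then have r: "r < dim_row A" by simp
  have "(A *\<^sub>v vec (dim_col A) b) $ r = (\<Sum>c\<in>{0..<dim_col A}. row A r $ c * vec (dim_col A) b $ c)"
    using r by (simp add: scalar_prod_def)
  also have "\<dots> = (\<Sum>c\<in>{0..<dim_col A}. A $$ (r, c) * b c)"
    using r by (intro sum.cong) simp_all
  finally show "(A *\<^sub>v vec (dim_col A) b) $ r = vec (dim_row A) (\<lambda>r. \<Sum>c<dim_col A. A $$ (r, c) * b c) $ r"
    using r by (simp add: atLeast0LessThan)
qed simp

lemma vec_eq_vec_nth: "v \<in> carrier_vec n \<Longrightarrow> v = vec n (\<lambda>i. v $ i)"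
  by (rule eq_vecI) auto

lemma mat_kernel_syzygies: "mat_kernel A = vec (dim_col A) ` mat_syzygies A"
proof
  show "mat_kernel A \<subseteq> vec (dim_col A) ` mat_syzygies A"
  proof
    fix v assume "v \<in> mat_kernel A"
    then have v: "v \<in> carrier_vec (dim_col A)" "A *\<^sub>v v = 0\<^sub>v (dim_row A)" by (auto simp: mat_kernel_def)
    define b where "b i = (if i < dim_col A then v $ i else 0)" for i
    have vb: "v = vec (dim_col A) b" using v(1) by (intro eq_vecI) (auto simp: b_def)
    have "(\<Sum>c<dim_col A. A $$ (r, c) * b c) = 0" if "r < dim_row A" for r
    proof -
      have "(A *\<^sub>v vec (dim_col A) b) $ r = 0" using v(2) that by (simp add: vb[symmetric] del: index_mult_mat_vec)
      then show ?thesis unfolding mult_mat_vec_fun using that by simp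
    qed
    then have "b \<in> mat_syzygies A" by (simp add: mat_syzygies_def b_def)
    then show "v \<in> vec (dim_col A) ` mat_syzygies A" using vb by blast
  qed
  show "vec (dim_col A) ` mat_syzygies A \<subseteq> mat_kernel A"
    by (auto simp: mat_kernel_def mat_syzygies_def mult_mat_vec_fun intro!: eq_vecI)
qed

lemma sum_fun_apply: "(\<Sum>x\<in>A. f x) i = (\<Sum>x\<in>A. f x i)" for f :: "'a \<Rightarrow> nat \<Rightarrow> 'b::comm_monoid_add"
  by (induction A rule: infinite_finite_induct) auto

lemma homog_1_0: assumes "homog (\<lambda>_. 1) 0 p" shows "p = Const (coef p 0)"
proof (rule poly_mapping_eqI)
  fix m
  show "coef p m = coef (Const (coef p 0)) m"
  proof (cases "m = 0")
    case False
    then obtain v where "expo m v \<noteq> 0" by (metis lookup_zero poly_mapping_eqI)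
    then have "0 < (\<Sum>v\<in>UNIV. int (expo m v))" by (intro sum_pos2[of _ v]) auto
    then have "coef p m = 0" using assms by (auto simp: homog_iff wt_def)
    then show ?thesis using False by (simp add: Const_def lookup_single)
  qed (simp add: Const_def)
qed

lemma sum_vcomp:
  fixes z :: "nat \<Rightarrow> ('v::finite, 'k::comm_ring_1) mpoly"
  assumes "\<And>i. length ss \<le> i \<Longrightarrow> z i = 0"
  shows "\<exists>T. finite T \<and> z = (\<Sum>t\<in>T. vcomp ss (int t) z)"
proof -
  define T where "T = (\<Union>i<length ss. (\<lambda>m. monom_degree m + ss ! i) ` Poly_Mapping.keys (z i))"
  have "finite T" by (simp add: T_def)
  moreover have "(\<Sum>t\<in>T. vcomp ss (int t) z) i = z i" for i
  proof (cases "i < length ss")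
    case True
    have "coef (\<Sum>t\<in>T. vcomp ss (int t) z i) m = coef (z i) m" for m
    proof -
      have "coef (\<Sum>t\<in>T. vcomp ss (int t) z i) m = (\<Sum>t\<in>T. if t = monom_degree m + ss ! i then coef (z i) m else 0)"
        unfolding lookup_sum using True by (intro sum.cong) (auto simp: vcomp_def coef_comp wt_1)
      also have "\<dots> = (if monom_degree m + ss ! i \<in> T then coef (z i) m else 0)"
        using \<open>finite T\<close> by simp
      also have "\<dots> = coef (z i) m"
      proof (cases "m \<in> Poly_Mapping.keys (z i)")
        case True
        then have "monom_degree m + ss ! i \<in> T"
          unfolding T_def using \<open>i < length ss\<close> by (intro UN_I[of i]) auto
        then show ?thesis by simp
      qed (simp add: in_keys_iff)
      finally show ?thesis .
    qed
    then show ?thesis unfolding sum_fun_apply by (rule poly_mapping_eqI)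
  next
    case False
    then show ?thesis unfolding sum_fun_apply using assms by (simp add: vcomp_def)
  qed
  ultimately show ?thesis by (intro exI[of _ T]) auto
qed

text \<open>The columns of \<open>A\<close> are a smallest finite set of homogeneous generators of
  \<open>Z\<close>. A syzygy having a coefficient with nonzero constant term would express one
  generator by the others, so the syzygies again satisfy \<open>graded_submodule\<close> and the
  construction can be iterated.\<close>

lemma minimal_presentation:
  fixes Z :: "(nat \<Rightarrow> ('v::finite, 'k::field) mpoly) set"
  assumes Z: "graded_submodule ss Z"
  shows "\<exists>ss' A. A \<in> carrier_mat (length ss) (length ss') \<and>
    (\<forall>r<length ss. \<forall>c<length ss'. A $$ (r, c) \<in> homogeneous_diff (ss' ! c) (ss ! r) \<and> coef (A $$ (r, c)) 0 = 0) \<and>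
    mat_image A = vec (length ss) ` Z \<and> graded_submodule ss' (mat_syzygies A)"
proof -
  let ?n = "length ss"
  let ?h = "homog (\<lambda>_ :: 'v. 1)"
  have sub: "fm.subspace Z" and supp: "\<And>z i. z \<in> Z \<Longrightarrow> ?n \<le> i \<Longrightarrow> z i = 0"
    and hom: "\<And>z t. z \<in> Z \<Longrightarrow> vcomp ss t z \<in> Z" and const: "\<And>z i. z \<in> Z \<Longrightarrow> coef (z i) 0 = 0"
    using Z by (auto simp: graded_submodule_def)
  \<comment> \<open>A generator carries its degree, which becomes an entry of the next degree list;
    only the vectors count for the span.\<close>
  define gen where "gen G \<longleftrightarrow> finite G \<and> (\<forall>x\<in>G. fst x \<in> Z \<and> (\<forall>i<?n. ?h (int (snd x) - int (ss ! i)) (fst x i))) \<and> Z \<subseteq> fm.span (fst ` G)"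
    for G :: "((nat \<Rightarrow> ('v, 'k) mpoly) \<times> nat) set"
  obtain G0 where G0: "G0 \<subseteq> Z" "finite G0" "Z \<subseteq> fm.span G0"
    using noetherian_free_module[OF sub, of ?n] supp by auto
  have "\<forall>z\<in>G0. \<exists>T. finite T \<and> z = (\<Sum>t\<in>T. vcomp ss (int t) z)"
    using sum_vcomp supp G0(1) by (metis subsetD)
  then obtain T where T: "\<And>z. z \<in> G0 \<Longrightarrow> finite (T z) \<and> z = (\<Sum>t\<in>T z. vcomp ss (int t) z)" by metis
  define G1 where "G1 = (\<Union>z\<in>G0. (\<lambda>t. (vcomp ss (int t) z, t)) ` T z)"
  have "gen G1"
    unfolding gen_def
  proof (intro conjI)
    show "finite G1" using G0(2) T by (auto simp: G1_def)
    show "\<forall>x\<in>G1. fst x \<in> Z \<and> (\<forall>i<?n. ?h (int (snd x) - int (ss ! i)) (fst x i))"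
      using hom G0(1) by (auto simp: G1_def vcomp_def)
    have "z \<in> fm.span (fst ` G1)" if "z \<in> G0" for z
    proof -
      have "vcomp ss (int t) z \<in> fst ` G1" if "t \<in> T z" for t
        using that \<open>z \<in> G0\<close> by (force simp: G1_def)
      then have "(\<Sum>t\<in>T z. vcomp ss (int t) z) \<in> fm.span (fst ` G1)"
        by (intro fm.span_sum fm.span_base)
      then show ?thesis using T[OF that] by simp
    qed
    then have "fm.span G0 \<subseteq> fm.span (fst ` G1)" by (intro fm.span_minimal fm.subspace_span) auto
    then show "Z \<subseteq> fm.span (fst ` G1)" using G0(3) by blast
  qed
  then obtain G where G: "gen G" "\<And>H. gen H \<Longrightarrow> card G \<le> card H"
    using ex_has_least_nat[of gen G1 card] by blast
  have finG: "finite G" and GZ: "\<And>x. x \<in> G \<Longrightarrow> fst x \<in> Z"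
    and Ghom: "\<And>x i. x \<in> G \<Longrightarrow> i < ?n \<Longrightarrow> ?h (int (snd x) - int (ss ! i)) (fst x i)"
    and Gspan: "Z \<subseteq> fm.span (fst ` G)"
    using G(1) by (auto simp: gen_def)
  obtain xs where xs: "set xs = G" "distinct xs" using finite_distinct_list[OF finG] by blast
  define ss' where "ss' = map snd xs"
  let ?m = "length ss'"
  define A where "A = mat ?n ?m (\<lambda>(r, c). fst (xs ! c) r)"
  have lenm: "?m = length xs" by (simp add: ss'_def)
  have xsG: "xs ! c \<in> G" if "c < ?m" for c using that xs(1) lenm by auto
  have A: "A \<in> carrier_mat ?n ?m" "dim_row A = ?n" "dim_col A = ?m" by (auto simp: A_def)
  have Aidx: "A $$ (r, c) = fst (xs ! c) r" if "r < ?n" "c < ?m" for r c using that by (simp add: A_def)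
  have Ahom: "?h (int (ss' ! c) - int (ss ! r)) (A $$ (r, c))" if "r < ?n" "c < ?m" for r c
    using Ghom[OF xsG[OF that(2)] that(1)] that lenm by (simp add: Aidx ss'_def)
  have sum_nth: "(\<Sum>c<?m. f (xs ! c)) = (\<Sum>x\<in>G. f x)" for f :: "_ \<Rightarrow> ('v, 'k) mpoly"
    using sum.reindex_bij_betw[OF bij_betw_nth[OF xs(2), of "{..<length xs}" G], of f] xs(1) lenm by simp
  have img: "mat_image A = vec ?n ` Z"
  proof
    show "mat_image A \<subseteq> vec ?n ` Z"
    proof
      fix w assume "w \<in> mat_image A"
      then obtain v where v: "v \<in> carrier_vec ?m" "w = A *\<^sub>v v" by (auto simp: mat_image_def A)
      have "w = A *\<^sub>v vec ?m (\<lambda>c. v $ c)" using v vec_eq_vec_nth by metis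
      also have "\<dots> = vec ?n (\<Sum>c<?m. (\<lambda>i. v $ c * fst (xs ! c) i))"
        using mult_mat_vec_fun[of A "\<lambda>c. v $ c"]
        by (auto simp: A sum_fun_apply Aidx mult.commute intro!: eq_vecI sum.cong)
      finally have "w = vec ?n (\<Sum>c<?m. (\<lambda>i. v $ c * fst (xs ! c) i))" .
      moreover have "(\<Sum>c<?m. (\<lambda>i. v $ c * fst (xs ! c) i)) \<in> Z"
        by (intro fm.subspace_sum[OF sub] fm.subspace_scale[OF sub] GZ xsG) simp
      ultimately show "w \<in> vec ?n ` Z" by blast
    qed
    show "vec ?n ` Z \<subseteq> mat_image A"
    proof
      fix w assume "w \<in> vec ?n ` Z"
      then obtain z where z: "z \<in> Z" "w = vec ?n z" by blast
      obtain c where c: "\<And>i. z i = (\<Sum>x\<in>G. c x * fst x i)"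
        using span_image_finite[OF finG, of z fst] Gspan z(1) by blast
      have "w = A *\<^sub>v vec ?m (\<lambda>j. c (xs ! j))"
        unfolding z(2) using mult_mat_vec_fun[of A "\<lambda>j. c (xs ! j)"]
        by (auto simp: A c sum_nth[symmetric] Aidx mult.commute intro!: eq_vecI sum.cong)
      then show "w \<in> mat_image A" by (auto simp: mat_image_def A)
    qed
  qed
  have syz_comp: "(\<Sum>c<?m. A $$ (r, c) * hom_comp (\<lambda>_. 1) (t - int (ss' ! c)) (b c)) = 0"
    if b: "b \<in> mat_syzygies A" and r: "r < ?n" for b r t
  proof -
    have "(\<Sum>c<?m. A $$ (r, c) * hom_comp (\<lambda>_. 1) (t - int (ss' ! c)) (b c))
        = hom_comp (\<lambda>_. 1) (t - int (ss ! r)) (\<Sum>c<?m. A $$ (r, c) * b c)"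
      unfolding hom_comp_sum using r by (intro sum.cong refl) (simp add: hom_comp_mult_homog[OF Ahom])
    then show ?thesis using b r by (simp add: mat_syzygies_def A)
  qed
  have "graded_submodule ss' (mat_syzygies A)"
    unfolding graded_submodule_def
  proof (intro conjI ballI allI impI)
    show "fm.subspace (mat_syzygies A)"
    proof (rule fm.subspaceI)
      fix c b assume "b \<in> mat_syzygies A"
      moreover have "(\<Sum>j<?m. A $$ (r, j) * (c * b j)) = c * (\<Sum>j<?m. A $$ (r, j) * b j)" for r
        by (simp add: sum_distrib_left mult.left_commute)
      ultimately show "(\<lambda>i. c * b i) \<in> mat_syzygies A" by (simp add: mat_syzygies_def A)
    qed (auto simp: mat_syzygies_def distrib_left sum.distrib)
  next
    fix b i assume "b \<in> mat_syzygies A" "?m \<le> i"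
    then show "b i = 0" by (simp add: mat_syzygies_def A)
  next
    fix b t assume "b \<in> mat_syzygies A"
    then show "vcomp ss' t b \<in> mat_syzygies A"
      using syz_comp[of b _ t] by (simp add: mat_syzygies_def A vcomp_def)
  next
    fix b k assume b: "b \<in> mat_syzygies A"
    show "coef (b k) 0 = 0"
    proof (rule ccontr)
      assume ne: "coef (b k) 0 \<noteq> 0"
      then have k: "k < ?m" using b by (cases "k < ?m") (auto simp: mat_syzygies_def A)
      \<comment> \<open>The graded component of the syzygy in the degree of the k-th generator.
        There the k-th coefficient has degree 0, so it is a nonzero constant and can be
        inverted.\<close>
      define a where "a c = hom_comp (\<lambda>_. 1) (int (ss' ! k) - int (ss' ! c)) (b c)" for c
      have ak: "a k = Const (coef (b k) 0)"
        using homog_1_0[of "a k"] by (simp add: a_def coef_comp)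
      have rel: "(\<Sum>c<?m. a c * fst (xs ! c) r) = 0" for r
      proof (cases "r < ?n")
        case True
        then show ?thesis using syz_comp[OF b True, of "int (ss' ! k)"] by (simp add: a_def Aidx mult.commute)
      next
        case False
        then show ?thesis using supp[OF GZ[OF xsG]] by simp
      qed
      define H where "H = G - {xs ! k}"
      have fst_k: "fst (xs ! k) \<in> fm.span (fst ` H)"
      proof -
        have "Const (coef (b k) 0) * fst (xs ! k) r = - (\<Sum>c\<in>{..<?m} - {k}. a c * fst (xs ! c) r)" for r
          using rel[of r] k by (simp add: sum.remove[of "{..<?m}" k] ak eq_neg_iff_add_eq_0)
        then have "Const (inverse (coef (b k) 0)) * (Const (coef (b k) 0) * fst (xs ! k) r) =
            Const (inverse (coef (b k) 0)) * - (\<Sum>c\<in>{..<?m} - {k}. a c * fst (xs ! c) r)" for r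
          by simp
        then have "fst (xs ! k) r = (\<Sum>c\<in>{..<?m} - {k}. - Const (inverse (coef (b k) 0)) * a c * fst (xs ! c) r)" for r
          using ne by (simp add: mult.assoc[symmetric] Const_simps(4)[symmetric] sum_distrib_left sum_negf[symmetric] del: Const_simps(4))
        then have "fst (xs ! k) = (\<Sum>c\<in>{..<?m} - {k}. (\<lambda>r. (- Const (inverse (coef (b k) 0)) * a c) * fst (xs ! c) r))"
          by (auto simp: fun_eq_iff sum_fun_apply)
        moreover have "xs ! c \<in> H" if "c \<in> {..<?m} - {k}" for c
          using that xsG[of c] k xs(2) lenm by (auto simp: H_def nth_eq_iff_index_eq)
        then have "(\<Sum>c\<in>{..<?m} - {k}. (\<lambda>r. (- Const (inverse (coef (b k) 0)) * a c) * fst (xs ! c) r)) \<in> fm.span (fst ` H)"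
          by (intro fm.span_sum fm.span_scale fm.span_base imageI)
        ultimately show ?thesis by metis
      qed
      have "fst x \<in> fm.span (fst ` H)" if "x \<in> G" for x
        using fst_k fm.span_base[of "fst x" "fst ` H"] that by (cases "x = xs ! k") (auto simp: H_def)
      then have "fm.span (fst ` G) \<subseteq> fm.span (fst ` H)" by (intro fm.span_minimal fm.subspace_span) auto
      then have "gen H" using G(1) by (auto simp: gen_def H_def)
      then have "card G \<le> card H" by (rule G(2))
      moreover have "card H < card G" unfolding H_def using xsG[OF k] finG by (intro psubset_card_mono) auto
      ultimately show False by simp
    qed
  qed
  then show ?thesis using A(1) img Ahom const[OF GZ[OF xsG]]
    by (intro exI[of _ ss'] exI[of _ A]) (simp add: homogeneous_diff_iff Aidx)
qed

lemma irrelevant_idealI: "coef p 0 = 0 \<Longrightarrow> p \<in> irrelevant_ideal"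
  for p :: "('v::finite, 'k::comm_ring_1) mpoly"
  unfolding irrelevant_ideal_def genideal_class_ring by (rule in_span_range_Var)

text \<open>Without existence the pick by \<open>SOME\<close> in \<open>graded_betti\<close> would
  be arbitrary. Minimal presentations are spliced, beginning with \<open>I\<close> as a submodule of
  the free module of rank 1; that \<open>I\<close> has no constant terms makes the first map
  minimal.\<close>

theorem ex_minimal_graded_free_resolution:
  fixes I :: "('v::finite, 'k::field) mpoly set"
  assumes I: "idl.subspace I" and hom: "\<And>p j. p \<in> I \<Longrightarrow> hom_comp (\<lambda>_. 1) j p \<in> I"
    and const: "\<And>p. p \<in> I \<Longrightarrow> coef p 0 = 0"
  shows "\<exists>s \<phi> \<epsilon>. minimal_graded_free_resolution I s \<phi> \<epsilon>"
proof -
  define Z0 where "Z0 = {z :: nat \<Rightarrow> ('v, 'k) mpoly. (\<forall>i\<ge>1. z i = 0) \<and> z 0 \<in> I}"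
  have Z0: "graded_submodule [0] Z0"
    unfolding graded_submodule_def
  proof (intro conjI ballI allI impI)
    show "fm.subspace Z0"
      using idl.subspace_0[OF I] idl.subspace_add[OF I] idl.subspace_scale[OF I] by (auto simp: Z0_def fm.subspace_def)
    show "coef (z i) 0 = 0" if "z \<in> Z0" for z i using that const by (cases i) (auto simp: Z0_def)
    show "vcomp [0] t z \<in> Z0" if "z \<in> Z0" for z t using that hom by (auto simp: Z0_def vcomp_def)
  qed (auto simp: Z0_def)
  \<comment> \<open>A state consists of the degrees of a free module and the submodule that the next
    map has to cover; the syzygies of this map are the submodule of the next state.\<close>
  define rel where "rel x y \<longleftrightarrow> (\<exists>A. A \<in> carrier_mat (length (fst x)) (length (fst y)) \<and>
    (\<forall>r<length (fst x). \<forall>c<length (fst y). A $$ (r, c) \<in> homogeneous_diff (fst y ! c) (fst x ! r) \<and> coef (A $$ (r, c)) 0 = 0) \<and>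
    mat_image A = vec (length (fst x)) ` snd x \<and> snd y = mat_syzygies A)"
    for x y :: "nat list \<times> (nat \<Rightarrow> ('v, 'k) mpoly) set"
  have "\<exists>f. \<forall>i. ((case f i of (ss, Z) \<Rightarrow> graded_submodule ss Z) \<and> (i = 0 \<longrightarrow> f i = ([0], Z0))) \<and> rel (f i) (f (Suc i))"
  proof (rule dependent_nat_choice)
    show "\<exists>x. (case x of (ss, Z) \<Rightarrow> graded_submodule ss Z) \<and> (0 = (0 :: nat) \<longrightarrow> x = ([0], Z0))" using Z0 by auto
  next
    fix x :: "nat list \<times> (nat \<Rightarrow> ('v, 'k) mpoly) set" and i :: nat
    assume "(case x of (ss, Z) \<Rightarrow> graded_submodule ss Z) \<and> (i = 0 \<longrightarrow> x = ([0], Z0))"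
    then have "graded_submodule (fst x) (snd x)" by (simp add: case_prod_beta)
    then obtain ss' A where "A \<in> carrier_mat (length (fst x)) (length ss')"
      "\<forall>r<length (fst x). \<forall>c<length ss'. A $$ (r, c) \<in> homogeneous_diff (ss' ! c) (fst x ! r) \<and> coef (A $$ (r, c)) 0 = 0"
      "mat_image A = vec (length (fst x)) ` snd x" "graded_submodule ss' (mat_syzygies A)"
      using minimal_presentation by blast
    then show "\<exists>y. ((case y of (ss, Z) \<Rightarrow> graded_submodule ss Z) \<and> (Suc i = 0 \<longrightarrow> y = ([0], Z0))) \<and> rel x y"
      by (intro exI[of _ "(ss', mat_syzygies A)"]) (auto simp: rel_def)
  qed
  then obtain f where f0: "f 0 = ([0], Z0)" and f: "\<And>i. rel (f i) (f (Suc i))" by blast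
  define s where "s i = fst (f i)" for i
  define Z where "Z i = snd (f i)" for i
  have "\<exists>A. A \<in> carrier_mat (length (s i)) (length (s (Suc i))) \<and>
    (\<forall>r<length (s i). \<forall>c<length (s (Suc i)). A $$ (r, c) \<in> homogeneous_diff (s (Suc i) ! c) (s i ! r) \<and> coef (A $$ (r, c)) 0 = 0) \<and>
    mat_image A = vec (length (s i)) ` Z i \<and> Z (Suc i) = mat_syzygies A" for i
    using f[of i] unfolding rel_def s_def Z_def .
  then obtain \<phi> where \<phi>: "\<And>i. \<phi> i \<in> carrier_mat (length (s i)) (length (s (Suc i)))"
    "\<And>i r c. r < length (s i) \<Longrightarrow> c < length (s (Suc i)) \<Longrightarrow> \<phi> i $$ (r, c) \<in> homogeneous_diff (s (Suc i) ! c) (s i ! r) \<and> coef (\<phi> i $$ (r, c)) 0 = 0"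
    "\<And>i. mat_image (\<phi> i) = vec (length (s i)) ` Z i" "\<And>i. Z (Suc i) = mat_syzygies (\<phi> i)"
    by metis
  have s0: "s 0 = [0]" "Z 0 = Z0" by (simp_all add: s_def Z_def f0)
  define \<epsilon> where "\<epsilon> = vec 1 (\<lambda>_. 1 :: ('v, 'k) mpoly)"
  have eps: "\<epsilon> \<bullet> v = v $ 0" if "v \<in> carrier_vec 1" for v
    using that by (simp add: \<epsilon>_def scalar_prod_def)
  have "graded_free_resolution I s \<phi> \<epsilon>"
    unfolding graded_free_resolution_def
  proof (intro conjI allI impI)
    show "\<epsilon> \<in> carrier_vec (length (s 0))" by (simp add: s0 \<epsilon>_def)
    show "\<epsilon> $ k \<in> homogeneous (s 0 ! k)" if "k < length (s 0)" for k
      using that by (simp add: s0 \<epsilon>_def homogeneous_diff_iff)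
    show "\<exists>v\<in>carrier_vec (length (s 0)). p - \<epsilon> \<bullet> v \<in> I" for p
      using idl.subspace_0[OF I] by (intro bexI[of _ "vec 1 (\<lambda>_. p)"]) (simp_all add: s0 eps)
    show "{v \<in> carrier_vec (length (s 0)). \<epsilon> \<bullet> v \<in> I} = mat_image (\<phi> 0)"
    proof -
      have "v \<in> vec 1 ` Z0" if "v \<in> carrier_vec 1" "v $ 0 \<in> I" for v
      proof
        show "v = vec 1 (\<lambda>i. if i = 0 then v $ 0 else 0)" using that(1) by (intro eq_vecI) auto
        show "(\<lambda>i. if i = 0 then v $ 0 else 0) \<in> Z0" using that(2) by (simp add: Z0_def)
      qed
      moreover have "vec 1 z \<in> carrier_vec 1 \<and> vec 1 z $ 0 \<in> I" if "z \<in> Z0" for z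
        using that by (simp add: Z0_def)
      ultimately show ?thesis by (auto simp: \<phi>(3) s0 eps)
    qed
    show "mat_kernel (\<phi> i) = mat_image (\<phi> (Suc i))" for i
      using \<phi>(1)[of i] by (simp add: \<phi>(3,4) mat_kernel_syzygies)
  qed (use \<phi> in auto)
  then have "minimal_graded_free_resolution I s \<phi> \<epsilon>"
    using \<phi>(2) by (auto simp: minimal_graded_free_resolution_def intro!: irrelevant_idealI)
  then show ?thesis by blast
qed

section \<open>A lower bound for the regularity\<close>

text \<open>A cycle modulo the ideal that is not a boundary, in exterior degree N with coefficients
  of degree N, hence a nonzero class of total degree 2N. Indices and coefficients are confined to
  the vertices covered by edges, so that variables at other vertices can be set to zero without
  changing it.\<close>

definition koszul_class :: "'n::finite set set \<Rightarrow> nat \<Rightarrow> (('n \<times> 'd::finite) set \<Rightarrow> ('n \<times> 'd, 'k::comm_ring_1) mpoly) \<Rightarrow> bool" where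
  "koszul_class E N z \<longleftrightarrow> (\<forall>A. z A \<noteq> 0 \<longrightarrow> card A = N \<and> A \<subseteq> \<Union>E \<times> UNIV) \<and>
     (\<forall>A. homog (\<lambda>_. 1) (int N) (z A)) \<and> (\<forall>A. poly_in (\<Union>E \<times> UNIV) (z A)) \<and>
     (\<forall>A. koszul z A \<in> idl.span (lss_gens E)) \<and> (\<nexists>y. \<forall>A. z A - koszul y A \<in> idl.span (lss_gens E))"

text \<open>The class of 1 is nonzero because a boundary in exterior degree 0 vanishes when all
  variables are set to zero.\<close>

lemma koszul_class_empty: "koszul_class {} 0 (\<lambda>A. if A = {} then 1 else 0 :: ('n::finite \<times> 'd::finite, 'k::field) mpoly)"
proof -
  have "(1 :: ('n \<times> 'd, 'k) mpoly) \<noteq> koszul y {}" for y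
  proof
    assume "(1 :: ('n \<times> 'd, 'k) mpoly) = koszul y {}"
    then have "poly_subst (kill UNIV) (1 :: ('n \<times> 'd, 'k) mpoly) = poly_subst (kill UNIV) (koszul y {})" by simp
    then show False by (simp add: koszul_on_def kill_def)
  qed
  moreover have "koszul (\<lambda>A. if A = {} then 1 else 0 :: ('n \<times> 'd, 'k) mpoly) A = 0" for A
    by (simp add: koszul_on_def)
  moreover have "poly_in {} (1 :: ('n \<times> 'd, 'k) mpoly)" using poly_in_Const[of "{}" 1] by simp
  ultimately show ?thesis by (auto simp: koszul_class_def lss_gens_def)
qed

lemma poly_subst_cong:
  assumes "poly_in Z p" "\<And>x. x \<in> Z \<Longrightarrow> f x = g x"
  shows "poly_subst f p = poly_subst g p"
proof -
  have "mono_subst f m = mono_subst g m" if "m \<in> Poly_Mapping.keys p" for m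
    unfolding mono_subst_def
  proof (rule prod.cong[OF refl])
    fix x
    have "expo m x = 0" if "x \<notin> Z"
      using assms(1) that \<open>m \<in> Poly_Mapping.keys p\<close> by (auto simp: poly_in_def in_keys_iff subset_iff)
    then show "f x ^ expo m x = g x ^ expo m x" using assms(2) by (cases "x \<in> Z") auto
  qed
  then show ?thesis unfolding poly_subst_def by simp
qed

lemma kill_disjoint:
  assumes "poly_in Z p" "Z \<inter> S = {}" shows "poly_subst (kill S) p = p"
proof -
  have "poly_subst (kill S) p = poly_subst Var p"
    using assms(1) by (rule poly_subst_cong) (use assms(2) in \<open>auto simp: kill_def\<close>)
  then show ?thesis by simp
qed

text \<open>Setting the variables of \<open>U\<close> to zero retracts the ring of the graph onto
  that of the induced subgraph on the other vertices. If the class became a boundary in the larger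
  graph, the retraction would make it a boundary already in the smaller one.\<close>

lemma koszul_class_delete_vertices:
  fixes E :: "'n::finite set set" and z :: "('n \<times> 'd::finite) set \<Rightarrow> ('n \<times> 'd, 'k::comm_ring_1) mpoly"
  assumes z: "koszul_class {e \<in> E. e \<inter> U = {}} N z"
  shows "koszul_class E N z"
proof -
  let ?E' = "{e \<in> E. e \<inter> U = {}}"
  define UU where "UU = U \<times> (UNIV :: 'd set)"
  let ?k = "poly_subst (kill UU) :: ('n \<times> 'd, 'k) mpoly \<Rightarrow> _"
  have sub: "\<Union>?E' \<subseteq> \<Union>E" by auto
  have dis: "(\<Union>?E' \<times> UNIV) \<inter> UU = {}" by (auto simp: UU_def)
  have gens: "lss_gens ?E' \<subseteq> (lss_gens E :: ('n \<times> 'd, 'k) mpoly set)" by (auto simp: lss_gens_def)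
  have k_span: "?k p \<in> idl.span (lss_gens ?E')" if p: "p \<in> idl.span (lss_gens E)" for p
  proof (rule poly_subst_span[OF p])
    fix g :: "('n \<times> 'd, 'k) mpoly" assume "g \<in> lss_gens E"
    then obtain i j where ij: "g = dot UNIV i j" "{i, j} \<in> E" by (auto simp: lss_gens_def)
    show "?k g \<in> idl.span (lss_gens ?E')"
    proof (cases "i \<in> U \<or> j \<in> U")
      case True
      then have "?k g = 0" by (auto simp: ij dot_def kill_def UU_def)
      then show ?thesis by (simp add: idl.span_zero)
    next
      case False
      then have "?k g = g" by (simp add: ij dot_def kill_def UU_def)
      moreover have "g \<in> lss_gens ?E'" using False ij by (auto simp: lss_gens_def)
      ultimately show ?thesis by (simp add: idl.span_base)
    qed
  qed
  have "\<nexists>y. \<forall>A. z A - koszul y A \<in> idl.span (lss_gens E)"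
  proof
    assume "\<exists>y. \<forall>A. z A - koszul y A \<in> idl.span (lss_gens E)"
    then obtain y where y: "\<And>A. z A - koszul y A \<in> idl.span (lss_gens E)" by blast
    \<comment> \<open>The retraction on chains: exterior indices at \<open>U\<close> are dropped
      together with the variables.\<close>
    define y' where "y' A = (if A \<inter> UU = {} then ?k (y A) else 0)" for A
    have "z A - koszul y' A \<in> idl.span (lss_gens ?E')" for A
    proof (cases "A \<inter> UU = {}")
      case True
      have "koszul y' A = ?k (koszul y A)"
        unfolding koszul_on_def poly_subst_sum
      proof (rule sum.cong[OF refl])
        fix v assume "v \<in> UNIV - A"
        have "?k (ksgn v A) = ksgn v A" by (simp add: ksgn_def)
        then show "ksgn v A * Var v * y' (insert v A) = ?k (ksgn v A * Var v * y (insert v A))"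
          using True by (auto simp: y'_def kill_def)
      qed
      moreover have "?k (z A) = z A"
        using z dis by (intro kill_disjoint[of "\<Union>?E' \<times> UNIV"]) (simp_all add: koszul_class_def)
      ultimately show ?thesis using k_span[OF y[of A]] by simp
    next
      case False
      then have "koszul y' A = 0" unfolding koszul_on_def by (intro sum.neutral) (auto simp: y'_def)
      moreover have "z A = 0"
      proof (rule ccontr)
        assume "z A \<noteq> 0"
        then have "A \<subseteq> \<Union>?E' \<times> UNIV" using z by (simp add: koszul_class_def)
        then show False using False dis by blast
      qed
      ultimately show ?thesis by (simp add: idl.span_zero)
    qed
    then show False using z unfolding koszul_class_def by blast
  qed
  moreover have "poly_in (\<Union>E \<times> UNIV) (z A)" for A
    using z sub unfolding koszul_class_def poly_in_def by blast
  moreover have "koszul z A \<in> idl.span (lss_gens E)" for A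
    using z idl.span_mono[OF gens] unfolding koszul_class_def by blast
  moreover have "card A = N \<and> A \<subseteq> \<Union>E \<times> UNIV" if "z A \<noteq> 0" for A
    using z sub that unfolding koszul_class_def by blast
  ultimately show ?thesis using z unfolding koszul_class_def by blast
qed

text \<open>For the weight of one coordinate at the new vertex, the leading term of the quadric is a
  product of two variables. Both are nonzerodivisors, the one at \<open>u\<close> by the degree
  bound and the one at \<open>l\<close> because no edge meets \<open>l\<close>; top components are
  removed successively.\<close>

lemma dot_leaf_nonzerodivisor:
  fixes E :: "'n::finite set set" and h :: "('n \<times> 'd::finite, 'k::field) mpoly"
  assumes E: "bridged E" and l: "l \<notin> \<Union>E" "u \<noteq> l" and deg: "edge_deg E u < card (UNIV :: 'd set)"
    and h: "dot UNIV u l * h \<in> idl.span (lss_gens E)"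
  shows "h \<in> idl.span (lss_gens E)"
proof -
  obtain k :: 'd where True by blast
  define W where "W x = (if x = (l, k) then 1 else 0 :: int)" for x
  let ?x = "Var (u, k) :: ('n \<times> 'd, 'k) mpoly" and ?y = "Var (l, k) :: ('n \<times> 'd, 'k) mpoly"
  have hom_gens: "\<exists>a. homog W a g" if "g \<in> lss_gens E" for g :: "('n \<times> 'd, 'k) mpoly"
  proof -
    obtain i j where ij: "g = dot UNIV i j" "{i, j} \<in> E" using \<open>g \<in> lss_gens E\<close> by (auto simp: lss_gens_def)
    then have "i \<noteq> l" "j \<noteq> l" using l(1) by auto
    then have "homog W 0 g" unfolding ij by (intro homog_dot) (simp add: W_def)
    then show ?thesis by blast
  qed
  have hom1: "homog W 1 (?x * ?y)" using l(2) by (intro homog_mult'[OF homog_Var homog_Var]) (auto simp: W_def)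
  have hom0: "homog W 0 (dot (UNIV - {k}) u l :: ('n \<times> 'd, 'k) mpoly)" by (intro homog_dot) (auto simp: W_def)
  have "{e \<in> E. l \<in> e} = {}" using l(1) by blast
  then have "edge_deg E l = 0" by (simp add: edge_deg_def)
  then have degl: "edge_deg E l < card (UNIV :: 'd set)" using deg by simp
  show ?thesis
    using h
  proof (induction "card {j. hom_comp W j h \<noteq> 0}" arbitrary: h rule: less_induct)
    case less
    let ?J = "{j. hom_comp W j h \<noteq> 0}"
    have "?J \<subseteq> wt W ` Poly_Mapping.keys h" using hom_comp_eq_0 by blast
    then have fin: "finite ?J" by (rule finite_subset) simp
    show ?case
    proof (cases "?J = {}")
      case True
      then have "h = 0" using sum_comp[of W h] by simp
      then show ?thesis by (simp add: idl.span_zero)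
    next
      case False
      define j where "j = Max ?J"
      have j: "hom_comp W j h \<noteq> 0" using Max_in[OF fin False] by (simp add: j_def)
      have j1: "hom_comp W (j + 1) h = 0" using Max_ge[OF fin, of "j + 1"] by (auto simp: j_def)
      let ?h = "hom_comp W j h"
      have "hom_comp W (j + 1) (dot UNIV u l * h) \<in> idl.span (lss_gens E)"
        by (rule hom_comp_span[OF less.prems hom_gens])
      also have "hom_comp W (j + 1) (dot UNIV u l * h) = ?x * (?y * ?h)"
        using hom_comp_mult_homog[OF hom1, of "j + 1" h] hom_comp_mult_homog[OF hom0, of "j + 1" h] j1
        by (simp add: dot_remove[of k UNIV] distrib_right hom_comp_add mult.assoc)
      finally have "?y * ?h \<in> idl.span (lss_gens E)" by (rule Var_nonzerodivisor[OF E deg])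
      then have hh: "?h \<in> idl.span (lss_gens E)" by (rule Var_nonzerodivisor[OF E degl])
      have diff: "hom_comp W i (h - ?h) = (if i = j then 0 else hom_comp W i h)" for i
        by (simp add: hom_comp_diff hom_comp_homog[OF homog_comp])
      have "{i. hom_comp W i (h - ?h) \<noteq> 0} \<subset> ?J" using j by (auto simp: diff)
      then have "card {i. hom_comp W i (h - ?h) \<noteq> 0} < card ?J" using fin by (rule psubset_card_mono[rotated])
      moreover have "dot UNIV u l * (h - ?h) \<in> idl.span (lss_gens E)"
        unfolding right_diff_distrib by (rule idl.span_diff[OF less.prems idl.span_scale[OF hh]])
      ultimately have "h - ?h \<in> idl.span (lss_gens E)" by (rule less.hyps)
      then show ?thesis using idl.span_add[OF _ hh, of "h - ?h"] by simp
    qed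
  qed
qed

text \<open>Multiplying a class by \<open>\<beta>\<close> with \<open>d\<beta> = q\<close> is a section of the surjection \<open>H\<^sub>N\<^sub>+\<^sub>1(R/(I + q)) \<rightarrow> H\<^sub>N(R/I)\<close> of the
  long exact sequence of a nonzerodivisor \<open>q\<close>.\<close>

lemma koszul_class_add_leaf:
  fixes E :: "'n::finite set set" and z :: "('n \<times> 'd::finite) set \<Rightarrow> ('n \<times> 'd, 'k::field) mpoly"
  assumes E: "bridged E" and l: "l \<notin> \<Union>E" "u \<noteq> l" and deg: "edge_deg E u < card (UNIV :: 'd set)"
    and z: "koszul_class E N z"
  shows "\<exists>z' :: ('n \<times> 'd) set \<Rightarrow> ('n \<times> 'd, 'k) mpoly. koszul_class (insert {u, l} E) (Suc N) z'"
proof -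
  \<comment> \<open>The 1-chain with coefficient \<open>x_{u,k}\<close> at each
    \<open>e_{l,k}\<close>; its boundary is the quadric \<open>q\<close> of the new edge.\<close>
  define b where "b x = (if fst x = l then Var (u, snd x) else 0 :: ('n \<times> 'd, 'k) mpoly)" for x :: "'n \<times> 'd"
  define q where "q = (dot UNIV u l :: ('n \<times> 'd, 'k) mpoly)"
  let ?E = "insert {u, l} E"
  let ?L = "idl.span (lss_gens E) :: ('n \<times> 'd, 'k) mpoly set"
  let ?L' = "idl.span (lss_gens ?E) :: ('n \<times> 'd, 'k) mpoly set"
  have supp: "\<And>A. z A \<noteq> 0 \<Longrightarrow> card A = N \<and> A \<subseteq> \<Union>E \<times> UNIV" and hom: "\<And>A. homog (\<lambda>_. 1) (int N) (z A)"
    and pin: "\<And>A. poly_in (\<Union>E \<times> UNIV) (z A)" and cyc: "\<And>A. koszul z A \<in> ?L" and nbd: "\<nexists>y. \<forall>A. z A - koszul y A \<in> ?L"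
    using z by (auto simp: koszul_class_def)
  have gens: "lss_gens ?E = insert q (lss_gens E)"
  proof
    show "lss_gens ?E \<subseteq> insert q (lss_gens E)"
      by (auto simp: lss_gens_def q_def doubleton_eq_iff dot_commute)
    show "insert q (lss_gens E) \<subseteq> lss_gens ?E"
      unfolding lss_gens_def q_def by blast
  qed
  have LL: "?L \<subseteq> ?L'" unfolding gens by (rule idl.span_mono) auto
  have qL: "q \<in> ?L'" unfolding gens by (rule idl.span_base) simp
  have bq: "(\<Sum>v\<in>UNIV. Var v * b v) = q"
  proof -
    have "(\<Sum>v\<in>UNIV. Var v * b v) = (\<Sum>v\<in>Pair l ` UNIV. Var v * b v)"
      by (rule sum.mono_neutral_right) (auto simp: b_def image_iff)
    also have "\<dots> = (\<Sum>k\<in>UNIV. Var (l, k) * b (l, k))" by (subst sum.reindex) (auto simp: inj_on_def)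
    finally show ?thesis by (simp add: b_def q_def dot_def mult.commute)
  qed
  let ?z = "wedge b z"
  have kz: "koszul ?z A = q * z A - wedge b (koszul z) A" for A
    using koszul_wedge[of b z A] by (simp add: bq)
  have wL: "wedge b (koszul z) A \<in> ?L" for A by (rule wedge_mem) (simp_all add: cyc)
  have "koszul_class ?E (Suc N) ?z"
    unfolding koszul_class_def
  proof (intro conjI allI impI)
    fix A assume "?z A \<noteq> 0"
    then obtain v where v: "v \<in> A" "b v \<noteq> 0" "z (A - {v}) \<noteq> 0"
      unfolding wedge_def by (metis (no_types, lifting) mult_zero_left mult_zero_right sum.neutral)
    then have "card (A - {v}) = N" "A - {v} \<subseteq> \<Union>E \<times> UNIV" using supp by auto
    moreover have "fst v = l" using v(2) by (auto simp: b_def split: if_splits)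
    ultimately show "card A = Suc N" "A \<subseteq> \<Union>?E \<times> UNIV"
      using v(1) by (auto simp: card_Suc_Diff1[symmetric] simp del: card_Diff_insert)
  next
    fix A
    have "homog (\<lambda>_. 1) 0 (ksgn v B :: ('n \<times> 'd, 'k) mpoly)" for v B
      unfolding ksgn_def by (cases "even (card {a \<in> B. var_index a < var_index v})") (auto intro: homog_uminus)
    moreover have "homog (\<lambda>_. 1) 1 (b v)" for v by (auto simp: b_def intro: homog_Var)
    ultimately show "homog (\<lambda>_. 1) (int (Suc N)) (?z A)"
      unfolding wedge_def by (intro homog_sum homog_mult'[OF homog_mult'[of _ 0 _ 1 _ 1] hom]) auto
  next
    fix A
    have "poly_in (\<Union>?E \<times> UNIV) (ksgn v B :: ('n \<times> 'd, 'k) mpoly)" for v B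
      unfolding ksgn_def using poly_in_Const[of _ "1 :: 'k"] poly_in_uminus[of _ "1 :: ('n \<times> 'd, 'k) mpoly"]
      by (cases "even (card {a \<in> B. var_index a < var_index v})") auto
    moreover have "poly_in (\<Union>?E \<times> UNIV) (b v)" for v by (auto simp: b_def intro: poly_in_Var)
    moreover have "poly_in (\<Union>?E \<times> UNIV) (z B)" for B using pin[of B] unfolding poly_in_def by blast
    ultimately show "poly_in (\<Union>?E \<times> UNIV) (?z A)"
      unfolding wedge_def by (intro poly_in_sum poly_in_mult) auto
  next
    fix A
    have "z A * q \<in> ?L'" using qL by (rule idl.span_scale)
    then show "koszul ?z A \<in> ?L'" unfolding kz using wL[of A] LL by (auto simp: mult.commute intro!: idl.span_diff)
  next
    show "\<nexists>y. \<forall>A. ?z A - koszul y A \<in> ?L'"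
    proof
      assume "\<exists>y. \<forall>A. ?z A - koszul y A \<in> ?L'"
      then obtain y where "\<And>A. ?z A - koszul y A \<in> ?L'" by blast
      then have "\<forall>A. \<exists>c. ?z A - koszul y A - c * q \<in> ?L" unfolding gens idl.span_breakdown_eq by blast
      then obtain c where c: "\<And>A. ?z A - koszul y A - c A * q \<in> ?L" by metis
      \<comment> \<open>Taking boundaries of the relation that defines \<open>c\<close> turns it
        into \<open>q\<close> times the desired difference, modulo the ideal, and \<open>q\<close>
        can be cancelled.\<close>
      have "z A - koszul c A \<in> ?L" for A
      proof -
        have "koszul (\<lambda>A. ?z A - koszul y A - q * c A) A \<in> ?L"
          by (rule koszul_on_mem) (use c in \<open>simp_all add: mult.commute\<close>)
        then have "q * z A - wedge b (koszul z) A - q * koszul c A \<in> ?L"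
          by (simp add: koszul_on_diff koszul_on_scale koszul_koszul kz)
        then have "(q * z A - wedge b (koszul z) A - q * koszul c A) + wedge b (koszul z) A \<in> ?L"
          by (rule idl.span_add[OF _ wL])
        then have "q * (z A - koszul c A) \<in> ?L" by (simp add: right_diff_distrib)
        then show ?thesis unfolding q_def by (rule dot_leaf_nonzerodivisor[OF E l deg])
      qed
      then show False using nbd by blast
    qed
  qed
  then show ?thesis by blast
qed

text \<open>The class forces a basis element of degree 2N at place N of the chosen resolution, and
  2N - N = N enters the supremum.\<close>

lemma reg_quotient_ge:
  fixes E :: "'n::finite set set" and z :: "('n \<times> 'd::finite) set \<Rightarrow> ('n \<times> 'd, 'k::field) mpoly"
  assumes z: "koszul_class E N z"
  shows "ereal (real N) \<le> reg_quotient (lss_ideal E :: ('n \<times> 'd, 'k) mpoly set)"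
proof -
  let ?I = "idl.span (lss_gens E) :: ('n \<times> 'd, 'k) mpoly set"
  have I: "lss_ideal E = ?I" by (rule lss_ideal_eq)
  have hom: "hom_comp (\<lambda>_. 1) j p \<in> ?I" if p: "p \<in> ?I" for p j
  proof (rule hom_comp_span[OF p])
    fix g :: "('n \<times> 'd, 'k) mpoly" assume "g \<in> lss_gens E"
    then obtain i j where "g = dot UNIV i j" by (auto simp: lss_gens_def)
    then have "homog (\<lambda>_. 1) 2 g" by (auto intro: homog_dot)
    then show "\<exists>i. homog (\<lambda>_. 1) i g" by blast
  qed
  have const: "coef p 0 = 0" if p: "p \<in> ?I" for p
  proof -
    have "poly_subst (kill UNIV) p \<in> idl.span {}"
      by (rule poly_subst_span[OF p]) (auto simp: lss_gens_def dot_def kill_def)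
    then have "Const (coef p 0) = (0 :: ('n \<times> 'd, 'k) mpoly)" by (simp add: poly_subst_kill_UNIV)
    then show ?thesis unfolding Const_def by (metis lookup_single_eq lookup_zero)
  qed
  define s where "s = (SOME s. \<exists>\<phi> \<epsilon>. minimal_graded_free_resolution ?I s \<phi> \<epsilon>)"
  have "\<exists>s \<phi> \<epsilon>. minimal_graded_free_resolution ?I s \<phi> \<epsilon>"
    by (rule ex_minimal_graded_free_resolution) (simp_all add: hom const)
  then have "\<exists>\<phi> \<epsilon>. minimal_graded_free_resolution ?I s \<phi> \<epsilon>"
    unfolding s_def by (rule someI_ex)
  then obtain \<phi> \<epsilon> where res: "graded_free_resolution ?I s \<phi> \<epsilon>" by (auto simp: minimal_graded_free_resolution_def)
  have "2 * N \<in> set (s N)"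
  proof (rule koszul_class_degree[OF _ _ res])
    show "idl.subspace ?I" by simp
    show "hom_comp (\<lambda>_. 1) j p \<in> ?I" if "p \<in> ?I" for p j using that by (rule hom)
    show "z A = 0" if "card A \<noteq> N" for A using z that unfolding koszul_class_def by blast
    show "homog (\<lambda>_. 1) (int N) (z A)" "koszul z A \<in> ?I" for A using z unfolding koszul_class_def by blast+
    show "\<nexists>y. \<forall>A. z A - koszul y A \<in> ?I" using z unfolding koszul_class_def by blast
  qed
  then have "graded_betti ?I N (2 * N) \<noteq> 0" by (simp add: graded_betti_def s_def count_list_0_iff)
  then have "ereal (real (2 * N) - real N) \<in> {ereal (real j - real i) | i j. graded_betti ?I i j \<noteq> 0}" by blast
  then have "ereal (real (2 * N) - real N) \<le> reg_quotient ?I" unfolding reg_quotient_def by (rule Sup_upper)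
  then show ?thesis by (simp add: I)
qed

text \<open>For d at least 2 a leaf has degree less than d and is never counted, so restoring a leaf
  edge can enlarge the counted set by its neighbour \<open>u\<close> only.\<close>

lemma ex_koszul_class:
  fixes E :: "'n::finite set set"
  assumes "bridged E" "2 \<le> card (UNIV :: 'd::finite set)"
  shows "\<exists>N (z :: ('n \<times> 'd) set \<Rightarrow> ('n \<times> 'd, 'k::field) mpoly).
    card {v. card (UNIV :: 'd set) \<le> edge_deg E v} \<le> N \<and> koszul_class E N z"
  using assms
proof (induction "card E" arbitrary: E rule: less_induct)
  case less
  note E = less.prems(1)
  let ?d = "card (UNIV :: 'd set)"
  let ?B = "\<lambda>E. {v. ?d \<le> edge_deg E v}"
  show ?case
  proof (cases "E = {}")
    case True
    then have "?B E = {}" using less.prems(2) by (simp add: edge_deg_def)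
    then show ?thesis using koszul_class_empty True by (metis card.empty le0)
  next
    case False
    then obtain p q where pq: "{p, q} \<in> E" using bridged_edgeE[OF E] by blast
    then obtain u l where ul: "{u, l} \<in> E" "\<And>e. e \<in> E \<Longrightarrow> l \<in> e \<Longrightarrow> e = {u, l}"
      using bridged_leaf[OF E pq] by blast
    define E' where "E' = E - {{u, l}}"
    have unl: "u \<noteq> l" by (rule bridged_neq[OF E ul(1)])
    have E': "bridged E'" by (rule bridged_subset[OF E]) (auto simp: E'_def)
    have "E' \<subset> E" using ul(1) by (auto simp: E'_def)
    then have "card E' < card E" by (rule psubset_card_mono[rotated]) simp
    then obtain N and z :: "('n \<times> 'd) set \<Rightarrow> ('n \<times> 'd, 'k) mpoly"
      where N: "card (?B E') \<le> N" "koszul_class E' N z" using less.hyps[OF _ E' less.prems(2)] by blast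
    have "{e \<in> E. l \<in> e} = {{u, l}}" using ul by blast
    then have dl: "edge_deg E l = 1" by (simp add: edge_deg_def)
    have du: "edge_deg E u = Suc (edge_deg E' u)" unfolding E'_def by (rule edge_deg_remove[OF ul(1)]) simp
    have dw: "edge_deg E w = edge_deg E' w" if "w \<noteq> u" "w \<noteq> l" for w
      unfolding E'_def using that by (intro edge_deg_remove_other[symmetric]) simp
    show ?thesis
    proof (cases "edge_deg E' u < ?d")
      case True
      have l: "l \<notin> \<Union>E'" using ul(2) by (auto simp: E'_def)
      have "insert {u, l} E' = E" using ul(1) by (auto simp: E'_def)
      then obtain z' :: "('n \<times> 'd) set \<Rightarrow> ('n \<times> 'd, 'k) mpoly" where z': "koszul_class E (Suc N) z'"
        using koszul_class_add_leaf[OF E' l unl True N(2)] by auto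
      have "?B E \<subseteq> insert u (?B E')" using dl dw less.prems(2) by force
      then have "card (?B E) \<le> card (insert u (?B E'))" by (intro card_mono) auto
      also have "\<dots> \<le> Suc (card (?B E'))" by (simp add: card_insert_if)
      finally show ?thesis using z' N(1) by (intro exI[of _ "Suc N"]) auto
    next
      case False
      \<comment> \<open>Here \<open>u\<close> was already counted before the edge was restored, so
        the set does not grow and it suffices that the class survives.\<close>
      have "v \<in> ?B E'" if "v \<in> ?B E" for v
        using that dl dw[of v] less.prems(2) False by (cases "v = u"; cases "v = l") auto
      then have "card (?B E) \<le> card (?B E')" by (intro card_mono) auto
      then have cN: "card (?B E) \<le> N" using N(1) by linarith
      have "{e \<in> E. e \<inter> {l} = {}} = E'"
      proof (rule Set.set_eqI)
        fix e
        show "e \<in> {e \<in> E. e \<inter> {l} = {}} \<longleftrightarrow> e \<in> E'"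
          using ul(2)[of e] by (cases "l \<in> e") (auto simp: E'_def)
      qed
      then have "koszul_class E N z" using N(2) by (intro koszul_class_delete_vertices[of E "{l}"]) simp
      then show ?thesis using cN by blast
    qed
  qed
qed

section \<open>Dimension one\<close>

text \<open>Each round takes the neighbour \<open>u\<close> of a leaf \<open>l\<close> into
  \<open>A\<close> and discards \<open>u\<close> and all its neighbours. The edges
  \<open>{u, l}\<close> form an induced matching, each raising N by one, and the discarded edges all
  contain a neighbour of \<open>u\<close>.\<close>

lemma edge_ideal_class:
  fixes E :: "'n::finite set set"
  assumes "bridged E" "card (UNIV :: 'd::finite set) = 1"
  shows "\<exists>N (z :: ('n \<times> 'd) set \<Rightarrow> ('n \<times> 'd, 'k::field) mpoly) A. koszul_class E N z \<and> card A \<le> N \<and>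
    A \<subseteq> \<Union>E \<and> (\<forall>a\<in>A. \<forall>b\<in>A. {a, b} \<notin> E) \<and> (\<forall>e\<in>E. \<exists>a\<in>A. \<exists>w\<in>e. {a, w} \<in> E)"
  using assms(1)
proof (induction "card E" arbitrary: E rule: less_induct)
  case less
  note E = less.prems
  show ?case
  proof (cases "E = {}")
    case True
    then show ?thesis using koszul_class_empty by (intro exI[of _ 0] exI[of _ "\<lambda>A. if A = {} then 1 else 0"] exI[of _ "{}"]) auto
  next
    case False
    then obtain p q where pq: "{p, q} \<in> E" using bridged_edgeE[OF E] by blast
    then obtain u l where ul: "{u, l} \<in> E" "\<And>e. e \<in> E \<Longrightarrow> l \<in> e \<Longrightarrow> e = {u, l}"
      using bridged_leaf[OF E pq] by blast
    define M where "M = {w. {u, w} \<in> E}"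
    define E' where "E' = {e \<in> E. e \<inter> insert u M = {}}"
    have neq: "a \<noteq> b" if "{a, b} \<in> E" for a b by (rule bridged_neq[OF E that])
    have unl: "u \<noteq> l" by (rule neq[OF ul(1)])
    have uM: "u \<notin> M" using neq[of u u] by (auto simp: M_def)
    have lM: "l \<in> M" using ul(1) by (simp add: M_def)
    have E': "bridged E'" by (rule bridged_subset[OF E]) (auto simp: E'_def)
    have "E' \<subset> E" using ul(1) by (auto simp: E'_def)
    then have "card E' < card E" by (rule psubset_card_mono[rotated]) simp
    from less.hyps[OF this E'] obtain N A and z :: "('n \<times> 'd) set \<Rightarrow> ('n \<times> 'd, 'k) mpoly"
      where N: "koszul_class E' N z" "card A \<le> N" and A1: "A \<subseteq> \<Union>E'" "\<forall>a\<in>A. \<forall>b\<in>A. {a, b} \<notin> E'"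
        "\<forall>e\<in>E'. \<exists>a\<in>A. \<exists>w\<in>e. {a, w} \<in> E'"
      by (elim exE conjE)
    have A: "A \<subseteq> \<Union>E'" "\<And>a b. a \<in> A \<Longrightarrow> b \<in> A \<Longrightarrow> {a, b} \<notin> E'"
        "\<And>e. e \<in> E' \<Longrightarrow> \<exists>a\<in>A. \<exists>w\<in>e. {a, w} \<in> E'"
      using A1 by (simp, blast, simp)
    have l: "l \<notin> \<Union>E'" using lM by (auto simp: E'_def)
    have "{e \<in> E'. u \<in> e} = {}" by (auto simp: E'_def)
    then have "edge_deg E' u < card (UNIV :: 'd set)" using assms(2) by (simp add: edge_deg_def)
    then obtain z' :: "('n \<times> 'd) set \<Rightarrow> ('n \<times> 'd, 'k) mpoly" where z': "koszul_class (insert {u, l} E') (Suc N) z'"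
      using koszul_class_add_leaf[OF E' l unl _ N(1)] by blast
    have edge_u: "\<exists>w\<in>M. e = {u, w}" if "e \<in> E" "u \<in> e" for e
    proof -
      obtain a b where "e = {a, b}" using bridged_edgeE[OF E \<open>e \<in> E\<close>] by blast
      then show ?thesis using that by (auto simp: M_def insert_commute)
    qed
    \<comment> \<open>Deleting the other neighbours of \<open>u\<close> isolates the edge
      \<open>{u, l}\<close>, so the class lives on an induced subgraph of \<open>E\<close> and
      extends to \<open>E\<close>.\<close>
    have "insert {u, l} E' = {e \<in> E. e \<inter> (M - {l}) = {}}"
    proof
      show "insert {u, l} E' \<subseteq> {e \<in> E. e \<inter> (M - {l}) = {}}"
        using ul(1) uM by (auto simp: E'_def)
      show "{e \<in> E. e \<inter> (M - {l}) = {}} \<subseteq> insert {u, l} E'"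
      proof
        fix e assume "e \<in> {e \<in> E. e \<inter> (M - {l}) = {}}"
        then have e: "e \<in> E" "e \<inter> (M - {l}) = {}" by auto
        show "e \<in> insert {u, l} E'"
        proof (cases "l \<in> e \<or> u \<in> e")
          case True
          then show ?thesis using e ul(2)[of e] edge_u[of e] by blast
        next
          case False
          then show ?thesis using e by (auto simp: E'_def)
        qed
      qed
    qed
    then have zE: "koszul_class E (Suc N) z'" using z' koszul_class_delete_vertices by metis
    have AM: "a \<noteq> u \<and> a \<notin> M" if "a \<in> A" for a using A(1) that by (auto simp: E'_def)
    have finA: "finite A" by simp
    have "card (insert u A) \<le> Suc N" using N(2) AM by (simp add: card_insert_if)
    moreover have "insert u A \<subseteq> \<Union>E" using A(1) ul(1) by (auto simp: E'_def)
    moreover have "{a, b} \<notin> E" if ab: "a \<in> insert u A" "b \<in> insert u A" for a b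
    proof
      assume e: "{a, b} \<in> E"
      consider "a = u" | "b = u" | "a \<in> A" "b \<in> A" using ab by blast
      then show False
      proof cases
        case 1
        then show False using e ab AM[of b] neq[OF e] by (auto simp: M_def)
      next
        case 2
        then show False using e ab AM[of a] neq[OF e] by (auto simp: M_def insert_commute)
      next
        case 3
        then have "{a, b} \<in> E'" using e AM[of a] AM[of b] by (auto simp: E'_def)
        then show False using A(2) 3 by blast
      qed
    qed
    moreover have "\<exists>a\<in>insert u A. \<exists>w\<in>e. {a, w} \<in> E" if e: "e \<in> E" for e
    proof (cases "e \<in> E'")
      case True
      then show ?thesis using A(3)[OF True] by (auto simp: E'_def)
    next
      case False
      then obtain w where w: "w \<in> e" "w = u \<or> w \<in> M" using e by (auto simp: E'_def)
      then have "\<exists>w\<in>e. w \<in> M" using edge_u[OF e] by blast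
      then show ?thesis by (auto simp: M_def)
    qed
    ultimately show ?thesis using zE by blast
  qed
qed

text \<open>For d = 1 the generators are products of two variables. The colon ideal by the product
  over \<open>A\<close> is generated by the variables of the neighbours of \<open>A\<close>: these
  multiply the product into the ideal, while setting them to zero kills every edge and, by
  independence, leaves the product unchanged.\<close>

lemma v_number_edge_ideal_le:
  fixes E :: "'n::finite set set"
  assumes d: "card (UNIV :: 'd::finite set) = 1"
    and ind: "\<And>a b. a \<in> A \<Longrightarrow> b \<in> A \<Longrightarrow> {a, b} \<notin> E" and cov: "\<And>e. e \<in> E \<Longrightarrow> \<exists>a\<in>A. \<exists>w\<in>e. {a, w} \<in> E"
  shows "v_number (lss_ideal E :: ('n \<times> 'd, 'k::field) mpoly set) \<le> card A"
proof -
  obtain k :: 'd where k: "UNIV = {k}" using d by (auto simp: card_1_singleton_iff)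
  define f where "f = (\<Prod>a\<in>A. Var (a, k) :: ('n \<times> 'd, 'k) mpoly)"
  define S where "S = {w. \<exists>a\<in>A. {a, w} \<in> E} \<times> (UNIV :: 'd set)"
  let ?k = "poly_subst (kill S) :: ('n \<times> 'd, 'k) mpoly \<Rightarrow> _"
  let ?L = "idl.span (lss_gens E) :: ('n \<times> 'd, 'k) mpoly set"
  \<comment> \<open>The ideal generated by the variables in \<open>S\<close>, written as the kernel
    of setting them to zero, which makes its primality immediate.\<close>
  define P where "P = {g. ?k g = 0}"
  have "homog (\<lambda>_. 1) (\<Sum>a\<in>A. 1) f" unfolding f_def by (intro homog_prod) (simp add: homog_Var)
  then have f_hom: "f \<in> homogeneous (card A)" by (simp add: homogeneous_diff_iff)
  have P: "primeideal P class_ring"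
  proof (rule primeideal_class_ringI)
    show "idl.subspace P" by (auto simp: idl.subspace_def P_def)
    show "a * b \<in> P \<Longrightarrow> a \<in> P \<or> b \<in> P" for a b using mpoly_mult_eq_0D[of "?k a" "?k b"] by (simp add: P_def)
  qed (simp add: P_def)
  have kf: "?k f = f" using ind by (auto simp: f_def kill_def S_def intro!: prod.cong)
  have f0: "f \<noteq> 0"
  proof -
    have "(\<Prod>a\<in>B. Var (a, k) :: ('n \<times> 'd, 'k) mpoly) \<noteq> 0" if "finite B" for B
      using that by induction (auto dest!: mpoly_mult_eq_0D simp: Var_nonzero)
    then show ?thesis by (simp add: f_def)
  qed
  have k_L: "?k p = 0" if p: "p \<in> ?L" for p
  proof -
    have "?k p \<in> idl.span {}"
    proof (rule poly_subst_span[OF p])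
      fix g :: "('n \<times> 'd, 'k) mpoly" assume "g \<in> lss_gens E"
      then obtain i j where ij: "g = dot UNIV i j" "{i, j} \<in> E" by (auto simp: lss_gens_def)
      have "kill S (i, l) * kill S (j, l) = (0 :: ('n \<times> 'd, 'k) mpoly)" for l
      proof -
        have "(i, l) \<in> S \<or> (j, l) \<in> S" using cov[OF ij(2)] by (auto simp: S_def)
        then show ?thesis by (auto simp: kill_def)
      qed
      then show "?k g \<in> idl.span {}" by (simp add: ij dot_def)
    qed
    then show ?thesis by simp
  qed
  have "colon ?L f = P"
  proof
    show "colon ?L f \<subseteq> P"
    proof
      fix g assume "g \<in> colon ?L f"
      then have "?k (g * f) = 0" by (intro k_L) (simp add: colon_def)
      then show "g \<in> P" using mpoly_mult_eq_0D[of "?k g" f] f0 by (simp add: kf P_def)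
    qed
    show "P \<subseteq> colon ?L f"
    proof
      fix g assume "g \<in> P"
      then have "g \<in> idl.span (Var ` S)" using diff_kill_in_span[of g S] by (simp add: P_def)
      then have "g * f \<in> ?L"
      proof (induction rule: idl.span_induct_alt)
        case (step c x y)
        then obtain w l a where w: "x = Var (w, l)" "a \<in> A" "{a, w} \<in> E" by (auto simp: S_def)
        have "l = k" using k by auto
        then have "x * f = (\<Prod>b\<in>A - {a}. Var (b, k)) * dot UNIV a w"
          using w(1,2) by (simp add: f_def k dot_def prod.remove[of A a] mult_ac)
        moreover have "dot UNIV a w \<in> ?L" using w(3) by (intro idl.span_base) (auto simp: lss_gens_def)
        ultimately have "x * f \<in> ?L" by (simp add: idl.span_scale)
        then have "c * (x * f) + y * f \<in> ?L" using step by (intro idl.span_add idl.span_scale[of "x * f"])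
        then show ?case by (simp add: algebra_simps)
      qed (simp add: idl.span_zero)
      then show "g \<in> colon ?L f" by (simp add: colon_def)
    qed
  qed
  then have "colon (lss_ideal E) f \<in> Ass (lss_ideal E)" using P by (auto simp: Ass_def lss_ideal_eq)
  then show ?thesis by (rule v_number_le[OF f_hom])
qed

theorem theorem4p14:
  fixes E :: "'n::finite set set"
  assumes "forest E"
  shows "ereal (real (v_number (lss_ideal E :: ('n \<times> 'd::finite, 'k::alg_closed_field) mpoly set)))
           \<le> reg_quotient (lss_ideal E :: ('n \<times> 'd, 'k) mpoly set)"
proof -
  have E: "bridged E" using assms by (rule forest_bridged)
  let ?v = "v_number (lss_ideal E :: ('n \<times> 'd, 'k) mpoly set)"
  have "\<exists>N (z :: ('n \<times> 'd) set \<Rightarrow> ('n \<times> 'd, 'k) mpoly). koszul_class E N z \<and> ?v \<le> N"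
  proof (cases "2 \<le> card (UNIV :: 'd set)")
    case True
    then obtain k0 k1 :: 'd where "k0 \<noteq> k1" by (metis card_2_iff' UNIV_I card_le_Suc0_iff_eq finite not_less_eq_eq numeral_2_eq_2)
    then show ?thesis
      using v_number_lss_le[OF E, of k0 k1, where 'k = 'k] ex_koszul_class[OF E True, where 'k = 'k]
      by (meson order_trans)
  next
    case False
    moreover have "card (UNIV :: 'd set) \<noteq> 0" by simp
    ultimately have d: "card (UNIV :: 'd set) = 1" by linarith
    show ?thesis
      using edge_ideal_class[OF E d, where 'k = 'k] v_number_edge_ideal_le[OF d, where 'k = 'k and E = E]
      by (meson order_trans)
  qed
  then obtain N and z :: "('n \<times> 'd) set \<Rightarrow> ('n \<times> 'd, 'k) mpoly" where N: "koszul_class E N z" "?v \<le> N" by blast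
  have "ereal (real ?v) \<le> ereal (real N)" using N(2) by simp
  also have "\<dots> \<le> reg_quotient (lss_ideal E :: ('n \<times> 'd, 'k) mpoly set)" by (rule reg_quotient_ge[OF N(1)])
  finally show ?thesis .
qed

end
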